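(* Let $p\in[1,+\infty[$ and $\nu,\beta\in]0,+\infty[$. Let $\mathbf X$ be the Hunt process on $E$ with semigroup kernel $p_t(x,y)$ described in the context, and suppose that the life time condition, the Bishop type inequality, and the upper and lower heat kernel estimates described in the context all hold. Then the following are equivalent: (1) $\mathfrak m\in K_{\nu,\beta}^{\,p}=S_K^{\,p}$; (2) $\mathfrak m\in D_{\nu,\beta}^{\,p}=S_D^{\,p}$; (3) $\nu-p(\nu-\beta)>0$.
   Context: Notation: $]a,b[$ denotes an open interval, $a\lor b=\max\{a,b\}$; "increasing" and "decreasing" are in the wide (non-strict) sense. Setting. $(E,d)$ is a locally compact separable metric space, $\mathfrak m$ is a positive Radon measure on $E$ with full support, $B_r(x)=\{y\in E: d(x,y)<r\}$. $(\mathscr E,\mathscr F)$ is a symmetric regular Dirichlet form on $L^2(E;\mathfrak m)$, and $\mathbf X=(\Omega,X_t,\zeta,\mathbf P_x)$ is an associated Hunt process with life time $\zeta=\inf\{t\ge 0: X_t=\partial\}$ ($\partial$ the cemetery point of the one-point compactification). It is assumed that there is a jointly measurable nonnegative function $p_t(x,y)$, $(t,x,y)\in]0,+\infty[\times E\times E$ (semigroup kernel, or heat kernel) with $\mathbf E_x[u(X_t)]=\int_E p_t(x,y)u(y)\,\mathfrak m(dy)$ for all $x\in E$, $t>0$ and bounded Borel $u$; moreover $p_{t+s}(x,y)=\int_E p_s(x,z)p_t(z,y)\,\mathfrak m(dz)$ for all $x,y\in E$, $s,t>0$, and $\int_E p_t(x,y)\,\mathfrak m(dy)\le 1$. Assumptions.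 Fix $\nu,\beta\in]0,+\infty[$, $t_0\in]0,+\infty]$, and an increasing positive function $V$ on $]0,+\infty[$. - Life time condition: $\lim_{t\to0}\sup_{x\in E}\mathbf P_x(\zeta\le t)\in[0,1[$. - Bishop type inequality: $r\mapsto V(r)/r^\nu$ is increasing or bounded, and $\sup_{x\in E}\mathfrak m(B_r(x))\le V(r)$ for all $r>0$. - Upper and lower heat kernel estimates: there are positive decreasing functions $\Phi_1,\Phi_2$ on $[0,+\infty[$ (possibly depending on $t_0$ if $t_0<+\infty$) with $\int_1^\infty \frac{(V(t)\lor t^\nu)\Phi_2(t)}{t}\,dt<+\infty$ and, for all $x,y\in E$, $t\in]0,t_0[$, $$\frac{1}{t^{\nu/\beta}}\Phi_1\Big(\frac{d(x,y)}{t^{1/\beta}}\Big)\le p_t(x,y)\le \frac{1}{t^{\nu/\beta}}\Phi_2\Big(\frac{d(x,y)}{t^{1/\beta}}\Big).$$ Classes of measures, $p\in[1,+\infty[$. - $S_K^{\,p}$ is the set of positive Radon measures $\mu$ on $E$ with $\lim_{t\to0}\sup_{x\in E}\int_E\big(\int_0^tp_s(x,y)\,ds\big)^p\mu(dy)=0$. - $S_D^{\,p}$ is the set of positive Radon measures $\mu$ on $E$ with $\sup_{x\in E}\int_E\big(\int_0^tp_s(x,y)\,ds\big)^p\mu(dy)<+\infty$ for some $t>0$. - Put $G(r)=r^{\beta-\nu}$ for $r\in]0,+\infty[$ if $\nu>\beta$, $G(r)=\log(r^{-1})$ for $r\in]0,1[$ if $\nu=\beta$, $G(0)=+\infty$,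 and $G(x,y)=G(d(x,y))$. $D_{\nu,\beta}^{\,p}$ is the set of positive Borel measures $\mu$ on $E$ such that: if $\nu\ge\beta$, $\sup_{x\in E}\int_{d(x,y)<r}G(x,y)^p\mu(dy)<+\infty$ for some $r>0$ ($r<1$ if $\nu=\beta$); if $\nu<\beta$, $\sup_{x\in E}\int_{d(x,y)\le1}\mu(dy)<+\infty$. - $K_{\nu,\beta}^{\,p}$ is the set of positive Borel measures $\mu$ on $E$ such that: if $\nu\ge\beta$, $\lim_{r\to0}\sup_{x\in E}\int_{d(x,y)<r}G(x,y)^p\mu(dy)=0$; if $\nu<\beta$, $\sup_{x\in E}\int_{d(x,y)\le1}\mu(dy)<+\infty$. *)

theory Defs
  imports "HOL-Probability.Probability"
begin

section \<open>Radon measures, square integrable functions, Dirichlet forms\<close>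

text \<open>
  Every Borel measure that is finite on compact sets of a locally compact separable metric space
  is automatically regular, so no regularity clause is needed in that setting.
\<close>

definition radon_measure :: "'a::topological_space measure \<Rightarrow> bool" where
  "radon_measure \<mu> \<longleftrightarrow> sets \<mu> = sets borel \<and> (\<forall>C. compact C \<longrightarrow> emeasure \<mu> C < \<infinity>)"

definition full_support :: "'a::topological_space measure \<Rightarrow> bool" where
  "full_support \<mu> \<longleftrightarrow> (\<forall>U. open U \<and> U \<noteq> {} \<longrightarrow> 0 < emeasure \<mu> U)"

text \<open>
  Elements of \<open>L\<^sup>2\<close> are handled through their representatives; all notions below are
  invariant under almost everywhere equality.
\<close>

definition L2 :: "'a measure \<Rightarrow> ('a \<Rightarrow> real) set" where
  "L2 m = {f \<in> borel_measurable m. integrable m (\<lambda>x. (f x)\<^sup>2)}"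

definition L2_inner :: "'a measure \<Rightarrow> ('a \<Rightarrow> real) \<Rightarrow> ('a \<Rightarrow> real) \<Rightarrow> real" where
  "L2_inner m f g = (\<integral>x. f x * g x \<partial>m)"

definition L2_dist2 :: "'a measure \<Rightarrow> ('a \<Rightarrow> real) \<Rightarrow> ('a \<Rightarrow> real) \<Rightarrow> real" where
  "L2_dist2 m f g = (\<integral>x. (f x - g x)\<^sup>2 \<partial>m)"

definition Cc :: "('a::topological_space \<Rightarrow> real) set" where
  "Cc = {f. continuous_on UNIV f \<and> compact (closure {x. f x \<noteq> 0})}"

text \<open>
  A symmetric Dirichlet form with domain \<open>D\<close> (the set of all representatives of the classes
  in the domain): a densely defined, closed, nonnegative definite symmetric bilinear form on
  \<open>L\<^sup>2\<close> on which the unit contraction operates.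
\<close>

locale symmetric_dirichlet_form =
  fixes m :: "'a measure"
    and Q :: "('a \<Rightarrow> real) \<Rightarrow> ('a \<Rightarrow> real) \<Rightarrow> real"
    and D :: "('a \<Rightarrow> real) set"
  assumes dom_subset: "D \<subseteq> L2 m"
    and dom_zero: "(\<lambda>_. 0) \<in> D"
    and dom_add: "\<And>u v. u \<in> D \<Longrightarrow> v \<in> D \<Longrightarrow> (\<lambda>x. u x + v x) \<in> D"
    and dom_scale: "\<And>c u. u \<in> D \<Longrightarrow> (\<lambda>x. c * u x) \<in> D"
    and dom_cong_AE: "\<And>u v. u \<in> D \<Longrightarrow> v \<in> borel_measurable m \<Longrightarrow> (AE x in m. u x = v x) \<Longrightarrow> v \<in> D"
    and dom_dense: "\<And>f e. f \<in> L2 m \<Longrightarrow> 0 < e \<Longrightarrow> \<exists>u\<in>D. L2_dist2 m f u < e"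
    and form_cong_AE: "\<And>u v w. u \<in> D \<Longrightarrow> v \<in> D \<Longrightarrow> w \<in> D \<Longrightarrow> (AE x in m. u x = v x) \<Longrightarrow> Q u w = Q v w"
    and form_add: "\<And>u v w. u \<in> D \<Longrightarrow> v \<in> D \<Longrightarrow> w \<in> D \<Longrightarrow> Q (\<lambda>x. u x + v x) w = Q u w + Q v w"
    and form_scale: "\<And>c u w. u \<in> D \<Longrightarrow> w \<in> D \<Longrightarrow> Q (\<lambda>x. c * u x) w = c * Q u w"
    and form_sym: "\<And>u v. u \<in> D \<Longrightarrow> v \<in> D \<Longrightarrow> Q u v = Q v u"
    and form_nonneg: "\<And>u. u \<in> D \<Longrightarrow> 0 \<le> Q u u"
    and form_closed:
      "\<And>u :: nat \<Rightarrow> 'a \<Rightarrow> real.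
         (\<And>n. u n \<in> D) \<Longrightarrow>
         (\<And>e. 0 < e \<Longrightarrow> \<exists>N. \<forall>i\<ge>N. \<forall>j\<ge>N.
             Q (\<lambda>x. u i x - u j x) (\<lambda>x. u i x - u j x) + L2_dist2 m (u i) (u j) < e) \<Longrightarrow>
         \<exists>v\<in>D. (\<lambda>n. Q (\<lambda>x. u n x - v x) (\<lambda>x. u n x - v x) + L2_dist2 m (u n) v) \<longlonglongrightarrow> 0"
    and form_markovian:
      "\<And>u. u \<in> D \<Longrightarrow> (\<lambda>x. min (max (u x) 0) 1) \<in> D \<and>
         Q (\<lambda>x. min (max (u x) 0) 1) (\<lambda>x. min (max (u x) 0) 1) \<le> Q u u"

locale regular_dirichlet_form = symmetric_dirichlet_form m Q D
  for m :: "'a::topological_space measure" and Q D +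
  assumes core_dense_form:
      "\<And>u e. u \<in> D \<Longrightarrow> 0 < e \<Longrightarrow>
         \<exists>v\<in>D \<inter> Cc. Q (\<lambda>x. u x - v x) (\<lambda>x. u x - v x) + L2_dist2 m u v < e"
    and core_dense_uniform:
      "\<And>f e. f \<in> Cc \<Longrightarrow> 0 < e \<Longrightarrow> \<exists>v\<in>D \<inter> Cc. \<forall>x. \<bar>f x - v x\<bar> < e"

locale symmetric_L2_semigroup =
  fixes m :: "'a measure" and T :: "real \<Rightarrow> ('a \<Rightarrow> real) \<Rightarrow> ('a \<Rightarrow> real)"
  assumes T_L2: "\<And>t f. 0 < t \<Longrightarrow> f \<in> L2 m \<Longrightarrow> T t f \<in> L2 m"
    and T_add: "\<And>t f g. 0 < t \<Longrightarrow> f \<in> L2 m \<Longrightarrow> g \<in> L2 m \<Longrightarrow>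
         AE x in m. T t (\<lambda>y. f y + g y) x = T t f x + T t g x"
    and T_scale: "\<And>t c f. 0 < t \<Longrightarrow> f \<in> L2 m \<Longrightarrow> AE x in m. T t (\<lambda>y. c * f y) x = c * T t f x"
    and T_contraction: "\<And>t f. 0 < t \<Longrightarrow> f \<in> L2 m \<Longrightarrow> L2_inner m (T t f) (T t f) \<le> L2_inner m f f"
    and T_sym: "\<And>t f g. 0 < t \<Longrightarrow> f \<in> L2 m \<Longrightarrow> g \<in> L2 m \<Longrightarrow>
         L2_inner m (T t f) g = L2_inner m f (T t g)"
    and T_semigroup: "\<And>s t f. 0 < s \<Longrightarrow> 0 < t \<Longrightarrow> f \<in> L2 m \<Longrightarrow>
         AE x in m. T (s + t) f x = T s (T t f) x"
    and T_continuous: "\<And>f. f \<in> L2 m \<Longrightarrow> ((\<lambda>t. L2_dist2 m (T t f) f) \<longlongrightarrow> 0) (at_right 0)"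

text \<open>
  The form \<open>(Q, D)\<close> corresponding to a semigroup, through the approximating forms
  \<open>(f - T\<^sub>t f, g) / t\<close>. Since \<open>(f - T\<^sub>t f, f) / t\<close> increases as \<open>t\<close> decreases to 0, convergence to
  a real number means precisely that the limit is finite.
\<close>

definition form_of_semigroup ::
  "'a measure \<Rightarrow> (real \<Rightarrow> ('a \<Rightarrow> real) \<Rightarrow> ('a \<Rightarrow> real)) \<Rightarrow>
   (('a \<Rightarrow> real) \<Rightarrow> ('a \<Rightarrow> real) \<Rightarrow> real) \<Rightarrow> ('a \<Rightarrow> real) set \<Rightarrow> bool" where
  "form_of_semigroup m T Q D \<longleftrightarrow>
     D = {f \<in> L2 m. \<exists>l. ((\<lambda>t. L2_inner m (\<lambda>x. f x - T t f x) f / t) \<longlongrightarrow> l) (at_right 0)} \<and>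
     (\<forall>f\<in>D. \<forall>g\<in>D. ((\<lambda>t. L2_inner m (\<lambda>x. f x - T t f x) g / t) \<longlongrightarrow> Q f g) (at_right 0))"

section \<open>Hunt processes\<close>

text \<open>
  The state space \<open>E\<close> is the type \<open>'a\<close>, and its one-point compactification is \<open>'a option\<close>,
  with \<open>None\<close> the cemetery point; if \<open>E\<close> is compact, \<open>None\<close> is an isolated point.
\<close>

abbreviation cemetery_topology :: "'a::topological_space option topology" where
  "cemetery_topology \<equiv> Alexandroff_compactification euclidean"

definition cemetery_borel :: "'a::topological_space option measure" where
  "cemetery_borel = sigma UNIV {U. openin cemetery_topology U}"

definition lifetime :: "(ennreal \<Rightarrow> 'w \<Rightarrow> 'a option) \<Rightarrow> 'w \<Rightarrow> ennreal" where
  "lifetime X \<omega> = Inf {t. X t \<omega> = None}"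

text \<open>
  The time set is \<open>[0, \<infinity>]\<close>, that is, \<^typ>\<open>ennreal\<close>. The strong Markov property and the
  quasi-left-continuity are required under every \<open>P x\<close>; integration with respect to the starting
  point gives them for arbitrary initial distributions. The simple Markov property is the strong
  one at constant times.
\<close>

definition strong_markov ::
  "'w measure \<Rightarrow> (ennreal \<Rightarrow> 'w measure) \<Rightarrow> (ennreal \<Rightarrow> 'w \<Rightarrow> 'a::topological_space option) \<Rightarrow>
   ('a option \<Rightarrow> 'w measure) \<Rightarrow> bool" where
  "strong_markov N F X P \<longleftrightarrow>
     (\<forall>\<sigma> s B x. stopping_time F \<sigma> \<and> B \<in> sets cemetery_borel \<longrightarrow>
        (AE \<omega> in P x.
           real_cond_exp (P x) (filtration.pre_sigma (space N) F \<sigma>)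
             (indicator {\<omega> \<in> space N. X (\<sigma> \<omega> + s) \<omega> \<in> B}) \<omega>
           = measure (P (X (\<sigma> \<omega>) \<omega>)) {\<omega>' \<in> space N. X s \<omega>' \<in> B}))"

definition quasi_left_continuous ::
  "'w measure \<Rightarrow> (ennreal \<Rightarrow> 'w measure) \<Rightarrow> (ennreal \<Rightarrow> 'w \<Rightarrow> 'a::topological_space option) \<Rightarrow>
   ('a option \<Rightarrow> 'w measure) \<Rightarrow> bool" where
  "quasi_left_continuous N F X P \<longleftrightarrow>
     (\<forall>(\<sigma> :: nat \<Rightarrow> 'w \<Rightarrow> ennreal) x.
        (\<forall>n. stopping_time F (\<sigma> n)) \<and> (\<forall>\<omega>\<in>space N. incseq (\<lambda>n. \<sigma> n \<omega>)) \<longrightarrow>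
        (AE \<omega> in P x. (SUP n. \<sigma> n \<omega>) < \<infinity> \<longrightarrow>
           limitin cemetery_topology (\<lambda>n. X (\<sigma> n \<omega>) \<omega>) (X (SUP n. \<sigma> n \<omega>) \<omega>) sequentially))"

definition right_continuous_admissible ::
  "'w measure \<Rightarrow> (ennreal \<Rightarrow> 'w measure) \<Rightarrow> (ennreal \<Rightarrow> 'w \<Rightarrow> 'a::topological_space option) \<Rightarrow> bool" where
  "right_continuous_admissible N F X \<longleftrightarrow>
     filtration (space N) F \<and>
     (\<forall>t. sets (F t) \<subseteq> sets N) \<and>
     (\<forall>t. X t \<in> measurable (F t) cemetery_borel) \<and>
     (\<forall>t<\<infinity>. sets (F t) = (\<Inter>u\<in>{t<..}. sets (F u)))"

locale hunt_process =
  fixes N :: "'w measure"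
    and X :: "ennreal \<Rightarrow> 'w \<Rightarrow> 'a::topological_space option"
    and P :: "'a option \<Rightarrow> 'w measure"
  assumes prob_P: "\<And>x. prob_space (P x)"
    and sets_P: "\<And>x. sets (P x) = sets N"
    and X_measurable: "\<And>t. X t \<in> measurable N cemetery_borel"
    and P_measurable: "\<And>t B. B \<in> sets cemetery_borel \<Longrightarrow>
         (\<lambda>x. measure (P x) {\<omega> \<in> space N. X t \<omega> \<in> B}) \<in> borel_measurable cemetery_borel"
    and P_start: "\<And>x. AE \<omega> in P x. X 0 \<omega> = x"
    and P_cemetery: "\<And>t. AE \<omega> in P None. X t \<omega> = None"
    and X_infinity: "\<And>\<omega>. \<omega> \<in> space N \<Longrightarrow> X \<infinity> \<omega> = None"
    and X_dead: "\<And>t \<omega>. \<omega> \<in> space N \<Longrightarrow> lifetime X \<omega> \<le> t \<Longrightarrow> X t \<omega> = None"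
    and shift: "\<And>t. \<exists>\<theta>. \<forall>\<omega>\<in>space N. \<theta> \<omega> \<in> space N \<and> (\<forall>s. X s (\<theta> \<omega>) = X (s + t) \<omega>)"
    and right_continuous: "\<And>t \<omega>. \<omega> \<in> space N \<Longrightarrow> t < \<infinity> \<Longrightarrow>
         limitin cemetery_topology (\<lambda>s. X s \<omega>) (X t \<omega>) (at_right t)"
    and left_limits: "\<And>t \<omega>. \<omega> \<in> space N \<Longrightarrow> 0 < t \<Longrightarrow> t < \<infinity> \<Longrightarrow>
         \<exists>l. limitin cemetery_topology (\<lambda>s. X s \<omega>) l (at_left t)"
    and strong_markov_qlc:
      "\<exists>F. right_continuous_admissible N F X \<and> strong_markov N F X P \<and> quasi_left_continuous N F X P"

text \<open>\<open>E\<^sub>x[u(X\<^sub>t)]\<close>, with the convention that functions on \<open>E\<close> vanish at the cemetery point.\<close>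

definition transition ::
  "(ennreal \<Rightarrow> 'w \<Rightarrow> 'a option) \<Rightarrow> ('a option \<Rightarrow> 'w measure) \<Rightarrow> real \<Rightarrow> ('a \<Rightarrow> real) \<Rightarrow> 'a \<Rightarrow> real" where
  "transition X P t u x = (\<integral>\<omega>. case_option 0 u (X (ennreal t) \<omega>) \<partial>P (Some x))"

text \<open>
  The process is associated with \<open>(Q, D)\<close> if its transition function is a version of the \<open>L\<^sup>2\<close>
  semigroup of \<open>(Q, D)\<close>.
\<close>

definition associated_process ::
  "'a measure \<Rightarrow> (('a \<Rightarrow> real) \<Rightarrow> ('a \<Rightarrow> real) \<Rightarrow> real) \<Rightarrow> ('a \<Rightarrow> real) set \<Rightarrow>
   (ennreal \<Rightarrow> 'w \<Rightarrow> 'a option) \<Rightarrow> ('a option \<Rightarrow> 'w measure) \<Rightarrow> bool" where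
  "associated_process m Q D X P \<longleftrightarrow>
     (\<exists>T. symmetric_L2_semigroup m T \<and> form_of_semigroup m T Q D \<and>
        (\<forall>t>0. \<forall>f\<in>L2 m. bounded (range f) \<longrightarrow> (AE x in m. T t f x = transition X P t f x)))"

locale semigroup_kernel =
  fixes m :: "'a::topological_space measure"
    and X :: "ennreal \<Rightarrow> 'w \<Rightarrow> 'a option"
    and P :: "'a option \<Rightarrow> 'w measure"
    and k :: "real \<Rightarrow> 'a \<Rightarrow> 'a \<Rightarrow> real"
  assumes kernel_measurable:
      "(\<lambda>(t, x, y). k t x y) \<in> borel_measurable (restrict_space borel {0<..} \<Otimes>\<^sub>M borel \<Otimes>\<^sub>M borel)"
    and kernel_nonneg: "\<And>t x y. 0 < t \<Longrightarrow> 0 \<le> k t x y"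
    and kernel_transition: "\<And>t x u. 0 < t \<Longrightarrow> u \<in> borel_measurable borel \<Longrightarrow> bounded (range u) \<Longrightarrow>
         transition X P t u x = (\<integral>y. k t x y * u y \<partial>m)"
    and chapman_kolmogorov: "\<And>s t x y. 0 < s \<Longrightarrow> 0 < t \<Longrightarrow>
         ennreal (k (t + s) x y) = (\<integral>\<^sup>+z. ennreal (k s x z) * ennreal (k t z y) \<partial>m)"
    and kernel_le_1: "\<And>t x. 0 < t \<Longrightarrow> (\<integral>\<^sup>+y. ennreal (k t x y) \<partial>m) \<le> 1"

section \<open>Standing assumptions\<close>

definition life_time_condition ::
  "(ennreal \<Rightarrow> 'w \<Rightarrow> 'a option) \<Rightarrow> ('a option \<Rightarrow> 'w measure) \<Rightarrow> bool" where
  "life_time_condition X P \<longleftrightarrow>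
     (\<exists>l\<in>{0..<1::real}.
        ((\<lambda>t. SUP x. measure (P (Some x)) {\<omega> \<in> space (P (Some x)). lifetime X \<omega> \<le> ennreal t})
          \<longlongrightarrow> l) (at_right 0))"

definition bishop_type :: "'a::metric_space measure \<Rightarrow> real \<Rightarrow> (real \<Rightarrow> real) \<Rightarrow> bool" where
  "bishop_type m \<nu> V \<longleftrightarrow>
     (mono_on {0<..} (\<lambda>r. V r / r powr \<nu>) \<or> bounded ((\<lambda>r. V r / r powr \<nu>) ` {0<..})) \<and>
     (\<forall>r>0. (SUP x. emeasure m (ball x r)) \<le> ennreal (V r))"

definition heat_kernel_estimates ::
  "real \<Rightarrow> real \<Rightarrow> ennreal \<Rightarrow> (real \<Rightarrow> real) \<Rightarrow> (real \<Rightarrow> 'a::metric_space \<Rightarrow> 'a \<Rightarrow> real) \<Rightarrow> bool" where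
  "heat_kernel_estimates \<nu> \<beta> t0 V k \<longleftrightarrow>
     (\<exists>\<Phi>1 \<Phi>2 :: real \<Rightarrow> real.
        (\<forall>r\<ge>0. 0 < \<Phi>1 r) \<and> antimono_on {0..} \<Phi>1 \<and>
        (\<forall>r\<ge>0. 0 < \<Phi>2 r) \<and> antimono_on {0..} \<Phi>2 \<and>
        (\<integral>\<^sup>+t\<in>{1..}. ennreal (max (V t) (t powr \<nu>) * \<Phi>2 t / t) \<partial>lborel) < \<infinity> \<and>
        (\<forall>x y t. 0 < t \<and> ennreal t < t0 \<longrightarrow>
           1 / t powr (\<nu> / \<beta>) * \<Phi>1 (dist x y / t powr (1 / \<beta>)) \<le> k t x y \<and>
           k t x y \<le> 1 / t powr (\<nu> / \<beta>) * \<Phi>2 (dist x y / t powr (1 / \<beta>))))"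

section \<open>Classes of measures\<close>

definition ennpowr :: "ennreal \<Rightarrow> real \<Rightarrow> ennreal" where
  "ennpowr a p = (if a = \<infinity> then \<infinity> else ennreal (enn2real a powr p))"

text \<open>\<open>\<integral>\<^sub>0\<^sup>t p\<^sub>s(x,y) ds\<close>, possibly infinite.\<close>

definition time_integral :: "(real \<Rightarrow> 'a \<Rightarrow> 'a \<Rightarrow> real) \<Rightarrow> real \<Rightarrow> 'a \<Rightarrow> 'a \<Rightarrow> ennreal" where
  "time_integral k t x y = (\<integral>\<^sup>+s\<in>{0<..<t}. ennreal (k s x y) \<partial>lborel)"

definition S_K :: "(real \<Rightarrow> 'a::topological_space \<Rightarrow> 'a \<Rightarrow> real) \<Rightarrow> real \<Rightarrow> 'a measure set" where
  "S_K k p = {\<mu>. radon_measure \<mu> \<and>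
     ((\<lambda>t. SUP x. \<integral>\<^sup>+y. ennpowr (time_integral k t x y) p \<partial>\<mu>) \<longlongrightarrow> 0) (at_right 0)}"

definition S_D :: "(real \<Rightarrow> 'a::topological_space \<Rightarrow> 'a \<Rightarrow> real) \<Rightarrow> real \<Rightarrow> 'a measure set" where
  "S_D k p = {\<mu>. radon_measure \<mu> \<and>
     (\<exists>t>0. (SUP x. \<integral>\<^sup>+y. ennpowr (time_integral k t x y) p \<partial>\<mu>) < \<infinity>)}"

text \<open>
  Only used for \<open>\<nu> \<ge> \<beta>\<close>, and for \<open>r < 1\<close> if \<open>\<nu> = \<beta>\<close>; other values are irrelevant.
\<close>

definition green :: "real \<Rightarrow> real \<Rightarrow> real \<Rightarrow> ennreal" where
  "green \<nu> \<beta> r = (if r = 0 then \<infinity> else if \<nu> > \<beta> then ennreal (r powr (\<beta> - \<nu>)) else ennreal (ln (1 / r)))"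

definition green_integral ::
  "real \<Rightarrow> real \<Rightarrow> real \<Rightarrow> 'a::metric_space measure \<Rightarrow> real \<Rightarrow> 'a \<Rightarrow> ennreal" where
  "green_integral \<nu> \<beta> p \<mu> r x = (\<integral>\<^sup>+y\<in>{y. dist x y < r}. ennpowr (green \<nu> \<beta> (dist x y)) p \<partial>\<mu>)"

definition K_class :: "real \<Rightarrow> real \<Rightarrow> real \<Rightarrow> 'a::metric_space measure set" where
  "K_class \<nu> \<beta> p = {\<mu>. sets \<mu> = sets borel \<and>
     (if \<nu> \<ge> \<beta> then ((\<lambda>r. SUP x. green_integral \<nu> \<beta> p \<mu> r x) \<longlongrightarrow> 0) (at_right 0)
      else (SUP x. emeasure \<mu> {y. dist x y \<le> 1}) < \<infinity>)}"

definition D_class :: "real \<Rightarrow> real \<Rightarrow> real \<Rightarrow> 'a::metric_space measure set" where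
  "D_class \<nu> \<beta> p = {\<mu>. sets \<mu> = sets borel \<and>
     (if \<nu> \<ge> \<beta> then (\<exists>r>0. (\<nu> = \<beta> \<longrightarrow> r < 1) \<and> (SUP x. green_integral \<nu> \<beta> p \<mu> r x) < \<infinity>)
      else (SUP x. emeasure \<mu> {y. dist x y \<le> 1}) < \<infinity>)}"

end

theory Submission
  imports Defs
begin

text \<open>
  Under the standing assumptions the two identities of classes hold for every exponent \<open>p\<close> and every
  pair \<open>\<nu>, \<beta>\<close>; so the equivalence comes down to deciding when the reference measure \<open>m\<close> itself
  belongs to the classes defined by the Green function.

  Everything rests on two-sided volume bounds at small scales. The upper bound \<open>m (ball x r) \<le> C r\<^sup>\<nu>\<close>
  is the Bishop type inequality. For the lower bound the life time condition says that, for small \<open>t\<close>,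
  the kernel \<open>k t x\<close> keeps a fixed amount of mass. The Bishop inequality and the moment condition on
  \<open>\<Phi>2\<close> show that only a small part of this mass lies beyond distance \<open>R t\<^bsup>1/\<beta>\<^esup>\<close>, for \<open>R\<close> large, and on the ball
  the density is at most \<open>\<Phi>2 0 t\<^bsup>-\<nu>/\<beta>\<^esup>\<close>; hence the ball has measure at least a multiple of
  \<open>t\<^bsup>\<nu>/\<beta>\<^esup>\<close> (\<open>volume_lower\<close>). A maximal separated set then bounds \<open>\<mu> (ball x \<rho>)\<close> by \<open>V (2 \<rho>)\<close> up to a constant, for
  every \<open>\<mu>\<close> that is uniformly bounded on balls of one small radius (\<open>ball_growth\<close>).

  For the identities \<open>K_class = S_K\<close> and \<open>D_class = S_D\<close> the potential \<open>\<integral>\<^sub>0\<^sup>t k s x y ds\<close> is compared with the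
  Green function. It dominates a multiple of it near the diagonal (\<open>time_integral_ge_green\<close>) and is
  dominated there by another multiple (\<open>majorant_le_green\<close>). Away from the diagonal the potential is at most 1
  for small \<open>t\<close>, so that its \<open>p\<close>-th power is at most the potential itself, and the integral of the latter
  with respect to any \<open>\<mu>\<close> from the classes is \<open>O(t)\<close> uniformly in \<open>x\<close>, by the growth bound for \<open>\<mu>\<close> and the moment
  condition (\<open>far_part\<close>). For \<open>\<nu> < \<beta>\<close> the potential is bounded by a power of \<open>t\<close> and, for fixed \<open>t\<close>,
  bounded below for distances up to 1.

  As for \<open>m\<close>, in the case \<open>\<nu> \<ge> \<beta>\<close>: if \<open>\<nu> - p (\<nu> - \<beta>) > 0\<close>, the dyadic annuli around \<open>x\<close> contribute a convergent geometric series
  to the integral of \<open>G\<^sup>p\<close>. If \<open>\<nu> - p (\<nu> - \<beta>) \<le> 0\<close>, the lower volume bound keeps the integral of \<open>G\<^sup>p\<close> over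
  arbitrarily small balls away from zero, although the integrals of an integrable function over
  balls shrinking to a null point must tend to zero.
\<close>

section \<open>Powers of extended nonnegative reals\<close>

lemma ennpowr_mono: "a \<le> b \<Longrightarrow> 0 \<le> p \<Longrightarrow> ennpowr a p \<le> ennpowr b p"
  by (cases a; cases b) (auto simp: ennpowr_def top_unique intro!: ennreal_leI powr_mono2)

lemma ennpowr_cmult:
  assumes "0 < c" "0 < p"
  shows "ennpowr (ennreal c * a) p = ennreal (c powr p) * ennpowr a p"
  using assms by (cases a) (auto simp: ennpowr_def ennreal_mult_top powr_mult enn2real_mult
      simp flip: ennreal_mult')

lemma ennpowr_le_self:
  assumes "a \<le> 1" "1 \<le> p" shows "ennpowr a p \<le> a"
proof (cases a)
  case (real r)
  then have "r powr p \<le> r powr 1 \<or> r = 0" using assms powr_mono'[of 1 p r] by auto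
  then show ?thesis using real by (auto simp: ennpowr_def intro!: ennreal_leI)
qed (use assms in auto)

lemma borel_measurable_ennpowr [measurable]: "(\<lambda>a. ennpowr a p) \<in> borel_measurable borel"
  unfolding ennpowr_def by measurable

lemma borel_measurable_green [measurable]: "green \<nu> \<beta> \<in> borel_measurable borel"
  unfolding green_def[abs_def] by measurable

section \<open>Analytic consequences of the standing assumptions\<close>

text \<open>
  The process and its Dirichlet form enter only through the kernel: \<open>T\<close> is a time up to
  which both kernel bounds hold and the mass of the kernel is at least \<open>c0\<close>.
\<close>

locale heat_kernel_bounds =
  fixes m :: "'a::{metric_space, second_countable_topology} measure"
    and k :: "real \<Rightarrow> 'a \<Rightarrow> 'a \<Rightarrow> real"
    and \<nu> \<beta> T c0 :: real
    and V \<Phi>1 \<Phi>2 :: "real \<Rightarrow> real"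
  assumes sets_m: "sets m = sets borel"
    and nu_pos: "0 < \<nu>" and beta_pos: "0 < \<beta>" and T_pos: "0 < T" and c0_pos: "0 < c0"
    and V_pos: "\<And>r. 0 < r \<Longrightarrow> 0 < V r"
    and V_mono: "\<And>r s. 0 < r \<Longrightarrow> r \<le> s \<Longrightarrow> V r \<le> V s"
    and V_powr: "mono_on {0<..} (\<lambda>r. V r / r powr \<nu>) \<or> bounded ((\<lambda>r. V r / r powr \<nu>) ` {0<..})"
    and emeasure_ball_le: "\<And>x r. 0 < r \<Longrightarrow> emeasure m (ball x r) \<le> ennreal (V r)"
    and Phi1_pos: "\<And>r. 0 \<le> r \<Longrightarrow> 0 < \<Phi>1 r"
    and Phi1_antimono: "\<And>r s. 0 \<le> r \<Longrightarrow> r \<le> s \<Longrightarrow> \<Phi>1 s \<le> \<Phi>1 r"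
    and Phi2_pos: "\<And>r. 0 \<le> r \<Longrightarrow> 0 < \<Phi>2 r"
    and Phi2_antimono: "\<And>r s. 0 \<le> r \<Longrightarrow> r \<le> s \<Longrightarrow> \<Phi>2 s \<le> \<Phi>2 r"
    and moment: "(\<integral>\<^sup>+t\<in>{1..}. ennreal (max (V t) (t powr \<nu>) * \<Phi>2 t / t) \<partial>lborel) < \<infinity>"
    and kernel_lower: "\<And>x y t. 0 < t \<Longrightarrow> t < T \<Longrightarrow>
          t powr (- \<nu> / \<beta>) * \<Phi>1 (dist x y / t powr (1 / \<beta>)) \<le> k t x y"
    and kernel_upper: "\<And>x y t. 0 < t \<Longrightarrow> t < T \<Longrightarrow>
          k t x y \<le> t powr (- \<nu> / \<beta>) * \<Phi>2 (dist x y / t powr (1 / \<beta>))"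
    and survival: "\<And>x t. 0 < t \<Longrightarrow> t < T \<Longrightarrow> ennreal c0 \<le> (\<integral>\<^sup>+y. ennreal (k t x y) \<partial>m)"
begin

text \<open>The weight in the moment condition on \<open>\<Phi>2\<close>.\<close>

definition W :: "real \<Rightarrow> real" where "W a = max (V a) (a powr \<nu>)"

lemma W_pos: "0 < a \<Longrightarrow> 0 < W a"
  using V_pos[of a] by (auto simp: W_def)

lemma W_mono: "0 < a \<Longrightarrow> a \<le> b \<Longrightarrow> W a \<le> W b"
  using V_mono[of a b] nu_pos powr_mono2[of \<nu> a b] by (auto simp: W_def)

text \<open>
  Since \<open>V\<close> need not be doubling, \<open>V (8 a)\<close> is not controlled by \<open>V a\<close>. But at a small scale \<open>\<tau>\<close> the value
  \<open>V (8 a \<tau>)\<close> is controlled at \<open>a\<close>, because \<open>V r / r\<^sup>\<nu>\<close> is increasing or bounded, and \<open>8 a \<tau> \<le> a\<close>. This leaves room for the factors 2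
  that are lost in dyadic decompositions and in the covering argument.
\<close>

lemma volume_rescale:
  obtains C where "0 < C" "\<And>\<tau> a. 0 < \<tau> \<Longrightarrow> \<tau> \<le> 1/8 \<Longrightarrow> 0 < a \<Longrightarrow> V (8 * a * \<tau>) \<le> C * \<tau> powr \<nu> * W a"
  using V_powr
proof
  assume mono: "mono_on {0<..} (\<lambda>r. V r / r powr \<nu>)"
  show thesis
  proof (rule that[of "8 powr \<nu>"])
    fix \<tau> a :: real assume *: "0 < \<tau>" "\<tau> \<le> 1/8" "0 < a"
    then have "V (8 * a * \<tau>) / (8 * a * \<tau>) powr \<nu> \<le> V a / a powr \<nu>"
      by (intro monotone_onD[OF mono]) (auto simp: field_simps)
    then have "V (8 * a * \<tau>) \<le> 8 powr \<nu> * \<tau> powr \<nu> * V a"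
      using * by (simp add: powr_mult field_simps)
    also have "\<dots> \<le> 8 powr \<nu> * \<tau> powr \<nu> * W a" by (intro mult_left_mono) (auto simp: W_def)
    finally show "V (8 * a * \<tau>) \<le> 8 powr \<nu> * \<tau> powr \<nu> * W a" .
  qed auto
next
  assume "bounded ((\<lambda>r. V r / r powr \<nu>) ` {0<..})"
  then obtain B where B: "0 < B" and "\<And>r. 0 < r \<Longrightarrow> \<bar>V r / r powr \<nu>\<bar> \<le> B"
    by (auto simp: bounded_pos)
  then have le_B: "V r / r powr \<nu> \<le> B" if "0 < r" for r
    using that abs_le_D1 by blast
  show thesis
  proof (rule that[of "B * 8 powr \<nu>"])
    fix \<tau> a :: real assume *: "0 < \<tau>" "\<tau> \<le> 1/8" "0 < a"
    then have "V (8 * a * \<tau>) / (8 * a * \<tau>) powr \<nu> \<le> B"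
      using le_B[of "8 * a * \<tau>"] by auto
    then have "V (8 * a * \<tau>) \<le> B * 8 powr \<nu> * \<tau> powr \<nu> * a powr \<nu>"
      using * by (simp add: powr_mult field_simps)
    also have "\<dots> \<le> B * 8 powr \<nu> * \<tau> powr \<nu> * W a"
      using B by (intro mult_left_mono) (auto simp: W_def)
    finally show "V (8 * a * \<tau>) \<le> B * 8 powr \<nu> * \<tau> powr \<nu> * W a" .
  qed (use B in auto)
qed

lemma volume_le_powr:
  obtains C where "0 < C" "\<And>a. 0 < a \<Longrightarrow> a \<le> 1 \<Longrightarrow> V a \<le> C * a powr \<nu>"
  using V_powr
proof
  assume mono: "mono_on {0<..} (\<lambda>r. V r / r powr \<nu>)"
  show thesis
  proof (rule that[of "V 1"])
    fix a :: real assume *: "0 < a" "a \<le> 1"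
    then have "V a / a powr \<nu> \<le> V 1 / 1 powr \<nu>"
      by (intro monotone_onD[OF mono]) auto
    then show "V a \<le> V 1 * a powr \<nu>" using * by (simp add: field_simps)
  qed (simp add: V_pos)
next
  assume "bounded ((\<lambda>r. V r / r powr \<nu>) ` {0<..})"
  then obtain B where B: "0 < B" and "\<And>r. 0 < r \<Longrightarrow> \<bar>V r / r powr \<nu>\<bar> \<le> B"
    by (auto simp: bounded_pos)
  then have le_B: "V r / r powr \<nu> \<le> B" if "0 < r" for r
    using that abs_le_D1 by blast
  show thesis
  proof (rule that[of B])
    fix a :: real assume *: "0 < a" "a \<le> 1"
    have "V a / a powr \<nu> \<le> B" using le_B[OF *(1)] by auto
    then show "V a \<le> B * a powr \<nu>" using * by (simp add: field_simps)
  qed (fact B)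
qed

lemma (in -) dyadic_index:
  fixes q :: real assumes "1 \<le> q" obtains j :: nat where "2 ^ j \<le> q" "q < 2 ^ Suc j"
proof -
  define j where "j = (LEAST j. q < 2 ^ j)"
  have "\<exists>j. q < 2 ^ j" using real_arch_pow[of 2 q] by auto
  then have 1: "q < 2 ^ j" unfolding j_def by (rule LeastI_ex)
  then have "j \<noteq> 0" using assms by (auto intro!: Nat.gr0I)
  then obtain i where i: "j = Suc i" using not0_implies_Suc by auto
  then have "\<not> q < 2 ^ i" using not_less_Least[of i "\<lambda>j. q < 2 ^ j"] by (simp add: j_def)
  then show thesis using that[of i] 1 i by auto
qed

text \<open>
  On the block from \<open>2\<^sup>j a\<close> to \<open>2\<^bsup>j+1\<^esup> a\<close> the increasing weight is at least its value at the left end and the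
  decreasing \<open>\<Phi>2\<close> at least its value at the right end, while \<open>dt / t\<close> gives the block mass at least
  one half. Comparing with constants on blocks gives the sum with the two arguments a factor 2 apart.
\<close>

lemma dyadic_moment:
  assumes a: "1 \<le> a"
  shows "(\<Sum>j. ennreal (W (2 ^ j * a) * \<Phi>2 (2 ^ Suc j * a)))
    \<le> 2 * (\<integral>\<^sup>+t\<in>{1..}. ennreal (W t * \<Phi>2 t / t) \<partial>lborel)"
proof -
  define I where "I j = {2 ^ j * a ..< 2 ^ Suc j * a}" for j :: nat
  define w where "w j = W (2 ^ j * a) * \<Phi>2 (2 ^ Suc j * a)" for j :: nat
  define h where "h j = w j / (2 ^ Suc j * a)" for j
  have apos: "0 < a" using a by simp
  have disj: "disjoint_family I"
    unfolding disjoint_family_on_def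
  proof (intro ballI impI)
    have less: "I i \<inter> I j = {}" if "i < j" for i j
    proof -
      have "(2::real) ^ Suc i \<le> 2 ^ j" using that by (intro power_increasing) auto
      then have "2 ^ Suc i * a \<le> 2 ^ j * a" using apos by (intro mult_right_mono) auto
      then show ?thesis unfolding I_def by fastforce
    qed
    fix i j :: nat assume "i \<noteq> j"
    then show "I i \<inter> I j = {}" using less[of i j] less[of j i] by (cases "i < j") auto
  qed
  have eq: "(\<integral>\<^sup>+t. ennreal (h j) * indicator (I j) t \<partial>lborel) = ennreal (w j / 2)" for j
  proof -
    have "(\<integral>\<^sup>+t. ennreal (h j) * indicator (I j) t \<partial>lborel) = ennreal (h j) * ennreal (2 ^ j * a)"
      using apos by (subst nn_integral_cmult_indicator) (auto simp: I_def mult.commute)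
    also have "\<dots> = ennreal (w j / 2)"
      using apos W_pos[of "2 ^ j * a"] Phi2_pos[of "2 ^ Suc j * a"]
      by (subst ennreal_mult''[symmetric]) (auto simp: h_def w_def field_simps)
    finally show ?thesis .
  qed
  have "ennreal (w j) = 2 * ennreal (w j / 2)" for j
    using ennreal_mult'[of 2 "w j / 2"] by simp
  then have "(\<Sum>j. ennreal (w j)) = 2 * (\<Sum>j. ennreal (w j / 2))" by simp
  also have "\<dots> = 2 * (\<integral>\<^sup>+t. (\<Sum>j. ennreal (h j) * indicator (I j) t) \<partial>lborel)"
    by (subst nn_integral_suminf) (simp_all only: eq, simp add: I_def)
  also have "\<dots> \<le> 2 * (\<integral>\<^sup>+t\<in>{1..}. ennreal (W t * \<Phi>2 t / t) \<partial>lborel)"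
  proof (intro mult_left_mono nn_integral_mono)
    fix t :: real
    show "(\<Sum>j. ennreal (h j) * indicator (I j) t) \<le> ennreal (W t * \<Phi>2 t / t) * indicator {1..} t"
    proof (cases "\<exists>j. t \<in> I j")
      case True
      then obtain j where j: "t \<in> I j" by auto
      then have lt: "2 ^ j * a \<le> t" "t < 2 ^ Suc j * a" by (auto simp: I_def)
      have "1 \<le> 2 ^ j * a" using a by (simp add: mult_ge1_I)
      then have t1: "1 \<le> t" using lt by auto
      have "h j \<le> W t * \<Phi>2 t / t" unfolding h_def w_def
        using lt apos t1
        by (intro frac_le mult_mono W_mono Phi2_antimono mult_nonneg_nonneg)
          (auto intro!: less_imp_le[OF Phi2_pos] less_imp_le[OF W_pos])
      moreover have "(\<Sum>j. ennreal (h j) * indicator (I j) t) = ennreal (h j)"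
        by (rule suminf_cmult_indicator[OF disj j])
      ultimately show ?thesis using t1 by (auto intro!: ennreal_leI)
    qed auto
  qed auto
  finally show ?thesis by (simp add: w_def)
qed

lemma dyadic_moment_finite:
  "2 * (\<integral>\<^sup>+t\<in>{1..}. ennreal (W t * \<Phi>2 t / t) \<partial>lborel) < \<infinity>"
  using moment by (simp add: W_def ennreal_mult_less_top)

text \<open>
  For starting points that are powers of 2 the dyadic sums are the tails of one and the same convergent series.
\<close>

lemma dyadic_moment_tail:
  assumes "0 < e"
  obtains J :: nat where
    "(\<Sum>j. ennreal (W (2 ^ j * 2 ^ J) * \<Phi>2 (2 ^ Suc j * 2 ^ J))) < ennreal e"
proof -
  define w where "w j = W (2 ^ j) * \<Phi>2 (2 ^ Suc j)" for j :: nat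
  have w0: "0 \<le> w j" for j by (simp add: w_def less_imp_le W_pos Phi2_pos)
  have "(\<Sum>j. ennreal (w j)) < \<infinity>"
    using dyadic_moment[of 1] dyadic_moment_finite by (simp add: w_def)
  then have summ: "summable w" using w0 by (intro summable_suminf_not_top) auto
  obtain J where J: "norm (\<Sum>i. w (i + J)) < e" using suminf_exist_split[OF assms summ] by auto
  have "(\<Sum>i. ennreal (w (i + J))) = ennreal (\<Sum>i. w (i + J))"
    using summ w0 by (intro suminf_ennreal2) (auto simp: summable_iff_shift)
  also have "\<dots> < ennreal e" using J assms by (intro ennreal_lessI) auto
  also have "(\<lambda>i. w (i + J)) = (\<lambda>i. W (2 ^ i * 2 ^ J) * \<Phi>2 (2 ^ Suc i * 2 ^ J))"
    unfolding w_def power_add[symmetric] by simp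
  finally show thesis by (rule that)
qed

end

section \<open>Volume bounds and growth of uniformly bounded measures\<close>

text \<open>
  The balls of radius \<open>r / 2\<close> around an \<open>r\<close>-separated subset of \<open>ball x \<rho>\<close> are disjoint and lie in
  \<open>ball x (2 \<rho>)\<close>, which bounds the number of points by \<open>B / v\<close>; if the set is maximal, the balls of radius \<open>r\<close> around it cover
  \<open>ball x \<rho>\<close>.
\<close>

lemma emeasure_ball_by_separated_cover:
  fixes m \<mu> :: "'a::{metric_space, second_countable_topology} measure"
  assumes sets [measurable_cong]: "sets m = sets borel" "sets \<mu> = sets borel"
    and r: "0 < r" "r \<le> \<rho>" and v: "0 < v" "\<And>x. ennreal v \<le> emeasure m (ball x (r / 2))"
    and M: "\<And>x. emeasure \<mu> (ball x r) \<le> M"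
    and B: "emeasure m (ball x (2 * \<rho>)) \<le> ennreal B" "0 \<le> B"
  shows "emeasure \<mu> (ball x \<rho>) \<le> M * ennreal (B / v)"
proof -
  define sep where "sep S \<longleftrightarrow> finite S \<and> S \<subseteq> ball x \<rho> \<and> (\<forall>s\<in>S. \<forall>s'\<in>S. s \<noteq> s' \<longrightarrow> r \<le> dist s s')" for S
  have card_le: "real (card S) \<le> B / v" if S: "sep S" for S
  proof -
    have fin: "finite S" and sub: "S \<subseteq> ball x \<rho>" using S by (auto simp: sep_def)
    have disj: "disjoint_family_on (\<lambda>s. ball s (r / 2)) S"
      unfolding disjoint_family_on_def
    proof (intro ballI impI)
      fix s s' assume "s \<in> S" "s' \<in> S" "s \<noteq> s'"
      then have "r \<le> dist s s'" using S by (auto simp: sep_def)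
      then show "ball s (r / 2) \<inter> ball s' (r / 2) = {}" by (intro disjoint_ballI) auto
    qed
    have "(\<Union>s\<in>S. ball s (r / 2)) \<subseteq> ball x (2 * \<rho>)"
    proof
      fix y assume "y \<in> (\<Union>s\<in>S. ball s (r / 2))"
      then obtain s where "s \<in> S" "dist s y < r / 2" by auto
      moreover then have "dist x s < \<rho>" using sub by auto
      ultimately show "y \<in> ball x (2 * \<rho>)" using dist_triangle[of x y s] r by auto
    qed
    then have "emeasure m (\<Union>s\<in>S. ball s (r / 2)) \<le> emeasure m (ball x (2 * \<rho>))"
      by (intro emeasure_mono) (auto simp: sets intro!: borel_open)
    moreover have "(\<Sum>s\<in>S. emeasure m (ball s (r / 2))) = emeasure m (\<Union>s\<in>S. ball s (r / 2))"
      using fin disj by (intro sum_emeasure) (auto simp: sets)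
    moreover have "(\<Sum>s\<in>S. ennreal v) \<le> (\<Sum>s\<in>S. emeasure m (ball s (r / 2)))"
      by (intro sum_mono v)
    ultimately have "of_nat (card S) * ennreal v \<le> ennreal B" using B by simp
    then have "ennreal (real (card S) * v) \<le> ennreal B"
      by (simp add: ennreal_mult' ennreal_of_nat_eq_real_of_nat)
    then show ?thesis using B v by (simp add: field_simps)
  qed
  have "\<exists>S. sep S \<and> (\<forall>S'. sep S' \<longrightarrow> card S' \<le> card S)"
  proof (rule ex_has_greatest_nat[where b = "Suc (nat \<lceil>B / v\<rceil>)"])
    show "sep {}" by (simp add: sep_def)
    show "\<forall>S. sep S \<longrightarrow> card S < Suc (nat \<lceil>B / v\<rceil>)" 
    proof (intro allI impI)
      fix S assume "sep S"
      from card_le[OF this] show "card S < Suc (nat \<lceil>B / v\<rceil>)" by linarith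
    qed
  qed
  then obtain S where S: "sep S" and max: "\<And>S'. sep S' \<Longrightarrow> card S' \<le> card S" by auto
  have fin: "finite S" using S by (simp add: sep_def)
  have "ball x \<rho> \<subseteq> (\<Union>s\<in>S. ball s r)"
  proof
    fix y assume y: "y \<in> ball x \<rho>"
    show "y \<in> (\<Union>s\<in>S. ball s r)"
    proof (rule ccontr)
      assume "y \<notin> (\<Union>s\<in>S. ball s r)"
      then have far: "r \<le> dist s y" if "s \<in> S" for s using that by auto
      then have "y \<notin> S" using r by fastforce
      moreover have "sep (insert y S)"
        using S y far by (auto simp: sep_def dist_commute)
      then have "card (insert y S) \<le> card S" by (rule max)
      ultimately show False using fin by simp
    qed
  qed
  then have "emeasure \<mu> (ball x \<rho>) \<le> emeasure \<mu> (\<Union>s\<in>S. ball s r)"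
    by (intro emeasure_mono) (auto simp: sets intro!: borel_open)
  also have "\<dots> \<le> (\<Sum>s\<in>S. emeasure \<mu> (ball s r))"
    using fin by (intro emeasure_subadditive_finite) (auto simp: sets)
  also have "\<dots> \<le> (\<Sum>s\<in>S. M)" by (intro sum_mono M)
  also have "\<dots> = M * ennreal (real (card S))"
    by (simp add: ennreal_of_nat_eq_real_of_nat mult.commute)
  also have "\<dots> \<le> M * ennreal (B / v)" by (intro mult_left_mono ennreal_leI card_le S) auto
  finally show ?thesis .
qed

context heat_kernel_bounds begin

lemma Phi2_measurable:
  assumes f: "f \<in> borel_measurable N" and nonneg: "\<And>x. 0 \<le> f x"
  shows "(\<lambda>x. \<Phi>2 (f x)) \<in> borel_measurable N"
proof -
  have "mono (\<lambda>u. - \<Phi>2 (max 0 u))" by (auto simp: mono_def intro!: Phi2_antimono)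
  then have "(\<lambda>u. - \<Phi>2 (max 0 u)) \<in> borel_measurable borel" by (rule borel_measurable_mono)
  then have "(\<lambda>u. \<Phi>2 (max 0 u)) \<in> borel_measurable borel"
    using borel_measurable_uminus_eq by blast
  from measurable_compose[OF f this] show ?thesis using nonneg by (simp add: max_absorb2)
qed

text \<open>
  Bound for the tail of the rescaled upper kernel, in a form that serves twice: with \<open>\<mu> = m\<close> it shows that
  little mass of the kernel lies far away, and with a general \<open>\<mu>\<close> it controls potentials
  off the diagonal. On the annulus where the distance is about \<open>2\<^bsup>j+1\<^esup> a \<tau>\<close> the kernel is at most
  \<open>\<tau>\<^bsup>-\<nu>\<^esup> \<Phi>2 (2\<^bsup>j+1\<^esup> a)\<close>, and the measure of the annulus at most \<open>A V (8 2\<^sup>j a \<tau>)\<close>, to which \<open>volume_rescale\<close> applies.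
\<close>

lemma tail_estimate:
  obtains C where "0 < C"
    and "\<And>(\<mu> :: 'a measure) A \<tau> a x. sets \<mu> = sets borel \<Longrightarrow> 0 < \<tau> \<Longrightarrow> \<tau> \<le> 1/8 \<Longrightarrow> 0 < a \<Longrightarrow>
      (\<And>\<rho>. 2 * a * \<tau> \<le> \<rho> \<Longrightarrow> emeasure \<mu> (ball x \<rho>) \<le> A * ennreal (V (2 * \<rho>))) \<Longrightarrow>
      (\<integral>\<^sup>+y\<in>{y. 2 * a * \<tau> \<le> dist x y}. ennreal (\<tau> powr - \<nu> * \<Phi>2 (dist x y / \<tau>)) \<partial>\<mu>)
        \<le> A * ennreal C * (\<Sum>j. ennreal (W (2 ^ j * a) * \<Phi>2 (2 ^ Suc j * a)))"
proof -
  obtain C where C: "0 < C"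
    "\<And>\<tau> a. 0 < \<tau> \<Longrightarrow> \<tau> \<le> 1/8 \<Longrightarrow> 0 < a \<Longrightarrow> V (8 * a * \<tau>) \<le> C * \<tau> powr \<nu> * W a"
    using volume_rescale by blast
  show thesis
  proof (rule that[OF C(1)])
    fix \<mu> :: "'a measure" and A \<tau> a x
    assume sets [measurable_cong]: "sets \<mu> = sets borel" and \<tau>: "0 < \<tau>" "\<tau> \<le> 1/8" and a: "0 < a"
      and A: "\<And>\<rho>. 2 * a * \<tau> \<le> \<rho> \<Longrightarrow> emeasure \<mu> (ball x \<rho>) \<le> A * ennreal (V (2 * \<rho>))"
    define g where "g j = ennreal (\<tau> powr - \<nu> * \<Phi>2 (2 ^ Suc j * a))" for j :: nat
    define B where "B j = ball x (2 ^ (j + 2) * a * \<tau>)" for j :: nat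
    have B_sets [measurable]: "B j \<in> sets \<mu>" for j by (simp add: B_def sets)
    have "(\<integral>\<^sup>+y\<in>{y. 2 * a * \<tau> \<le> dist x y}. ennreal (\<tau> powr - \<nu> * \<Phi>2 (dist x y / \<tau>)) \<partial>\<mu>)
      \<le> (\<integral>\<^sup>+y. (\<Sum>j. g j * indicator (B j) y) \<partial>\<mu>)"
    proof (rule nn_integral_mono)
      fix y
      show "ennreal (\<tau> powr - \<nu> * \<Phi>2 (dist x y / \<tau>)) * indicator {y. 2 * a * \<tau> \<le> dist x y} y
        \<le> (\<Sum>j. g j * indicator (B j) y)"
      proof (cases "2 * a * \<tau> \<le> dist x y")
        case True
        then have "1 \<le> dist x y / (2 * a * \<tau>)" using a \<tau> by (simp add: field_simps)
        then obtain j where j: "2 ^ j \<le> dist x y / (2 * a * \<tau>)" "dist x y / (2 * a * \<tau>) < 2 ^ Suc j"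
          using dyadic_index by blast
        have y: "y \<in> B j" using j(2) a \<tau> by (simp add: B_def field_simps)
        have "\<Phi>2 (dist x y / \<tau>) \<le> \<Phi>2 (2 ^ Suc j * a)"
          using j(1) a \<tau> by (intro Phi2_antimono) (auto simp: field_simps)
        then have "ennreal (\<tau> powr - \<nu> * \<Phi>2 (dist x y / \<tau>)) \<le> g j * indicator (B j) y"
          using y by (auto simp: g_def intro!: ennreal_leI mult_left_mono)
        also have "\<dots> \<le> (\<Sum>j. g j * indicator (B j) y)"
          using sum_le_suminf[of "\<lambda>j. g j * indicator (B j) y" "{j}"] by (simp del: sum_mult_indicator)
        finally show ?thesis using True by simp
      qed simp
    qed
    also have "\<dots> = (\<Sum>j. g j * emeasure \<mu> (B j))"
      by (simp add: nn_integral_suminf nn_integral_cmult_indicator)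
    also have "\<dots> \<le> (\<Sum>j. A * ennreal C * ennreal (W (2 ^ j * a) * \<Phi>2 (2 ^ Suc j * a)))"
    proof (intro suminf_le allI)
      fix j :: nat
      have ge: "2 * a * \<tau> \<le> 2 ^ (j + 2) * a * \<tau>"
        using a \<tau> one_le_power[of "2::real" j] by (intro mult_right_mono) (auto simp del: one_le_power)
      have "g j * emeasure \<mu> (B j) \<le> g j * (A * ennreal (V (8 * (2 ^ j * a) * \<tau>)))"
        using A[OF ge] by (intro mult_left_mono) (auto simp: B_def algebra_simps)
      also have "\<dots> \<le> g j * (A * ennreal (C * \<tau> powr \<nu> * W (2 ^ j * a)))"
        using C(2)[of \<tau> "2 ^ j * a"] a \<tau> by (intro mult_left_mono ennreal_leI) auto
      also have "\<dots> = A * (g j * ennreal (C * \<tau> powr \<nu> * W (2 ^ j * a)))"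
        by (simp add: ac_simps)
      also have "g j * ennreal (C * \<tau> powr \<nu> * W (2 ^ j * a))
          = ennreal (C * (W (2 ^ j * a) * \<Phi>2 (2 ^ Suc j * a)))"
        unfolding g_def using \<tau> a C(1) W_pos[of "2 ^ j * a"] Phi2_pos[of "2 ^ Suc j * a"]
        by (subst ennreal_mult[symmetric]) (auto simp: powr_minus field_simps)
      also have "A * \<dots> = A * ennreal C * ennreal (W (2 ^ j * a) * \<Phi>2 (2 ^ Suc j * a))"
        using a C(1) W_pos[of "2 ^ j * a"] Phi2_pos[of "2 ^ Suc j * a"]
        by (subst ennreal_mult) (auto simp: mult.assoc)
      finally show "g j * emeasure \<mu> (B j)
        \<le> A * ennreal C * ennreal (W (2 ^ j * a) * \<Phi>2 (2 ^ Suc j * a))" .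
    qed auto
    also have "\<dots> = A * ennreal C * (\<Sum>j. ennreal (W (2 ^ j * a) * \<Phi>2 (2 ^ Suc j * a)))"
      by (rule ennreal_suminf_cmult)
    finally show "(\<integral>\<^sup>+y\<in>{y. 2 * a * \<tau> \<le> dist x y}. ennreal (\<tau> powr - \<nu> * \<Phi>2 (dist x y / \<tau>)) \<partial>\<mu>)
        \<le> A * ennreal C * (\<Sum>j. ennreal (W (2 ^ j * a) * \<Phi>2 (2 ^ Suc j * a)))" .
  qed
qed

text \<open>
  The life time condition turned into a lower volume bound. Put \<open>\<tau> = t\<^bsup>1/\<beta>\<^esup>\<close>. Once \<open>a\<close> is large, the
  kernel has mass at most \<open>c0 / 2\<close> beyond distance \<open>2 a \<tau>\<close>, so that mass at least \<open>c0 / 2\<close> remains in a ball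
  on which the density is at most \<open>\<tau>\<^bsup>-\<nu>\<^esup> \<Phi>2 0\<close>.
\<close>

lemma volume_lower:
  obtains c r0 where "0 < c" "0 < r0"
    "\<And>x r. 0 < r \<Longrightarrow> r \<le> r0 \<Longrightarrow> ennreal (c * r powr \<nu>) \<le> emeasure m (ball x r)"
proof -
  obtain C where C: "0 < C"
    and tail: "\<And>(\<mu> :: 'a measure) A \<tau> a x. sets \<mu> = sets borel \<Longrightarrow> 0 < \<tau> \<Longrightarrow> \<tau> \<le> 1/8 \<Longrightarrow> 0 < a \<Longrightarrow>
      (\<And>\<rho>. 2 * a * \<tau> \<le> \<rho> \<Longrightarrow> emeasure \<mu> (ball x \<rho>) \<le> A * ennreal (V (2 * \<rho>))) \<Longrightarrow>
      (\<integral>\<^sup>+y\<in>{y. 2 * a * \<tau> \<le> dist x y}. ennreal (\<tau> powr - \<nu> * \<Phi>2 (dist x y / \<tau>)) \<partial>\<mu>)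
        \<le> A * ennreal C * (\<Sum>j. ennreal (W (2 ^ j * a) * \<Phi>2 (2 ^ Suc j * a)))"
    using tail_estimate by blast
  obtain J :: nat where
    J: "(\<Sum>j. ennreal (W (2 ^ j * 2 ^ J) * \<Phi>2 (2 ^ Suc j * 2 ^ J))) < ennreal (c0 / (2 * C))"
    using dyadic_moment_tail[of "c0 / (2 * C)"] c0_pos C by auto
  define a :: real where "a = 2 ^ J"
  define \<tau>0 where "\<tau>0 = min (1/8) (T powr (1 / \<beta>) / 2)"
  have a: "0 < a" by (simp add: a_def)
  have \<tau>0: "0 < \<tau>0" using T_pos by (simp add: \<tau>0_def)
  define c where "c = c0 / (2 * \<Phi>2 0 * (2 * a) powr \<nu>)"
  have P0: "0 < \<Phi>2 0" by (simp add: Phi2_pos)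
  show thesis
  proof (rule that[of c "2 * a * \<tau>0"])
    show "0 < c" using c0_pos P0 a by (simp add: c_def)
    show "0 < 2 * a * \<tau>0" using a \<tau>0 by simp
    fix x r assume r: "0 < r" "r \<le> 2 * a * \<tau>0"
    define \<tau> where "\<tau> = r / (2 * a)"
    have \<tau>: "0 < \<tau>" "\<tau> \<le> 1/8" "\<tau> < T powr (1 / \<beta>)" "2 * a * \<tau> = r"
    proof -
      have "\<tau> \<le> \<tau>0" using r a by (simp add: \<tau>_def field_simps)
      then show "\<tau> \<le> 1/8" "\<tau> < T powr (1 / \<beta>)"
        using T_pos \<tau>0 powr_gt_zero[of T "1 / \<beta>"] by (auto simp: \<tau>0_def simp del: powr_gt_zero)
    qed (use r a in \<open>auto simp: \<tau>_def\<close>)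
    define t where "t = \<tau> powr \<beta>"
    have "t < (T powr (1 / \<beta>)) powr \<beta>" unfolding t_def using \<tau> beta_pos by (intro powr_less_mono2) auto
    then have t: "0 < t" "t < T" using \<tau> T_pos beta_pos by (auto simp: t_def powr_powr)
    have tp: "t powr (1 / \<beta>) = \<tau>" "t powr (- \<nu> / \<beta>) = \<tau> powr - \<nu>"
      using \<tau> beta_pos by (auto simp: t_def powr_powr)
    have m [measurable_cong]: "sets m = sets borel" by (rule sets_m)
    have Phi [measurable]: "(\<lambda>y. \<Phi>2 (dist x y / \<tau>)) \<in> borel_measurable m"
      using \<tau> by (intro Phi2_measurable) auto
    have "(\<integral>\<^sup>+y. ennreal (k t x y) \<partial>m) \<le> (\<integral>\<^sup>+y. ennreal (\<tau> powr - \<nu> * \<Phi>2 0) * indicator (ball x r) y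
        + ennreal (\<tau> powr - \<nu> * \<Phi>2 (dist x y / \<tau>)) * indicator {y. 2 * a * \<tau> \<le> dist x y} y \<partial>m)"
    proof (rule nn_integral_mono)
      fix y
      have upper: "k t x y \<le> \<tau> powr - \<nu> * \<Phi>2 (dist x y / \<tau>)" using kernel_upper[OF t, of x y] unfolding tp .
      have "\<Phi>2 (dist x y / \<tau>) \<le> \<Phi>2 0" using \<tau> by (intro Phi2_antimono) auto
      then have "\<tau> powr - \<nu> * \<Phi>2 (dist x y / \<tau>) \<le> \<tau> powr - \<nu> * \<Phi>2 0" by (intro mult_left_mono) auto
      with upper have "k t x y \<le> \<tau> powr - \<nu> * \<Phi>2 0" by linarith
      then show "ennreal (k t x y) \<le> ennreal (\<tau> powr - \<nu> * \<Phi>2 0) * indicator (ball x r) y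
        + ennreal (\<tau> powr - \<nu> * \<Phi>2 (dist x y / \<tau>)) * indicator {y. 2 * a * \<tau> \<le> dist x y} y"
      proof (cases "dist x y < r")
        case True
        then show ?thesis using \<open>k t x y \<le> \<tau> powr - \<nu> * \<Phi>2 0\<close> \<tau>(4)
          by (simp add: ennreal_leI)
      next
        case False
        then show ?thesis using upper \<tau>(4) by (simp add: ennreal_leI)
      qed
    qed
    also have "\<dots> = ennreal (\<tau> powr - \<nu> * \<Phi>2 0) * emeasure m (ball x r)
      + (\<integral>\<^sup>+y\<in>{y. 2 * a * \<tau> \<le> dist x y}. ennreal (\<tau> powr - \<nu> * \<Phi>2 (dist x y / \<tau>)) \<partial>m)"
    proof (subst nn_integral_add)
      show "(\<lambda>y. ennreal (\<tau> powr - \<nu> * \<Phi>2 0) * indicator (ball x r) y) \<in> borel_measurable m"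
        by (intro borel_measurable_times_ennreal borel_measurable_indicator) (simp_all add: sets_m)
      show "(\<lambda>y. ennreal (\<tau> powr - \<nu> * \<Phi>2 (dist x y / \<tau>)) * indicator {y. 2 * a * \<tau> \<le> dist x y} y)
        \<in> borel_measurable m"
        by measurable
    qed (simp add: nn_integral_cmult_indicator sets_m)
    also have "\<dots> \<le> ennreal (\<tau> powr - \<nu> * \<Phi>2 0) * emeasure m (ball x r) + ennreal (c0 / 2)"
    proof (rule add_left_mono)
      have "(\<integral>\<^sup>+y\<in>{y. 2 * a * \<tau> \<le> dist x y}. ennreal (\<tau> powr - \<nu> * \<Phi>2 (dist x y / \<tau>)) \<partial>m)
        \<le> 1 * ennreal C * (\<Sum>j. ennreal (W (2 ^ j * a) * \<Phi>2 (2 ^ Suc j * a)))"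
      proof (rule tail[OF sets_m \<tau>(1,2) a])
        fix \<rho> assume "2 * a * \<tau> \<le> \<rho>"
        then have \<rho>: "0 < \<rho>" using \<tau>(4) r(1) by simp
        then have "emeasure m (ball x \<rho>) \<le> ennreal (V \<rho>)" by (rule emeasure_ball_le)
        also have "\<dots> \<le> ennreal (V (2 * \<rho>))" using \<rho> by (intro ennreal_leI V_mono) auto
        finally show "emeasure m (ball x \<rho>) \<le> 1 * ennreal (V (2 * \<rho>))" by simp
      qed
      also have "\<dots> \<le> ennreal C * ennreal (c0 / (2 * C))"
        using J by (auto simp: a_def intro!: mult_left_mono)
      also have "\<dots> = ennreal (c0 / 2)" using C c0_pos by (simp flip: ennreal_mult')
      finally show "(\<integral>\<^sup>+y\<in>{y. 2 * a * \<tau> \<le> dist x y}. ennreal (\<tau> powr - \<nu> * \<Phi>2 (dist x y / \<tau>)) \<partial>m)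
        \<le> ennreal (c0 / 2)" .
    qed
    finally have le: "ennreal c0 \<le> ennreal (\<tau> powr - \<nu> * \<Phi>2 0) * emeasure m (ball x r) + ennreal (c0 / 2)"
      using survival[OF t, of x] by (rule order.trans[rotated])
    have "emeasure m (ball x r) \<noteq> \<top>" using emeasure_ball_le[OF r(1), of x] by (auto simp: top_unique)
    then obtain v where v: "0 \<le> v" "emeasure m (ball x r) = ennreal v"
      by (cases "emeasure m (ball x r)") auto
    have "c0 \<le> \<tau> powr - \<nu> * \<Phi>2 0 * v + c0 / 2"
      using le v P0 c0_pos by (simp flip: ennreal_mult' ennreal_plus)
    then have "c0 * \<tau> powr \<nu> \<le> 2 * \<Phi>2 0 * v" using \<tau>(1) by (simp add: powr_minus field_simps)
    moreover have "r powr \<nu> = (2 * a) powr \<nu> * \<tau> powr \<nu>"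
      unfolding \<tau>(4)[symmetric] using \<tau>(1) a by (simp add: powr_mult)
    ultimately have "c * r powr \<nu> \<le> v" using P0 a by (simp add: c_def field_simps)
    then show "ennreal (c * r powr \<nu>) \<le> emeasure m (ball x r)" using v by (simp add: ennreal_leI)
  qed
qed

lemma ball_growth:
  obtains r0 where "0 < r0"
    "\<And>r. 0 < r \<Longrightarrow> r \<le> r0 \<Longrightarrow> \<exists>K. \<forall>\<mu> :: 'a measure. \<forall>M x \<rho>. sets \<mu> = sets borel \<longrightarrow>
       (\<forall>x. emeasure \<mu> (ball x r) \<le> M) \<longrightarrow> r \<le> \<rho> \<longrightarrow>
       emeasure \<mu> (ball x \<rho>) \<le> M * ennreal K * ennreal (V (2 * \<rho>))"
proof -
  obtain c r0 where c: "0 < c" "0 < r0"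
    "\<And>x r. 0 < r \<Longrightarrow> r \<le> r0 \<Longrightarrow> ennreal (c * r powr \<nu>) \<le> emeasure m (ball x r)"
    using volume_lower by blast
  show thesis
  proof (rule that[OF c(2)], intro exI allI impI)
    fix r x \<rho> and M and \<mu> :: "'a measure"
    assume r: "0 < r" "r \<le> r0" "r \<le> \<rho>" and \<mu>: "sets \<mu> = sets borel" "\<forall>x. emeasure \<mu> (ball x r) \<le> M"
    let ?v = "c * (r / 2) powr \<nu>"
    have v: "0 < ?v" using c r by simp
    have V: "0 \<le> V (2 * \<rho>)" using r by (intro less_imp_le V_pos) auto
    have "emeasure \<mu> (ball x \<rho>) \<le> M * ennreal (V (2 * \<rho>) / ?v)"
      using r \<mu> v V c by (intro emeasure_ball_by_separated_cover[OF sets_m]) (auto intro!: emeasure_ball_le)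
    also have "\<dots> = M * ennreal (1 / ?v) * ennreal (V (2 * \<rho>))"
      using V v by (subst mult.assoc, subst ennreal_mult[symmetric]) auto
    finally show "emeasure \<mu> (ball x \<rho>) \<le> M * ennreal (1 / ?v) * ennreal (V (2 * \<rho>))" .
  qed
qed

section \<open>Upper bounds for the potential\<close>

text \<open>
  The upper kernel bound integrated over time, as a function of the distance \<open>d\<close>. Working with it avoids
  the kernel itself: it is measurable in the distance by monotonicity of \<open>\<Phi>2\<close>.
\<close>

definition majorant :: "real \<Rightarrow> real \<Rightarrow> ennreal" where
  "majorant t d = (\<integral>\<^sup>+s\<in>{0<..<t}. ennreal (s powr (- \<nu> / \<beta>) * \<Phi>2 (d / s powr (1 / \<beta>))) \<partial>lborel)"

lemma time_integral_le_majorant: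
  assumes "t \<le> T" shows "time_integral k t x y \<le> majorant t (dist x y)"
  unfolding time_integral_def majorant_def
  using assms kernel_upper[of _ x y]
  by (intro nn_integral_mono) (auto simp: indicator_def intro!: ennreal_leI)

text \<open>
  A single term of the dyadic sum already bounds \<open>a\<^sup>\<nu> \<Phi>2 (2 a)\<close>. This pointwise decay is all that is needed
  of \<open>\<Phi>2\<close> for a fixed pair of points.
\<close>

lemma powr_Phi2_bounded:
  obtains B where "0 < B" "\<forall>u\<ge>0. u powr \<nu> * \<Phi>2 u \<le> B"
proof -
  obtain I where I: "0 \<le> I" "2 * (\<integral>\<^sup>+t\<in>{1..}. ennreal (W t * \<Phi>2 t / t) \<partial>lborel) = ennreal I"
    using dyadic_moment_finite by (auto simp: less_top_ennreal)
  show thesis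
  proof (rule that[of "2 powr \<nu> * \<Phi>2 0 + 2 powr \<nu> * I"])
    show "0 < 2 powr \<nu> * \<Phi>2 0 + 2 powr \<nu> * I"
      using I Phi2_pos[of 0] by (intro add_pos_nonneg) auto
    show "\<forall>u\<ge>0. u powr \<nu> * \<Phi>2 u \<le> 2 powr \<nu> * \<Phi>2 0 + 2 powr \<nu> * I"
    proof (intro allI impI)
      fix u :: real assume u: "0 \<le> u"
      show "u powr \<nu> * \<Phi>2 u \<le> 2 powr \<nu> * \<Phi>2 0 + 2 powr \<nu> * I"
      proof (cases "u \<le> 2")
        case True
        then have "u powr \<nu> * \<Phi>2 u \<le> 2 powr \<nu> * \<Phi>2 0"
          using u nu_pos by (intro mult_mono powr_mono2 Phi2_antimono less_imp_le[OF Phi2_pos]) auto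
        then show ?thesis using I by (simp add: add_increasing2)
      next
        case False
        define a where "a = u / 2"
        have a: "1 \<le> a" "u = 2 * a" using False by (auto simp: a_def)
        have "ennreal (W a * \<Phi>2 (2 * a)) \<le> (\<Sum>j. ennreal (W (2 ^ j * a) * \<Phi>2 (2 ^ Suc j * a)))"
          using sum_le_suminf[of "\<lambda>j. ennreal (W (2 ^ j * a) * \<Phi>2 (2 ^ Suc j * a))" "{0}"] by simp
        also have "\<dots> \<le> ennreal I" using dyadic_moment[OF a(1)] I(2) by simp
        finally have "W a * \<Phi>2 u \<le> I" using I(1) a by simp
        moreover have "a powr \<nu> * \<Phi>2 u \<le> W a * \<Phi>2 u"
          using less_imp_le[OF Phi2_pos[OF u]] by (intro mult_right_mono) (auto simp: W_def)
        ultimately have "2 powr \<nu> * (a powr \<nu> * \<Phi>2 u) \<le> 2 powr \<nu> * I" by (intro mult_left_mono) auto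
        then have "u powr \<nu> * \<Phi>2 u \<le> 2 powr \<nu> * I" using a by (simp add: powr_mult)
        moreover have "0 \<le> 2 powr \<nu> * \<Phi>2 0" using Phi2_pos[of 0] by simp
        ultimately show ?thesis by linarith
      qed
    qed
  qed
qed

text \<open>The factor \<open>s\<^bsup>-\<nu>/\<beta>\<^esup>\<close> equals \<open>d\<^bsup>-\<nu>\<^esup> u\<^sup>\<nu>\<close> for \<open>u = d / s\<^bsup>1/\<beta>\<^esup>\<close>.\<close>

lemma upper_kernel_le:
  assumes B: "\<forall>u\<ge>0. u powr \<nu> * \<Phi>2 u \<le> B" and "0 < d" "0 < s"
  shows "s powr (- \<nu> / \<beta>) * \<Phi>2 (d / s powr (1 / \<beta>)) \<le> B * d powr - \<nu>"
proof -
  have "s powr (- \<nu> / \<beta>) * \<Phi>2 (d / s powr (1 / \<beta>))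
      = ((d / s powr (1 / \<beta>)) powr \<nu> * \<Phi>2 (d / s powr (1 / \<beta>))) * d powr - \<nu>"
    using assms(2,3) beta_pos by (simp add: powr_divide powr_powr powr_minus field_simps)
  also have "\<dots> \<le> B * d powr - \<nu>" using assms by (intro mult_right_mono B[rule_format]) auto
  finally show ?thesis .
qed

lemma majorant_le_linear:
  assumes B: "0 < B" "\<forall>u\<ge>0. u powr \<nu> * \<Phi>2 u \<le> B" and d: "0 < r" "r \<le> d" and t: "0 \<le> t"
  shows "majorant t d \<le> ennreal (B * r powr - \<nu> * t)"
proof -
  have "majorant t d \<le> (\<integral>\<^sup>+s. ennreal (B * r powr - \<nu>) * indicator {0<..<t} s \<partial>lborel)"
    unfolding majorant_def
  proof (rule nn_integral_mono)
    fix s :: real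
    have "s powr (- \<nu> / \<beta>) * \<Phi>2 (d / s powr (1 / \<beta>)) \<le> B * r powr - \<nu>" if "0 < s"
    proof -
      have "B * d powr - \<nu> \<le> B * r powr - \<nu>"
        using d B(1) nu_pos by (intro mult_left_mono powr_mono2') auto
      with upper_kernel_le[OF B(2), of d s] d that show ?thesis by simp
    qed
    then show "ennreal (s powr (- \<nu> / \<beta>) * \<Phi>2 (d / s powr (1 / \<beta>))) * indicator {0<..<t} s
        \<le> ennreal (B * r powr - \<nu>) * indicator {0<..<t} s"
      by (auto simp: indicator_def intro!: ennreal_leI)
  qed
  also have "\<dots> = ennreal (B * r powr - \<nu> * t)"
    using t B(1) by (subst nn_integral_cmult_indicator) (auto simp flip: ennreal_mult'')
  finally show ?thesis .
qed

text \<open>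
  The natural cut is at time \<open>d\<^sup>\<beta>\<close>: before it the points are far apart at the scale \<open>s\<^bsup>1/\<beta>\<^esup>\<close>, and the
  decay of \<open>\<Phi>2\<close> gives \<open>d\<^bsup>\<beta>-\<nu>\<^esup>\<close>; after it only \<open>\<Phi>2 0\<close> is used.
\<close>

lemma majorant_le_split:
  assumes B: "0 < B" "\<forall>u\<ge>0. u powr \<nu> * \<Phi>2 u \<le> B" and d: "0 < d"
  shows "majorant t d \<le> ennreal (B * d powr (\<beta> - \<nu>))
    + ennreal (\<Phi>2 0) * (\<integral>\<^sup>+s\<in>{d powr \<beta>..t}. ennreal (s powr (- \<nu> / \<beta>)) \<partial>lborel)"
proof -
  let ?a = "d powr \<beta>"
  have "majorant t d \<le> (\<integral>\<^sup>+s. ennreal (B * d powr - \<nu>) * indicator {0<..<?a} s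
      + ennreal (\<Phi>2 0) * (ennreal (s powr (- \<nu> / \<beta>)) * indicator {?a..t} s) \<partial>lborel)"
    unfolding majorant_def
  proof (rule nn_integral_mono)
    fix s :: real
    have 1: "s powr (- \<nu> / \<beta>) * \<Phi>2 (d / s powr (1 / \<beta>)) \<le> B * d powr - \<nu>" if "0 < s"
      using upper_kernel_le[OF B(2) d that] .
    have "\<Phi>2 (d / s powr (1 / \<beta>)) * s powr (- \<nu> / \<beta>) \<le> \<Phi>2 0 * s powr (- \<nu> / \<beta>)"
      using d by (intro mult_right_mono Phi2_antimono) auto
    then have "ennreal (\<Phi>2 (d / s powr (1 / \<beta>)) * s powr (- \<nu> / \<beta>))
        \<le> ennreal (\<Phi>2 0) * ennreal (s powr (- \<nu> / \<beta>))"
      using Phi2_pos[of 0] by (simp flip: ennreal_mult add: ennreal_leI)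
    with 1 show "ennreal (s powr (- \<nu> / \<beta>) * \<Phi>2 (d / s powr (1 / \<beta>))) * indicator {0<..<t} s
        \<le> ennreal (B * d powr - \<nu>) * indicator {0<..<?a} s
          + ennreal (\<Phi>2 0) * (ennreal (s powr (- \<nu> / \<beta>)) * indicator {?a..t} s)"
      by (cases "s < ?a"; cases "0 < s"; cases "s < t") (auto simp: mult.commute intro!: ennreal_leI)
  qed
  also have "\<dots> = ennreal (B * d powr - \<nu>) * ennreal ?a
      + ennreal (\<Phi>2 0) * (\<integral>\<^sup>+s\<in>{?a..t}. ennreal (s powr (- \<nu> / \<beta>)) \<partial>lborel)"
    by (simp add: nn_integral_add nn_integral_cmult nn_integral_cmult_indicator)
  also have "ennreal (B * d powr - \<nu>) * ennreal ?a = ennreal (B * d powr (\<beta> - \<nu>))"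
    using B(1) by (simp flip: ennreal_mult add: powr_add[symmetric] mult.assoc)
  finally show ?thesis .
qed

lemma (in -) nn_integral_powr:
  fixes e :: real
  assumes "e \<noteq> -1" "0 < a" "a \<le> b"
  shows "(\<integral>\<^sup>+s\<in>{a..b}. ennreal (s powr e) \<partial>lborel) = ennreal ((b powr (e + 1) - a powr (e + 1)) / (e + 1))"
proof -
  have e: "e + 1 \<noteq> 0" using assms(1) by linarith
  have "(\<integral>\<^sup>+s\<in>{a..b}. ennreal (s powr e) \<partial>lborel)
      = ennreal (b powr (e + 1) / (e + 1) - a powr (e + 1) / (e + 1))"
  proof (rule nn_integral_FTC_Icc)
    fix s assume "s \<in> {a..b}"
    then have "0 < s" using assms by auto
    then show "((\<lambda>s. s powr (e + 1) / (e + 1)) has_real_derivative s powr e) (at s)"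
      using e by (auto intro!: derivative_eq_intros)
  qed (use assms in auto)
  then show ?thesis by (simp add: diff_divide_distrib)
qed

lemma (in -) nn_integral_powr_minus_1:
  fixes a b :: real
  assumes "0 < a" "a \<le> b"
  shows "(\<integral>\<^sup>+s\<in>{a..b}. ennreal (s powr - 1) \<partial>lborel) = ennreal (ln b - ln a)"
proof (rule nn_integral_FTC_Icc)
  fix s assume "s \<in> {a..b}"
  then have "0 < s" using assms by auto
  then show "(ln has_real_derivative s powr - 1) (at s)"
    by (auto intro!: derivative_eq_intros simp: powr_minus divide_inverse)
qed (use assms in auto)

text \<open>
  After the cut at \<open>d\<^sup>\<beta>\<close> the remaining integral of \<open>s\<^bsup>-\<nu>/\<beta>\<^esup>\<close> is of order \<open>d\<^bsup>\<beta>-\<nu>\<^esup>\<close> if \<open>\<nu> > \<beta>\<close> and logarithmic if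
  \<open>\<nu> = \<beta>\<close>; keeping \<open>d < 1/2\<close> makes the logarithm absorb the constant from the first part.
\<close>

lemma majorant_le_green:
  assumes nb: "\<beta> \<le> \<nu>"
  obtains C r1 where "0 < C" "0 < r1" "r1 < 1"
    "\<And>t d. 0 < t \<Longrightarrow> t \<le> 1 \<Longrightarrow> 0 \<le> d \<Longrightarrow> d < r1 \<Longrightarrow> majorant t d \<le> ennreal C * green \<nu> \<beta> d"
proof -
  obtain B where B: "0 < B" "\<forall>u\<ge>0. u powr \<nu> * \<Phi>2 u \<le> B"
    using powr_Phi2_bounded by blast
  have P0: "0 < \<Phi>2 0" by (simp add: Phi2_pos)
  note split = majorant_le_split[OF B]
  define I where "I d t = (\<integral>\<^sup>+s\<in>{d powr \<beta>..t}. ennreal (s powr (- \<nu> / \<beta>)) \<partial>lborel)" for d t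
  show thesis
  proof (cases "\<nu> = \<beta>")
    case False
    then have nb': "\<beta> < \<nu>" using nb by simp
    define e where "e = \<nu> / \<beta> - 1"
    have e: "0 < e" using nb' beta_pos by (simp add: e_def field_simps)
    show thesis
    proof (rule that[of "B + \<Phi>2 0 / e" "1/2"])
      fix t d :: real assume t: "0 < t" "t \<le> 1" and d: "0 \<le> d" "d < 1/2"
      show "majorant t d \<le> ennreal (B + \<Phi>2 0 / e) * green \<nu> \<beta> d"
      proof (cases "d = 0")
        case True
        have "0 < B + \<Phi>2 0 / e" using B P0 e by (intro add_pos_pos) auto
        then show ?thesis using True by (simp add: green_def ennreal_mult_top)
      next
        case False
        then have d0: "0 < d" using d by simp
        have "I d t \<le> ennreal (d powr (\<beta> - \<nu>) / e)"
        proof (cases "d powr \<beta> \<le> t")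
          case True
          have "I d t = ennreal ((t powr - e - (d powr \<beta>) powr - e) / - e)"
            unfolding I_def using nn_integral_powr[of "- \<nu> / \<beta>" "d powr \<beta>" t] True d0 e nb' beta_pos
            by (simp add: e_def)
          also have "(t powr - e - (d powr \<beta>) powr - e) / - e = ((d powr \<beta>) powr - e - t powr - e) / e"
            using e by (simp add: field_simps)
          also have "\<dots> \<le> (d powr \<beta>) powr - e / e" using e by (intro divide_right_mono) auto
          also have "(d powr \<beta>) powr - e = d powr (\<beta> * - e)" by (rule powr_powr)
          also have "\<beta> * - e = \<beta> - \<nu>" using beta_pos by (simp add: e_def algebra_simps)
          finally show ?thesis by (simp add: ennreal_leI)
        next
          case False
          then show ?thesis by (simp add: I_def)
        qed
        then have "majorant t d \<le> ennreal (B * d powr (\<beta> - \<nu>)) + ennreal (\<Phi>2 0) * ennreal (d powr (\<beta> - \<nu>) / e)"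
          using split[OF d0, of t] unfolding I_def
          by (meson add_left_mono mult_left_mono order_trans zero_le)
        also have "\<dots> = ennreal ((B + \<Phi>2 0 / e) * d powr (\<beta> - \<nu>))"
          using B P0 e by (simp flip: ennreal_mult ennreal_plus add: algebra_simps)
        also have "\<dots> = ennreal (B + \<Phi>2 0 / e) * green \<nu> \<beta> d"
          using B P0 e nb' d0 by (simp add: green_def ennreal_mult)
        finally show ?thesis .
      qed
    qed (use B P0 e in \<open>auto intro!: add_pos_pos\<close>)
  next
    case True
    define C where "C = B / ln 2 + \<Phi>2 0 * \<beta>"
    have ln2: "0 < ln (2::real)" by simp
    have C: "0 < C" using B P0 beta_pos by (simp add: C_def add_pos_pos)
    show thesis
    proof (rule that[of C "1/2"])
      fix t d :: real assume t: "0 < t" "t \<le> 1" and d: "0 \<le> d" "d < 1/2"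
      show "majorant t d \<le> ennreal C * green \<nu> \<beta> d"
      proof (cases "d = 0")
        case True
        then show ?thesis using C by (simp add: green_def ennreal_mult_top)
      next
        case False
        then have d0: "0 < d" using d by simp
        have ln: "ln 2 \<le> ln (1 / d)" using d d0 by (subst ln_le_cancel_iff) (auto simp: field_simps)
        have "I d t \<le> ennreal (\<beta> * ln (1 / d))"
        proof (cases "d powr \<beta> \<le> t")
          case le: True
          have "I d t = ennreal (ln t - ln (d powr \<beta>))"
            unfolding I_def using nn_integral_powr_minus_1[of "d powr \<beta>" t] le d0 beta_pos True by simp
          also have "\<dots> \<le> ennreal (\<beta> * ln (1 / d))"
            using t d0 by (intro ennreal_leI) (simp add: ln_powr ln_div)
          finally show ?thesis .
        next
          case False
          then show ?thesis by (simp add: I_def)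
        qed
        then have "majorant t d \<le> ennreal (B * d powr (\<beta> - \<nu>)) + ennreal (\<Phi>2 0) * ennreal (\<beta> * ln (1 / d))"
          using split[OF d0, of t] unfolding I_def
          by (meson add_left_mono mult_left_mono order_trans zero_le)
        also have "\<dots> = ennreal (B + \<Phi>2 0 * (\<beta> * ln (1 / d)))"
        proof -
          have "0 \<le> \<beta> * ln (1 / d)" using ln ln2 beta_pos by (intro mult_nonneg_nonneg) linarith+
          then show ?thesis using True d0 B P0 by (simp flip: ennreal_mult ennreal_plus)
        qed
        also have "\<dots> \<le> ennreal (C * ln (1 / d))"
        proof (rule ennreal_leI)
          have "B * ln 2 \<le> B * ln (1 / d)" using ln B by (intro mult_left_mono) auto
          then have "B \<le> B / ln 2 * ln (1 / d)" using ln2 by (simp add: field_simps)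
          then show "B + \<Phi>2 0 * (\<beta> * ln (1 / d)) \<le> C * ln (1 / d)" by (simp add: C_def algebra_simps)
        qed
        also have "\<dots> = ennreal C * green \<nu> \<beta> d"
          using C True d0 by (simp add: green_def ennreal_mult')
        finally show ?thesis .
      qed
    qed (use C in auto)
  qed
qed

lemma majorant_le_powr:
  assumes nb: "\<nu> < \<beta>" and t: "0 \<le> t" and d: "0 \<le> d"
  shows "majorant t d \<le> ennreal (\<Phi>2 0 / (1 - \<nu> / \<beta>) * t powr (1 - \<nu> / \<beta>))"
proof -
  have e: "0 < 1 - \<nu> / \<beta>" using nb beta_pos by simp
  have P0: "0 < \<Phi>2 0" by (simp add: Phi2_pos)
  have "majorant t d \<le> (\<integral>\<^sup>+s. ennreal (\<Phi>2 0) * (ennreal (s powr (- \<nu> / \<beta>)) * indicator {0..t} s) \<partial>lborel)"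
    unfolding majorant_def
  proof (rule nn_integral_mono)
    fix s :: real
    have "\<Phi>2 (d / s powr (1 / \<beta>)) * s powr (- \<nu> / \<beta>) \<le> \<Phi>2 0 * s powr (- \<nu> / \<beta>)"
      using d by (intro mult_right_mono Phi2_antimono) auto
    then have "ennreal (\<Phi>2 (d / s powr (1 / \<beta>)) * s powr (- \<nu> / \<beta>))
        \<le> ennreal (\<Phi>2 0) * ennreal (s powr (- \<nu> / \<beta>))"
      using P0 by (simp flip: ennreal_mult add: ennreal_leI)
    then show "ennreal (s powr (- \<nu> / \<beta>) * \<Phi>2 (d / s powr (1 / \<beta>))) * indicator {0<..<t} s
        \<le> ennreal (\<Phi>2 0) * (ennreal (s powr (- \<nu> / \<beta>)) * indicator {0..t} s)"
      by (auto simp: indicator_def mult.commute)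
  qed
  also have "\<dots> = ennreal (\<Phi>2 0) * (\<integral>\<^sup>+s\<in>{0..t}. ennreal (s powr (- \<nu> / \<beta>)) \<partial>lborel)"
    by (simp add: nn_integral_cmult)
  also have "(\<integral>\<^sup>+s\<in>{0..t}. ennreal (s powr (- \<nu> / \<beta>)) \<partial>lborel)
      = ennreal (t powr (- \<nu> / \<beta> + 1) / (- \<nu> / \<beta> + 1))"
    using t e by (intro nn_integral_has_integral_lebesgue' has_integral_powr_from_0) auto
  also have "ennreal (\<Phi>2 0) * \<dots> = ennreal (\<Phi>2 0 / (1 - \<nu> / \<beta>) * t powr (1 - \<nu> / \<beta>))"
    using P0 e by (simp flip: ennreal_mult add: add.commute)
  finally show ?thesis .
qed

end

section \<open>The classes through their suprema\<close>

text \<open>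
  For a monotone function convergence to 0 at \<open>0\<close> only requires arbitrarily small values, so that the defining
  conditions of the two Kato classes can be compared one radius and one time at a time.
\<close>

lemma tendsto_0_at_right_mono_iff:
  fixes f :: "real \<Rightarrow> ennreal"
  assumes mono: "\<And>s t. 0 < s \<Longrightarrow> s \<le> t \<Longrightarrow> f s \<le> f t"
  shows "(f \<longlongrightarrow> 0) (at_right 0) \<longleftrightarrow> (\<forall>e>0. \<exists>t>0. f t < ennreal e)"
proof
  assume lim: "(f \<longlongrightarrow> 0) (at_right 0)"
  show "\<forall>e>0. \<exists>t>0. f t < ennreal e"
  proof (intro allI impI)
    fix e :: real assume "0 < e"
    then have "\<forall>\<^sub>F t in at_right 0. f t < ennreal e" using order_tendstoD(2)[OF lim] by simp
    then obtain b where "0 < b" "\<forall>t>0. t < b \<longrightarrow> f t < ennreal e"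
      unfolding eventually_at_right_field by auto
    then show "\<exists>t>0. f t < ennreal e" by (intro exI[of _ "b / 2"]) auto
  qed
next
  assume *: "\<forall>e>0. \<exists>t>0. f t < ennreal e"
  show "(f \<longlongrightarrow> 0) (at_right 0)"
  proof (rule order_tendstoI)
    fix a :: ennreal assume "0 < a"
    then obtain e where e: "0 < e" "ennreal e \<le> a"
      by (cases a) (auto intro: that[of 1])
    then obtain t where t: "0 < t" "f t < ennreal e" using * by auto
    show "\<forall>\<^sub>F s in at_right 0. f s < a"
      unfolding eventually_at_right_field
    proof (intro exI[of _ t] conjI allI impI)
      fix s assume "0 < s" "s < t"
      then show "f s < a" using mono[of s t] t e by (meson le_less_trans less_imp_le less_le_trans)
    qed (rule t)
  qed auto
qed

lemma radon_measureI_uniform_balls: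
  fixes \<mu> :: "'a::metric_space measure"
  assumes sets: "sets \<mu> = sets borel" and r: "0 < r" and M: "\<And>x. emeasure \<mu> (ball x r) \<le> M" "M < \<infinity>"
  shows "radon_measure \<mu>"
  unfolding radon_measure_def
proof (intro conjI allI impI)
  fix C :: "'a set" assume "compact C"
  moreover have "C \<subseteq> (\<Union>x\<in>C. ball x r)" using r by auto
  ultimately obtain F where F: "F \<subseteq> C" "finite F" "C \<subseteq> (\<Union>x\<in>F. ball x r)"
    using compactE_image[of C C "\<lambda>x. ball x r"] open_ball by metis
  then have "emeasure \<mu> C \<le> emeasure \<mu> (\<Union>x\<in>F. ball x r)"
    by (intro emeasure_mono) (auto simp: sets intro!: borel_open)
  also have "\<dots> \<le> (\<Sum>x\<in>F. emeasure \<mu> (ball x r))"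
    using F by (intro emeasure_subadditive_finite) (auto simp: sets)
  also have "\<dots> \<le> (\<Sum>x\<in>F. M)" by (intro sum_mono M)
  also have "\<dots> < \<infinity>" using M(2) by (simp add: ennreal_mult_less_top of_nat_less_top)
  finally show "emeasure \<mu> C < \<infinity>" .
qed (rule sets)

definition sup_green_integral :: "real \<Rightarrow> real \<Rightarrow> real \<Rightarrow> 'a::metric_space measure \<Rightarrow> real \<Rightarrow> ennreal" where
  "sup_green_integral \<nu> \<beta> p \<mu> r = (SUP x. green_integral \<nu> \<beta> p \<mu> r x)"

definition sup_potential_integral ::
  "(real \<Rightarrow> 'a \<Rightarrow> 'a \<Rightarrow> real) \<Rightarrow> real \<Rightarrow> 'a measure \<Rightarrow> real \<Rightarrow> ennreal" where
  "sup_potential_integral k p \<mu> t = (SUP x. \<integral>\<^sup>+y. ennpowr (time_integral k t x y) p \<partial>\<mu>)"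

lemma sup_green_integral_mono:
  assumes "r \<le> r'" shows "sup_green_integral \<nu> \<beta> p \<mu> r \<le> sup_green_integral \<nu> \<beta> p \<mu> r'"
  unfolding sup_green_integral_def green_integral_def
  using assms by (intro SUP_mono' nn_integral_mono) (auto simp: indicator_def)

lemma time_integral_mono: "t \<le> t' \<Longrightarrow> time_integral k t x y \<le> time_integral k t' x y"
  unfolding time_integral_def by (intro nn_integral_mono) (auto simp: indicator_def)

lemma sup_potential_integral_mono:
  assumes "t \<le> t'" "0 \<le> p" shows "sup_potential_integral k p \<mu> t \<le> sup_potential_integral k p \<mu> t'"
  unfolding sup_potential_integral_def
  using assms by (intro SUP_mono' nn_integral_mono ennpowr_mono time_integral_mono)

lemma K_class_iff:
  assumes "\<beta> \<le> \<nu>"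
  shows "\<mu> \<in> K_class \<nu> \<beta> p \<longleftrightarrow> sets \<mu> = sets borel \<and> (\<forall>e>0. \<exists>r>0. sup_green_integral \<nu> \<beta> p \<mu> r < ennreal e)"
  using assms tendsto_0_at_right_mono_iff[of "sup_green_integral \<nu> \<beta> p \<mu>", OF sup_green_integral_mono]
  by (simp add: K_class_def sup_green_integral_def[abs_def])

lemma S_K_iff:
  assumes "0 \<le> p"
  shows "\<mu> \<in> S_K k p \<longleftrightarrow> radon_measure \<mu> \<and> (\<forall>e>0. \<exists>t>0. sup_potential_integral k p \<mu> t < ennreal e)"
  using tendsto_0_at_right_mono_iff[of "sup_potential_integral k p \<mu>", OF sup_potential_integral_mono] assms
  by (simp add: S_K_def sup_potential_integral_def[abs_def])

text \<open>
  On \<open>ball x r\<close> the Green function is at least its value at \<open>r\<close>, which is positive because \<open>r < 1\<close>. Hence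
  the measures in the Green classes are uniformly bounded on balls of a small radius; this makes
  them Radon measures and opens the way to \<open>ball_growth\<close>.
\<close>

lemma ball_le_sup_green_integral:
  fixes \<mu> :: "'a::{metric_space, second_countable_topology} measure"
  assumes sets [measurable_cong]: "sets \<mu> = sets borel" and nb: "\<beta> \<le> \<nu>" and r: "0 < r" "r < 1" and p: "0 < p"
  obtains g where "0 < g" "\<And>x. emeasure \<mu> (ball x r) \<le> ennreal g * sup_green_integral \<nu> \<beta> p \<mu> r"
proof -
  define h where "h = enn2real (green \<nu> \<beta> r)"
  have h: "0 < h" "green \<nu> \<beta> r = ennreal h"
    using r by (auto simp: h_def green_def)
  show thesis
  proof (rule that[of "1 / h powr p"])
    fix x
    have "ennreal (h powr p) * emeasure \<mu> (ball x r) = (\<integral>\<^sup>+y. ennreal (h powr p) * indicator (ball x r) y \<partial>\<mu>)"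
      by (simp add: nn_integral_cmult_indicator sets)
    also have "\<dots> \<le> green_integral \<nu> \<beta> p \<mu> r x"
      unfolding green_integral_def
    proof (rule nn_integral_mono)
      fix y
      have "ennreal (h powr p) \<le> ennpowr (green \<nu> \<beta> (dist x y)) p" if "dist x y < r"
      proof -
        have "green \<nu> \<beta> r \<le> green \<nu> \<beta> (dist x y)"
          using that r nb by (auto simp: green_def intro!: ennreal_leI powr_mono2' frac_le)
        then have "ennpowr (ennreal h) p \<le> ennpowr (green \<nu> \<beta> (dist x y)) p"
          unfolding h(2) using p by (intro ennpowr_mono) auto
        then show ?thesis using h by (simp add: ennpowr_def)
      qed
      then show "ennreal (h powr p) * indicator (ball x r) y
          \<le> ennpowr (green \<nu> \<beta> (dist x y)) p * indicator {y. dist x y < r} y"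
        by (auto simp: indicator_def)
    qed
    also have "\<dots> \<le> sup_green_integral \<nu> \<beta> p \<mu> r"
      unfolding sup_green_integral_def by (intro SUP_upper) auto
    finally have "ennreal (1 / h powr p) * (ennreal (h powr p) * emeasure \<mu> (ball x r))
        \<le> ennreal (1 / h powr p) * sup_green_integral \<nu> \<beta> p \<mu> r" by (intro mult_left_mono) auto
    then show "emeasure \<mu> (ball x r) \<le> ennreal (1 / h powr p) * sup_green_integral \<nu> \<beta> p \<mu> r"
      using h by (simp add: mult.assoc[symmetric] ennreal_mult'[symmetric])
  qed (use h in auto)
qed

context heat_kernel_bounds begin

section \<open>Potentials off the diagonal\<close>

lemma majorant_measurable [measurable]: "(\<lambda>y. majorant t (dist x y)) \<in> borel_measurable (borel :: 'a measure)"
  unfolding majorant_def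
proof (rule lborel.borel_measurable_nn_integral)
  have [measurable]: "(\<lambda>z::'a \<times> real. \<Phi>2 (dist x (fst z) / snd z powr (1 / \<beta>)))
      \<in> borel_measurable (borel \<Otimes>\<^sub>M lborel)"
    by (rule Phi2_measurable) auto
  show "(\<lambda>(y, s). ennreal (s powr (- \<nu> / \<beta>) * \<Phi>2 (dist x y / s powr (1 / \<beta>))) * indicator {0<..<t} s)
      \<in> borel_measurable (borel \<Otimes>\<^sub>M lborel)"
    unfolding case_prod_beta by measurable
qed

text \<open>
  Off the diagonal the potential is at most 1 for small \<open>t\<close>, which removes the exponent \<open>p\<close>. Tonelli's theorem then
  reduces the claim to the integral of \<open>s\<^bsup>-\<nu>/\<beta>\<^esup> \<Phi>2 (d / s\<^bsup>1/\<beta>\<^esup>)\<close> in space at fixed \<open>s\<close>, which is a tail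
  with \<open>2 a \<tau> = r\<close> and so is bounded independently of \<open>s\<close> and \<open>x\<close>.
\<close>

lemma far_part:
  assumes p: "1 \<le> p"
  obtains r0 where "0 < r0" "\<And>r (\<mu> :: 'a measure) M. 0 < r \<Longrightarrow> r \<le> r0 \<Longrightarrow> sets \<mu> = sets borel \<Longrightarrow>
      (\<And>x. emeasure \<mu> (ball x r) \<le> M) \<Longrightarrow> M < \<infinity> \<Longrightarrow>
      \<exists>K t1. 0 < t1 \<and> 0 \<le> K \<and> (\<forall>t x. 0 < t \<longrightarrow> t \<le> t1 \<longrightarrow>
        (\<integral>\<^sup>+y\<in>{y. r \<le> dist x y}. ennpowr (majorant t (dist x y)) p \<partial>\<mu>) \<le> ennreal (K * t))"
proof -
  obtain r0 where r0: "0 < r0" and growth: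
    "\<And>r. 0 < r \<Longrightarrow> r \<le> r0 \<Longrightarrow> \<exists>K. \<forall>\<mu> :: 'a measure. \<forall>M x \<rho>. sets \<mu> = sets borel \<longrightarrow>
       (\<forall>x. emeasure \<mu> (ball x r) \<le> M) \<longrightarrow> r \<le> \<rho> \<longrightarrow>
       emeasure \<mu> (ball x \<rho>) \<le> M * ennreal K * ennreal (V (2 * \<rho>))"
    using ball_growth by blast
  obtain C where C: "0 < C"
    and tail: "\<And>(\<mu> :: 'a measure) A \<tau> a x. sets \<mu> = sets borel \<Longrightarrow> 0 < \<tau> \<Longrightarrow> \<tau> \<le> 1/8 \<Longrightarrow> 0 < a \<Longrightarrow>
      (\<And>\<rho>. 2 * a * \<tau> \<le> \<rho> \<Longrightarrow> emeasure \<mu> (ball x \<rho>) \<le> A * ennreal (V (2 * \<rho>))) \<Longrightarrow>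
      (\<integral>\<^sup>+y\<in>{y. 2 * a * \<tau> \<le> dist x y}. ennreal (\<tau> powr - \<nu> * \<Phi>2 (dist x y / \<tau>)) \<partial>\<mu>)
        \<le> A * ennreal C * (\<Sum>j. ennreal (W (2 ^ j * a) * \<Phi>2 (2 ^ Suc j * a)))"
    using tail_estimate by blast
  obtain B where B: "0 < B" "\<forall>u\<ge>0. u powr \<nu> * \<Phi>2 u \<le> B"
    using powr_Phi2_bounded by blast
  define I where "I = 2 * (\<integral>\<^sup>+t\<in>{1..}. ennreal (W t * \<Phi>2 t / t) \<partial>lborel)"
  have I: "I < \<infinity>" using dyadic_moment_finite by (simp add: I_def)
  show thesis
  proof (rule that[OF r0])
    fix r and \<mu> :: "'a measure" and M
    assume r: "0 < r" "r \<le> r0" and sets [measurable_cong]: "sets \<mu> = sets borel"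
      and M: "\<And>x. emeasure \<mu> (ball x r) \<le> M" "M < \<infinity>"
    obtain K0 where K0: "\<And>x \<rho>. r \<le> \<rho> \<Longrightarrow> emeasure \<mu> (ball x \<rho>) \<le> M * ennreal K0 * ennreal (V (2 * \<rho>))"
      using growth[OF r] sets M(1) by blast
    define A where "A = M * ennreal K0"
    have fin: "A * ennreal C * I < \<infinity>" using M(2) I by (simp add: A_def ennreal_mult_less_top)
    define K where "K = enn2real (A * ennreal C * I)"
    have K: "ennreal K = A * ennreal C * I" "0 \<le> K" using fin by (simp_all add: K_def)
    have sigma: "sigma_finite_measure \<mu>"
    proof
      define \<B> where "\<B> = range (\<lambda>n::nat. ball (undefined :: 'a) (r + real n))"
      have "\<exists>n::nat. x \<in> ball undefined (r + real n)" for x :: 'a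
      proof -
        obtain n :: nat where "dist undefined x < real n" using reals_Archimedean2 by blast
        then show ?thesis using r by (intro exI[of _ n]) auto
      qed
      then have "\<Union> \<B> = space \<mu>" using sets_eq_imp_space_eq[OF sets] by (auto simp: \<B>_def)
      moreover have "emeasure \<mu> a \<noteq> \<infinity>" if "a \<in> \<B>" for a
      proof -
        obtain n :: nat where a: "a = ball undefined (r + real n)" using \<open>a \<in> \<B>\<close> by (auto simp: \<B>_def)
        have "emeasure \<mu> a \<le> M * ennreal K0 * ennreal (V (2 * (r + real n)))"
          unfolding a by (rule K0) auto
        also have "\<dots> < \<infinity>" using M(2) by (simp add: ennreal_mult_less_top)
        finally show ?thesis by simp
      qed
      moreover have "countable \<B>" "\<B> \<subseteq> sets \<mu>" by (auto simp: \<B>_def sets)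
      ultimately show "\<exists>\<A>. countable \<A> \<and> \<A> \<subseteq> sets \<mu> \<and> \<Union> \<A> = space \<mu> \<and> (\<forall>a\<in>\<A>. emeasure \<mu> a \<noteq> \<infinity>)"
        by blast
    qed
    \<comment> \<open>The three bounds give, for \<open>s < t1\<close> and \<open>\<tau> = s\<^bsup>1/\<beta>\<^esup>\<close>, that \<open>\<tau> \<le> 1/8\<close>, that \<open>a = r / (2 \<tau>) \<ge> 1\<close>, and that the
      majorant at time \<open>t1\<close> is at most 1.\<close>
    define t1 where "t1 = min ((1/8) powr \<beta>) (min ((r / 2) powr \<beta>) (1 / (B * r powr - \<nu>)))"
    have "0 < t1" using r B by (simp add: t1_def)
    moreover have "(\<integral>\<^sup>+y\<in>{y. r \<le> dist x y}. ennpowr (majorant t (dist x y)) p \<partial>\<mu>) \<le> ennreal (K * t)"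
      if t: "0 < t" "t \<le> t1" for t x
    proof -
      define f where "f = (\<lambda>(s, y). ennreal (s powr (- \<nu> / \<beta>) * \<Phi>2 (dist x y / s powr (1 / \<beta>)))
        * indicator {0<..<t} s * indicator {y. r \<le> dist x y} y)"
      have [measurable]: "(\<lambda>z::real \<times> 'a. \<Phi>2 (dist x (snd z) / fst z powr (1 / \<beta>)))
          \<in> borel_measurable (lborel \<Otimes>\<^sub>M \<mu>)"
        by (rule Phi2_measurable) auto
      have f: "f \<in> borel_measurable (lborel \<Otimes>\<^sub>M \<mu>)"
        unfolding f_def case_prod_beta by measurable
      interpret pair_sigma_finite lborel \<mu>
        using sigma by (simp add: pair_sigma_finite_def lborel.sigma_finite_measure_axioms)
      have "(\<integral>\<^sup>+y\<in>{y. r \<le> dist x y}. ennpowr (majorant t (dist x y)) p \<partial>\<mu>) \<le> (\<integral>\<^sup>+y. \<integral>\<^sup>+s. f (s, y) \<partial>lborel \<partial>\<mu>)"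
      proof (rule nn_integral_mono)
        fix y
        show "ennpowr (majorant t (dist x y)) p * indicator {y. r \<le> dist x y} y \<le> (\<integral>\<^sup>+s. f (s, y) \<partial>lborel)"
        proof (cases "r \<le> dist x y")
          case True
          have "majorant t (dist x y) \<le> ennreal (B * r powr - \<nu> * t)"
            using majorant_le_linear[OF B r(1) True] t by simp
          also have "\<dots> \<le> ennreal 1"
          proof (rule ennreal_leI)
            have "t \<le> 1 / (B * r powr - \<nu>)" using t by (simp add: t1_def)
            moreover have "0 < B * r powr - \<nu>" using B r by simp
            ultimately show "B * r powr - \<nu> * t \<le> 1" by (simp add: pos_le_divide_eq mult.commute)
          qed
          finally have "ennpowr (majorant t (dist x y)) p \<le> majorant t (dist x y)"
            using p by (intro ennpowr_le_self) auto
          then show ?thesis using True by (simp add: majorant_def f_def)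
        qed simp
      qed
      also have "\<dots> = (\<integral>\<^sup>+s. \<integral>\<^sup>+y. f (s, y) \<partial>\<mu> \<partial>lborel)" by (rule Fubini[OF f])
      also have "\<dots> \<le> (\<integral>\<^sup>+s. ennreal K * indicator {0<..<t} s \<partial>lborel)"
      proof (rule nn_integral_mono)
        fix s :: real
        show "(\<integral>\<^sup>+y. f (s, y) \<partial>\<mu>) \<le> ennreal K * indicator {0<..<t} s"
        proof (cases "0 < s \<and> s < t")
          case True
          define \<tau> where "\<tau> = s powr (1 / \<beta>)"
          define a where "a = r / (2 * \<tau>)"
          have \<tau>0: "0 < \<tau>" using True by (simp add: \<tau>_def)
          have le: "\<tau> \<le> b" if "0 < b" "t1 \<le> b powr \<beta>" for b
          proof -
            have "s powr (1 / \<beta>) \<le> (b powr \<beta>) powr (1 / \<beta>)"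
              using True t that beta_pos by (intro powr_mono2) auto
            then show ?thesis using that beta_pos by (simp add: \<tau>_def powr_powr)
          qed
          have \<tau>8: "\<tau> \<le> 1/8" by (rule le) (auto simp: t1_def)
          have "\<tau> \<le> r / 2" using r by (intro le) (auto simp: t1_def)
          then have a: "1 \<le> a" using \<tau>0 by (simp add: a_def field_simps)
          have r_eq: "2 * a * \<tau> = r" using \<tau>0 by (simp add: a_def)
          have "s powr (- \<nu> / \<beta>) = \<tau> powr - \<nu>" using True by (simp add: \<tau>_def powr_powr)
          then have "(\<integral>\<^sup>+y. f (s, y) \<partial>\<mu>)
              = (\<integral>\<^sup>+y\<in>{y. 2 * a * \<tau> \<le> dist x y}. ennreal (\<tau> powr - \<nu> * \<Phi>2 (dist x y / \<tau>)) \<partial>\<mu>)"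
            using True unfolding r_eq by (simp add: f_def \<tau>_def)
          also have "\<dots> \<le> A * ennreal C * (\<Sum>j. ennreal (W (2 ^ j * a) * \<Phi>2 (2 ^ Suc j * a)))"
          proof (rule tail[OF sets \<tau>0 \<tau>8])
            show "0 < a" using a by simp
            fix \<rho> assume "2 * a * \<tau> \<le> \<rho>"
            then show "emeasure \<mu> (ball x \<rho>) \<le> A * ennreal (V (2 * \<rho>))"
              unfolding A_def r_eq by (rule K0)
          qed
          also have "\<dots> \<le> A * ennreal C * I"
            unfolding I_def by (intro mult_left_mono dyadic_moment a) auto
          finally show ?thesis using True K by simp
        qed (auto simp: f_def)
      qed
      also have "\<dots> = ennreal (K * t)"
        using t K by (subst nn_integral_cmult_indicator) (auto simp: ennreal_mult)
      finally show ?thesis .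
    qed
    ultimately show "\<exists>K t1. 0 < t1 \<and> 0 \<le> K \<and> (\<forall>t x. 0 < t \<longrightarrow> t \<le> t1 \<longrightarrow>
        (\<integral>\<^sup>+y\<in>{y. r \<le> dist x y}. ennpowr (majorant t (dist x y)) p \<partial>\<mu>) \<le> ennreal (K * t))"
      using K(2) by blast
  qed
qed

end

section \<open>Lower bounds for the potential\<close>

lemma green_unbounded:
  assumes nb: "\<beta> \<le> \<nu>" and r: "0 < r"
  obtains \<delta> where "0 < \<delta>" "\<delta> < r" "ennreal K \<le> green \<nu> \<beta> \<delta>"
proof (cases "\<nu> = \<beta>")
  case True
  define \<delta> where "\<delta> = min (r / 2) (exp (- K))"
  have \<delta>: "0 < \<delta>" "\<delta> < r" "\<delta> \<le> exp (- K)" using r by (auto simp: \<delta>_def)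
  have "ln \<delta> \<le> - K" using \<delta> by (metis ln_exp ln_le_cancel_iff exp_gt_zero)
  then have "K \<le> ln (1 / \<delta>)" using \<delta> by (simp add: ln_div)
  then show thesis using \<delta> True by (intro that[of \<delta>]) (auto simp: green_def intro!: ennreal_leI)
next
  case False
  then have nb': "\<beta> - \<nu> < 0" using nb by simp
  define K' where "K' = max K 1"
  define \<delta> where "\<delta> = min (r / 2) (K' powr (1 / (\<beta> - \<nu>)))"
  have K': "0 < K'" "K \<le> K'" by (auto simp: K'_def)
  have \<delta>: "0 < \<delta>" "\<delta> < r" "\<delta> \<le> K' powr (1 / (\<beta> - \<nu>))" using r K' by (auto simp: \<delta>_def)
  have "(K' powr (1 / (\<beta> - \<nu>))) powr (\<beta> - \<nu>) \<le> \<delta> powr (\<beta> - \<nu>)"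
    using \<delta> nb' by (intro powr_mono2') auto
  then have "K' \<le> \<delta> powr (\<beta> - \<nu>)" using nb' K' by (simp add: powr_powr)
  then show thesis using \<delta> nb' K' by (intro that[of \<delta>]) (auto simp: green_def intro!: ennreal_leI)
qed

context heat_kernel_bounds begin

lemma time_integral_ge:
  assumes t: "0 < t" "t \<le> T" and ab: "0 < a" "a \<le> b" "b < t"
    and d: "dist x y \<le> \<delta>"
  shows "ennreal (\<Phi>1 (\<delta> / a powr (1 / \<beta>))) * (\<integral>\<^sup>+s\<in>{a..b}. ennreal (s powr (- \<nu> / \<beta>)) \<partial>lborel)
    \<le> time_integral k t x y"
proof -
  have \<delta>: "0 \<le> \<delta>" using d zero_le_dist order_trans by blast
  define P where "P = \<Phi>1 (\<delta> / a powr (1 / \<beta>))"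
  have P: "0 < P" unfolding P_def using \<delta> by (intro Phi1_pos) auto
  have "ennreal P * (\<integral>\<^sup>+s\<in>{a..b}. ennreal (s powr (- \<nu> / \<beta>)) \<partial>lborel)
    = (\<integral>\<^sup>+s. ennreal P * (ennreal (s powr (- \<nu> / \<beta>)) * indicator {a..b} s) \<partial>lborel)"
    by (simp add: nn_integral_cmult)
  also have "\<dots> \<le> time_integral k t x y"
    unfolding time_integral_def
  proof (rule nn_integral_mono)
    fix s :: real
    have "P * s powr (- \<nu> / \<beta>) \<le> k s x y" if s: "a \<le> s" "s \<le> b"
    proof -
      have "dist x y / s powr (1 / \<beta>) \<le> \<delta> / a powr (1 / \<beta>)"
        using s ab d \<delta> beta_pos by (intro frac_le powr_mono2) auto
      then have "P \<le> \<Phi>1 (dist x y / s powr (1 / \<beta>))" unfolding P_def by (intro Phi1_antimono) auto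
      then have "P * s powr (- \<nu> / \<beta>) \<le> s powr (- \<nu> / \<beta>) * \<Phi>1 (dist x y / s powr (1 / \<beta>))"
        by (subst mult.commute) (intro mult_left_mono, auto)
      also have "\<dots> \<le> k s x y" using s ab t by (intro kernel_lower) auto
      finally show ?thesis .
    qed
    then have "ennreal P * ennreal (s powr (- \<nu> / \<beta>)) \<le> ennreal (k s x y)" if "a \<le> s" "s \<le> b"
      using that P by (simp flip: ennreal_mult add: ennreal_leI)
    then show "ennreal P * (ennreal (s powr (- \<nu> / \<beta>)) * indicator {a..b} s)
        \<le> ennreal (k s x y) * indicator {0<..<t} s"
      using ab by (auto simp: indicator_def)
  qed
  finally show ?thesis by (simp add: P_def)
qed

text \<open>
  The bound is first shown with \<open>green \<nu> \<beta> \<delta>\<close> for every \<open>\<delta>\<close> not smaller than the distance, integrating from \<open>\<delta>\<^sup>\<beta>\<close> on, where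
  \<open>\<Phi>1\<close> is evaluated at most at 1. For distinct points \<open>\<delta>\<close> is the distance; on the diagonal letting
  \<open>\<delta>\<close> tend to 0 shows that the potential is infinite there. The constant must not depend on \<open>t\<close>, since the Kato classes let \<open>t\<close>
  tend to 0.
\<close>

lemma time_integral_ge_green:
  assumes nb: "\<beta> \<le> \<nu>"
  obtains c where "0 < c" "\<And>t. 0 < t \<Longrightarrow> t \<le> T \<Longrightarrow>
    \<exists>r>0. r < 1 \<and> (\<forall>x y. dist x y < r \<longrightarrow> ennreal c * green \<nu> \<beta> (dist x y) \<le> time_integral k t x y)"
proof -
  have P1: "0 < \<Phi>1 1" by (simp add: Phi1_pos)
  have "\<exists>c>0. \<forall>t. 0 < t \<and> t \<le> T \<longrightarrow> (\<exists>r>0. r < 1 \<and>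
    (\<forall>x y \<delta>. 0 < \<delta> \<and> \<delta> < r \<and> dist x y \<le> \<delta> \<longrightarrow> ennreal c * green \<nu> \<beta> \<delta> \<le> time_integral k t x y))"
  proof (cases "\<nu> = \<beta>")
    case True
    show ?thesis
    proof (rule exI[of _ "\<Phi>1 1 * (\<beta> / 2)"], intro conjI allI impI)
      fix t assume t: "0 < t \<and> t \<le> T"
      \<comment> \<open>For \<open>\<delta> < r\<close> the term \<open>ln (t / 2)\<close> costs at most half of \<open>\<beta> ln (1 / \<delta>)\<close>, whatever \<open>t\<close> is.\<close>
      define r where "r = min (1/2) ((t / 2) powr (2 / \<beta>))"
      have "0 < r" "r < 1" using t by (auto simp: r_def)
      moreover have "ennreal (\<Phi>1 1 * (\<beta> / 2)) * green \<nu> \<beta> \<delta> \<le> time_integral k t x y"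
        if *: "0 < \<delta> \<and> \<delta> < r \<and> dist x y \<le> \<delta>" for x y \<delta>
      proof -
        have \<delta>: "0 < \<delta>" "\<delta> < 1" "dist x y \<le> \<delta>" using * by (auto simp: r_def)
        define L where "L = ln (1 / \<delta>)"
        have "ln \<delta> \<le> ln ((t / 2) powr (2 / \<beta>))" using * t by (subst ln_le_cancel_iff) (auto simp: r_def)
        also have "\<dots> = 2 / \<beta> * ln (t / 2)" using t by (simp add: ln_powr)
        finally have lt: "\<beta> / 2 * L \<le> ln (t / 2) + \<beta> * L" "0 < L"
          using \<delta> beta_pos by (auto simp: L_def ln_div field_simps)
        moreover have "0 < \<beta> / 2 * L" using lt(2) beta_pos by simp
        moreover have lnd: "ln (\<delta> powr \<beta>) = - (\<beta> * L)" using \<delta> by (simp add: L_def ln_div ln_powr)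
        moreover have "\<beta> * L = 2 * (\<beta> / 2 * L)" by simp
        ultimately have "ln (\<delta> powr \<beta>) \<le> ln (t / 2)" by linarith
        then have le: "\<delta> powr \<beta> \<le> t / 2" by (subst (asm) ln_le_cancel_iff) (use \<delta> t in auto)
        have "ennreal (\<Phi>1 1 * (\<beta> / 2)) * green \<nu> \<beta> \<delta> = ennreal (\<Phi>1 1) * ennreal (\<beta> / 2 * L)"
          using True \<delta> P1 beta_pos lt(2) by (simp add: green_def L_def mult.assoc flip: ennreal_mult)
        also have "\<dots> \<le> ennreal (\<Phi>1 1) * ennreal (ln (t / 2) - ln (\<delta> powr \<beta>))"
          using lt(1) unfolding lnd by (intro mult_left_mono ennreal_leI) auto
        also have "\<dots> = ennreal (\<Phi>1 (\<delta> / (\<delta> powr \<beta>) powr (1 / \<beta>)))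
            * (\<integral>\<^sup>+s\<in>{\<delta> powr \<beta>..t / 2}. ennreal (s powr (- \<nu> / \<beta>)) \<partial>lborel)"
          using nn_integral_powr_minus_1[of "\<delta> powr \<beta>" "t / 2"] le \<delta> True beta_pos
          by (simp add: powr_powr)
        also have "\<dots> \<le> time_integral k t x y" using t \<delta> le by (intro time_integral_ge) auto
        finally show ?thesis .
      qed
      ultimately show "\<exists>r>0. r < 1 \<and> (\<forall>x y \<delta>. 0 < \<delta> \<and> \<delta> < r \<and> dist x y \<le> \<delta> \<longrightarrow>
          ennreal (\<Phi>1 1 * (\<beta> / 2)) * green \<nu> \<beta> \<delta> \<le> time_integral k t x y)" by blast
    qed (use P1 beta_pos in auto)
  next
    case False
    then have nb': "\<beta> < \<nu>" using nb by simp
    define e where "e = \<nu> / \<beta> - 1"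
    have e: "0 < e" using nb' beta_pos by (simp add: e_def field_simps)
    define q where "q = 1 - 2 powr - e"
    have q: "0 < q" using e powr_less_mono[of "-e" 0 "2::real"] by (simp add: q_def)
    show ?thesis
    proof (rule exI[of _ "\<Phi>1 1 * (q / e)"], intro conjI allI impI)
      fix t assume t: "0 < t \<and> t \<le> T"
      define r where "r = min (1/2) ((t / 4) powr (1 / \<beta>))"
      have "0 < r" "r < 1" using t by (auto simp: r_def)
      moreover have "ennreal (\<Phi>1 1 * (q / e)) * green \<nu> \<beta> \<delta> \<le> time_integral k t x y"
        if *: "0 < \<delta> \<and> \<delta> < r \<and> dist x y \<le> \<delta>" for x y \<delta>
      proof -
        have \<delta>: "0 < \<delta>" "dist x y \<le> \<delta>" using * by (auto simp: r_def)
        define a where "a = \<delta> powr \<beta>"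
        have "a \<le> ((t / 4) powr (1 / \<beta>)) powr \<beta>"
          unfolding a_def using * \<delta> beta_pos by (intro powr_mono2) (auto simp: r_def)
        then have a: "0 < a" "2 * a < t" using t beta_pos \<delta> by (auto simp: powr_powr a_def)
        have g: "a powr - e = \<delta> powr (\<beta> - \<nu>)"
        proof -
          have "\<beta> * - e = \<beta> - \<nu>" using beta_pos by (simp add: e_def algebra_simps)
          then show ?thesis unfolding a_def powr_powr by simp
        qed
        have I: "(\<integral>\<^sup>+s\<in>{a..2 * a}. ennreal (s powr (- \<nu> / \<beta>)) \<partial>lborel)
            = ennreal (((2 * a) powr - e - a powr - e) / - e)"
          using nn_integral_powr[of "- \<nu> / \<beta>" a "2 * a"] a e nb' beta_pos by (simp add: e_def)
        have "((2 * a) powr - e - a powr - e) / - e = q / e * a powr - e"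
          using a e by (simp add: q_def powr_mult field_simps)
        then have "ennreal (\<Phi>1 1 * (q / e)) * green \<nu> \<beta> \<delta>
            = ennreal (\<Phi>1 1) * (\<integral>\<^sup>+s\<in>{a..2 * a}. ennreal (s powr (- \<nu> / \<beta>)) \<partial>lborel)"
          unfolding I using nb' \<delta> P1 q e by (simp add: green_def g flip: ennreal_mult)
        also have "\<dots> = ennreal (\<Phi>1 (\<delta> / a powr (1 / \<beta>)))
            * (\<integral>\<^sup>+s\<in>{a..2 * a}. ennreal (s powr (- \<nu> / \<beta>)) \<partial>lborel)"
          using \<delta> beta_pos by (simp add: powr_powr a_def)
        also have "\<dots> \<le> time_integral k t x y" using t \<delta> a by (intro time_integral_ge) auto
        finally show ?thesis .
      qed
      ultimately show "\<exists>r>0. r < 1 \<and> (\<forall>x y \<delta>. 0 < \<delta> \<and> \<delta> < r \<and> dist x y \<le> \<delta> \<longrightarrow>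
          ennreal (\<Phi>1 1 * (q / e)) * green \<nu> \<beta> \<delta> \<le> time_integral k t x y)" by blast
    qed (use P1 q e in auto)
  qed
  then obtain c where c: "0 < c" and *: "\<forall>t. 0 < t \<and> t \<le> T \<longrightarrow> (\<exists>r>0. r < 1 \<and>
    (\<forall>x y \<delta>. 0 < \<delta> \<and> \<delta> < r \<and> dist x y \<le> \<delta> \<longrightarrow> ennreal c * green \<nu> \<beta> \<delta> \<le> time_integral k t x y))"
    by (elim exE conjE)
  show thesis
  proof (rule that[OF c])
    fix t assume t: "0 < t" "t \<le> T"
    obtain r where r: "0 < r" "r < 1"
      and le: "\<forall>x y \<delta>. 0 < \<delta> \<and> \<delta> < r \<and> dist x y \<le> \<delta> \<longrightarrow> ennreal c * green \<nu> \<beta> \<delta> \<le> time_integral k t x y"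
      using *[THEN spec, THEN mp, OF conjI[OF t]] by (elim exE conjE)
    have "ennreal c * green \<nu> \<beta> (dist x y) \<le> time_integral k t x y" if "dist x y < r" for x y
    proof (cases "dist x y = 0")
      case False
      then show ?thesis using that by (intro le[rule_format]) auto
    next
      case True
      have "ennreal K \<le> time_integral k t x y" if "0 \<le> K" for K
      proof -
        obtain \<delta> where \<delta>: "0 < \<delta>" "\<delta> < r" "ennreal (K / c) \<le> green \<nu> \<beta> \<delta>"
          using green_unbounded[OF nb r(1)] by blast
        have "ennreal K = ennreal c * ennreal (K / c)" using c that by (simp flip: ennreal_mult)
        also have "\<dots> \<le> ennreal c * green \<nu> \<beta> \<delta>" using \<delta> by (intro mult_left_mono) auto
        also have "\<dots> \<le> time_integral k t x y" using \<delta> True by (intro le[rule_format]) auto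
        finally show ?thesis .
      qed
      then have "time_integral k t x y = \<top>"
      proof (cases "time_integral k t x y")
        case (real v)
        then have "ennreal (v + 1) \<le> ennreal v"
          using \<open>\<And>K. 0 \<le> K \<Longrightarrow> ennreal K \<le> time_integral k t x y\<close>[of "v + 1"] by simp
        then show ?thesis using real by simp
      qed
      then show ?thesis by simp
    qed
    then show "\<exists>r>0. r < 1 \<and> (\<forall>x y. dist x y < r \<longrightarrow>
        ennreal c * green \<nu> \<beta> (dist x y) \<le> time_integral k t x y)" using r by blast
  qed
qed

section \<open>Comparison of Green and potential classes\<close>

lemma sup_green_integral_le:
  assumes nb: "\<beta> \<le> \<nu>" and p: "1 \<le> p"
  obtains c where "0 < c" "\<And>t (\<mu> :: 'a measure). 0 < t \<Longrightarrow> t \<le> T \<Longrightarrow> sets \<mu> = sets borel \<Longrightarrow>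
    \<exists>r>0. r < 1 \<and> ennreal c * sup_green_integral \<nu> \<beta> p \<mu> r \<le> sup_potential_integral k p \<mu> t"
proof -
  obtain c where c: "0 < c" and *: "\<And>t. 0 < t \<Longrightarrow> t \<le> T \<Longrightarrow>
    \<exists>r>0. r < 1 \<and> (\<forall>x y. dist x y < r \<longrightarrow> ennreal c * green \<nu> \<beta> (dist x y) \<le> time_integral k t x y)"
    using time_integral_ge_green[OF nb] by blast
  show thesis
  proof (rule that[of "c powr p"])
    fix t and \<mu> :: "'a measure" assume t: "0 < t" "t \<le> T" and sets [measurable_cong]: "sets \<mu> = sets borel"
    obtain r where r: "0 < r" "r < 1"
      and le: "\<And>x y. dist x y < r \<Longrightarrow> ennreal c * green \<nu> \<beta> (dist x y) \<le> time_integral k t x y"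
      using *[OF t] by blast
    have "ennreal (c powr p) * green_integral \<nu> \<beta> p \<mu> r x \<le> sup_potential_integral k p \<mu> t" for x
    proof -
      have "ennreal (c powr p) * green_integral \<nu> \<beta> p \<mu> r x
        = (\<integral>\<^sup>+y. ennreal (c powr p) * (ennpowr (green \<nu> \<beta> (dist x y)) p * indicator {y. dist x y < r} y) \<partial>\<mu>)"
        unfolding green_integral_def by (subst nn_integral_cmult) auto
      also have "\<dots> \<le> (\<integral>\<^sup>+y. ennpowr (time_integral k t x y) p \<partial>\<mu>)"
      proof (rule nn_integral_mono)
        fix y
        have "ennreal (c powr p) * ennpowr (green \<nu> \<beta> (dist x y)) p \<le> ennpowr (time_integral k t x y) p"
          if "dist x y < r"
          using ennpowr_mono[OF le[OF that], of p] c p by (simp add: ennpowr_cmult)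
        then show "ennreal (c powr p) * (ennpowr (green \<nu> \<beta> (dist x y)) p * indicator {y. dist x y < r} y)
            \<le> ennpowr (time_integral k t x y) p" by (auto simp: indicator_def)
      qed
      also have "\<dots> \<le> sup_potential_integral k p \<mu> t"
        unfolding sup_potential_integral_def by (intro SUP_upper) auto
      finally show ?thesis .
    qed
    then have "ennreal (c powr p) * sup_green_integral \<nu> \<beta> p \<mu> r \<le> sup_potential_integral k p \<mu> t"
      unfolding sup_green_integral_def by (subst SUP_mult_left_ennreal) (auto intro!: SUP_least)
    then show "\<exists>r>0. r < 1 \<and> ennreal (c powr p) * sup_green_integral \<nu> \<beta> p \<mu> r \<le> sup_potential_integral k p \<mu> t"
      using r by blast
  qed (use c in auto)
qed

lemma potential_integral_split:
  assumes sets [measurable_cong]: "sets \<mu> = sets borel" and t: "t \<le> T" and p: "0 \<le> p"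
  shows "(\<integral>\<^sup>+y. ennpowr (time_integral k t x y) p \<partial>\<mu>)
    \<le> (\<integral>\<^sup>+y\<in>{y. dist x y < r}. ennpowr (majorant t (dist x y)) p \<partial>\<mu>)
      + (\<integral>\<^sup>+y\<in>{y. r \<le> dist x y}. ennpowr (majorant t (dist x y)) p \<partial>\<mu>)"
proof -
  have [measurable]: "(\<lambda>y. majorant t (dist x y)) \<in> borel_measurable \<mu>"
    using majorant_measurable sets by (simp cong: measurable_cong_sets)
  have "(\<integral>\<^sup>+y. ennpowr (time_integral k t x y) p \<partial>\<mu>)
    \<le> (\<integral>\<^sup>+y. ennpowr (majorant t (dist x y)) p * indicator {y. dist x y < r} y
        + ennpowr (majorant t (dist x y)) p * indicator {y. r \<le> dist x y} y \<partial>\<mu>)"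
    using ennpowr_mono[OF time_integral_le_majorant[OF t] p]
    by (intro nn_integral_mono) (auto simp: indicator_def)
  then show ?thesis by (subst (asm) nn_integral_add) auto
qed

text \<open>
  Only the off-diagonal constant \<open>K\<close> depends on \<open>\<mu>\<close> and \<open>r\<close>. For the Kato class one therefore fixes \<open>r\<close> to make
  the first term small and then lets \<open>t\<close> tend to 0.
\<close>

lemma sup_potential_integral_le:
  assumes nb: "\<beta> \<le> \<nu>" and p: "1 \<le> p"
  obtains C r1 where "0 < C" "0 < r1" "r1 < 1" "\<And>r (\<mu> :: 'a measure). 0 < r \<Longrightarrow> r \<le> r1 \<Longrightarrow>
    sets \<mu> = sets borel \<Longrightarrow> sup_green_integral \<nu> \<beta> p \<mu> r < \<infinity> \<Longrightarrow>
    \<exists>K t1. 0 < t1 \<and> 0 \<le> K \<and> (\<forall>t. 0 < t \<longrightarrow> t \<le> t1 \<longrightarrow>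
      sup_potential_integral k p \<mu> t \<le> ennreal C * sup_green_integral \<nu> \<beta> p \<mu> r + ennreal (K * t))"
proof -
  obtain C r1 where C: "0 < C" "0 < r1" "r1 < 1"
    and U: "\<And>t d. 0 < t \<Longrightarrow> t \<le> 1 \<Longrightarrow> 0 \<le> d \<Longrightarrow> d < r1 \<Longrightarrow> majorant t d \<le> ennreal C * green \<nu> \<beta> d"
    using majorant_le_green[OF nb] by blast
  obtain r0 where r0: "0 < r0" and far: "\<And>r (\<mu> :: 'a measure) M. 0 < r \<Longrightarrow> r \<le> r0 \<Longrightarrow> sets \<mu> = sets borel \<Longrightarrow>
      (\<And>x. emeasure \<mu> (ball x r) \<le> M) \<Longrightarrow> M < \<infinity> \<Longrightarrow>
      \<exists>K t1. 0 < t1 \<and> 0 \<le> K \<and> (\<forall>t x. 0 < t \<longrightarrow> t \<le> t1 \<longrightarrow>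
        (\<integral>\<^sup>+y\<in>{y. r \<le> dist x y}. ennpowr (majorant t (dist x y)) p \<partial>\<mu>) \<le> ennreal (K * t))"
    using far_part[OF p] by blast
  show thesis
  proof (rule that[of "C powr p" "min r0 r1"])
    fix r and \<mu> :: "'a measure"
    assume r: "0 < r" "r \<le> min r0 r1" and sets [measurable_cong]: "sets \<mu> = sets borel"
      and fin: "sup_green_integral \<nu> \<beta> p \<mu> r < \<infinity>"
    obtain g where g: "\<And>x. emeasure \<mu> (ball x r) \<le> ennreal g * sup_green_integral \<nu> \<beta> p \<mu> r"
      using ball_le_sup_green_integral[OF sets nb, of r p] r C p by auto
    obtain K t1 where K: "0 < t1" "0 \<le> K"
      and far': "\<And>t x. 0 < t \<Longrightarrow> t \<le> t1 \<Longrightarrow>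
        (\<integral>\<^sup>+y\<in>{y. r \<le> dist x y}. ennpowr (majorant t (dist x y)) p \<partial>\<mu>) \<le> ennreal (K * t)"
      using far[OF r(1) _ sets g] r(2) fin by (auto simp: ennreal_mult_less_top)
    define t2 where "t2 = min t1 (min T 1)"
    have "sup_potential_integral k p \<mu> t \<le> ennreal (C powr p) * sup_green_integral \<nu> \<beta> p \<mu> r + ennreal (K * t)"
      if t: "0 < t" "t \<le> t2" for t
      unfolding sup_potential_integral_def
    proof (rule SUP_least)
      fix x
      have "(\<integral>\<^sup>+y\<in>{y. dist x y < r}. ennpowr (majorant t (dist x y)) p \<partial>\<mu>)
        \<le> (\<integral>\<^sup>+y. ennreal (C powr p) * (ennpowr (green \<nu> \<beta> (dist x y)) p * indicator {y. dist x y < r} y) \<partial>\<mu>)"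
      proof (rule nn_integral_mono)
        fix y
        have "ennpowr (majorant t (dist x y)) p \<le> ennreal (C powr p) * ennpowr (green \<nu> \<beta> (dist x y)) p"
          if "dist x y < r"
        proof -
          have "majorant t (dist x y) \<le> ennreal C * green \<nu> \<beta> (dist x y)"
            using that r t by (intro U) (auto simp: t2_def)
          then show ?thesis using ennpowr_mono[of _ _ p] p C by (simp flip: ennpowr_cmult)
        qed
        then show "ennpowr (majorant t (dist x y)) p * indicator {y. dist x y < r} y
            \<le> ennreal (C powr p) * (ennpowr (green \<nu> \<beta> (dist x y)) p * indicator {y. dist x y < r} y)"
          by (auto simp: indicator_def)
      qed
      also have "\<dots> = ennreal (C powr p) * green_integral \<nu> \<beta> p \<mu> r x"
        unfolding green_integral_def by (subst nn_integral_cmult) auto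
      also have "\<dots> \<le> ennreal (C powr p) * sup_green_integral \<nu> \<beta> p \<mu> r"
        unfolding sup_green_integral_def by (intro mult_left_mono SUP_upper) auto
      finally have near: "(\<integral>\<^sup>+y\<in>{y. dist x y < r}. ennpowr (majorant t (dist x y)) p \<partial>\<mu>)
        \<le> ennreal (C powr p) * sup_green_integral \<nu> \<beta> p \<mu> r" .
      have "(\<integral>\<^sup>+y. ennpowr (time_integral k t x y) p \<partial>\<mu>)
          \<le> (\<integral>\<^sup>+y\<in>{y. dist x y < r}. ennpowr (majorant t (dist x y)) p \<partial>\<mu>)
            + (\<integral>\<^sup>+y\<in>{y. r \<le> dist x y}. ennpowr (majorant t (dist x y)) p \<partial>\<mu>)"
        using t p by (intro potential_integral_split sets) (auto simp: t2_def)
      also have "\<dots> \<le> ennreal (C powr p) * sup_green_integral \<nu> \<beta> p \<mu> r + ennreal (K * t)"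
        using t by (intro add_mono near far') (auto simp: t2_def)
      finally show "(\<integral>\<^sup>+y. ennpowr (time_integral k t x y) p \<partial>\<mu>)
        \<le> ennreal (C powr p) * sup_green_integral \<nu> \<beta> p \<mu> r + ennreal (K * t)" .
    qed
    moreover have "0 < t2" using K T_pos by (simp add: t2_def)
    ultimately show "\<exists>K t1. 0 < t1 \<and> 0 \<le> K \<and> (\<forall>t. 0 < t \<longrightarrow> t \<le> t1 \<longrightarrow>
      sup_potential_integral k p \<mu> t \<le> ennreal (C powr p) * sup_green_integral \<nu> \<beta> p \<mu> r + ennreal (K * t))"
      using K(2) by blast
  qed (use C r0 in auto)
qed

lemma K_class_eq_S_K_if_beta_le_nu:
  assumes nb: "\<beta> \<le> \<nu>" and p: "1 \<le> p"
  shows "K_class \<nu> \<beta> p = S_K k p"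
proof (intro set_eqI iffI)
  have p0: "0 \<le> p" using p by simp
  fix \<mu> :: "'a measure" assume "\<mu> \<in> S_K k p"
  then have rad: "radon_measure \<mu>" and small: "\<And>e. 0 < e \<Longrightarrow> \<exists>t>0. sup_potential_integral k p \<mu> t < ennreal e"
    by (auto simp: S_K_iff[OF p0])
  then have sets: "sets \<mu> = sets borel" by (simp add: radon_measure_def)
  obtain c where c: "0 < c" and *: "\<And>t (\<mu> :: 'a measure). 0 < t \<Longrightarrow> t \<le> T \<Longrightarrow> sets \<mu> = sets borel \<Longrightarrow>
    \<exists>r>0. r < 1 \<and> ennreal c * sup_green_integral \<nu> \<beta> p \<mu> r \<le> sup_potential_integral k p \<mu> t"
    using sup_green_integral_le[OF nb p] by blast
  have "\<exists>r>0. sup_green_integral \<nu> \<beta> p \<mu> r < ennreal e" if e: "0 < e" for e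
  proof -
    obtain t where t: "0 < t" "sup_potential_integral k p \<mu> t < ennreal (c * e)"
      using small[of "c * e"] c e by auto
    then obtain r where r: "0 < r"
      and le: "ennreal c * sup_green_integral \<nu> \<beta> p \<mu> r \<le> sup_potential_integral k p \<mu> (min t T)"
      using *[of "min t T" \<mu>] T_pos sets by auto
    have "sup_potential_integral k p \<mu> (min t T) \<le> sup_potential_integral k p \<mu> t"
      using p0 by (intro sup_potential_integral_mono) auto
    then have lt: "ennreal c * sup_green_integral \<nu> \<beta> p \<mu> r < ennreal (c * e)" using le t by auto
    have "\<not> ennreal e \<le> sup_green_integral \<nu> \<beta> p \<mu> r"
    proof
      assume "ennreal e \<le> sup_green_integral \<nu> \<beta> p \<mu> r"
      then have "ennreal c * ennreal e \<le> ennreal c * sup_green_integral \<nu> \<beta> p \<mu> r"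
        by (intro mult_left_mono) auto
      then show False using lt c e by (simp add: ennreal_mult)
    qed
    then show ?thesis using r by auto
  qed
  then show "\<mu> \<in> K_class \<nu> \<beta> p" using sets by (simp add: K_class_iff[OF nb])
next
  have p0: "0 \<le> p" using p by simp
  fix \<mu> :: "'a measure" assume "\<mu> \<in> K_class \<nu> \<beta> p"
  then have sets: "sets \<mu> = sets borel"
    and small: "\<And>e. 0 < e \<Longrightarrow> \<exists>r>0. sup_green_integral \<nu> \<beta> p \<mu> r < ennreal e"
    by (auto simp: K_class_iff[OF nb])
  obtain C r1 where C: "0 < C" "0 < r1" "r1 < 1" and *: "\<And>r (\<mu> :: 'a measure). 0 < r \<Longrightarrow> r \<le> r1 \<Longrightarrow>
    sets \<mu> = sets borel \<Longrightarrow> sup_green_integral \<nu> \<beta> p \<mu> r < \<infinity> \<Longrightarrow>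
    \<exists>K t1. 0 < t1 \<and> 0 \<le> K \<and> (\<forall>t. 0 < t \<longrightarrow> t \<le> t1 \<longrightarrow>
      sup_potential_integral k p \<mu> t \<le> ennreal C * sup_green_integral \<nu> \<beta> p \<mu> r + ennreal (K * t))"
    using sup_potential_integral_le[OF nb p] by blast
  have small': "\<exists>r>0. r \<le> r1 \<and> sup_green_integral \<nu> \<beta> p \<mu> r < ennreal e" if e: "0 < e" for e
  proof -
    obtain r where r: "0 < r" "sup_green_integral \<nu> \<beta> p \<mu> r < ennreal e" using small[OF e] by auto
    moreover have "sup_green_integral \<nu> \<beta> p \<mu> (min r r1) \<le> sup_green_integral \<nu> \<beta> p \<mu> r"
      by (intro sup_green_integral_mono) auto
    ultimately show ?thesis using C by (intro exI[of _ "min r r1"]) auto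
  qed
  have "\<exists>t>0. sup_potential_integral k p \<mu> t < ennreal e" if e: "0 < e" for e
  proof -
    obtain r where r: "0 < r" "r \<le> r1" "sup_green_integral \<nu> \<beta> p \<mu> r < ennreal (e / (2 * C))"
      using small'[of "e / (2 * C)"] C e by auto
    then have "sup_green_integral \<nu> \<beta> p \<mu> r < \<infinity>"
      using order.strict_trans[OF r(3) ennreal_less_top] by simp
    then obtain K t1 where K: "0 < t1" "0 \<le> K" "\<And>t. 0 < t \<Longrightarrow> t \<le> t1 \<Longrightarrow>
      sup_potential_integral k p \<mu> t \<le> ennreal C * sup_green_integral \<nu> \<beta> p \<mu> r + ennreal (K * t)"
      using *[OF r(1,2) sets] by blast
    define t where "t = min t1 (e / (4 * (K + 1)))"
    have t: "0 < t" "t \<le> t1" "t \<le> e / (4 * (K + 1))" using K e by (auto simp: t_def)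
    have "K * t \<le> (K + 1) * (e / (4 * (K + 1)))" using t K by (intro mult_mono) auto
    also have "\<dots> = e / 4" using K by (simp add: field_simps)
    finally have Kt: "K * t < e / 2" using e by simp
    have "sup_potential_integral k p \<mu> t \<le> ennreal C * sup_green_integral \<nu> \<beta> p \<mu> r + ennreal (K * t)"
      using K(3) t by blast
    also have "\<dots> \<le> ennreal C * ennreal (e / (2 * C)) + ennreal (K * t)"
      using r by (intro add_mono mult_left_mono) auto
    also have "\<dots> = ennreal (e / 2 + K * t)" using C e K t by (simp flip: ennreal_mult ennreal_plus)
    also have "\<dots> < ennreal e" using Kt e by (intro ennreal_lessI) auto
    finally show ?thesis using t by blast
  qed
  moreover have "radon_measure \<mu>"
  proof -
    obtain r where r: "0 < r" "r \<le> r1" "sup_green_integral \<nu> \<beta> p \<mu> r < ennreal 1"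
      using small'[of 1] by auto
    then obtain g where g: "\<And>x. emeasure \<mu> (ball x r) \<le> ennreal g * sup_green_integral \<nu> \<beta> p \<mu> r"
      using ball_le_sup_green_integral[OF sets nb, of r p] C p by auto
    have "sup_green_integral \<nu> \<beta> p \<mu> r < \<top>" using r(3) ennreal_less_top by (rule order.strict_trans)
    then show ?thesis
      by (intro radon_measureI_uniform_balls[OF sets r(1) g]) (simp add: ennreal_mult_less_top)
  qed
  ultimately show "\<mu> \<in> S_K k p" by (simp add: S_K_iff[OF p0])
qed

lemma D_class_eq_S_D_if_beta_le_nu:
  assumes nb: "\<beta> \<le> \<nu>" and p: "1 \<le> p"
  shows "D_class \<nu> \<beta> p = S_D k p"
proof (intro set_eqI iffI)
  have p0: "0 \<le> p" using p by simp
  fix \<mu> :: "'a measure" assume "\<mu> \<in> S_D k p"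
  then obtain t where rad: "radon_measure \<mu>" and t: "0 < t" "sup_potential_integral k p \<mu> t < \<infinity>"
    by (auto simp: S_D_def sup_potential_integral_def)
  then have sets: "sets \<mu> = sets borel" by (simp add: radon_measure_def)
  obtain c where c: "0 < c" and *: "\<And>t (\<mu> :: 'a measure). 0 < t \<Longrightarrow> t \<le> T \<Longrightarrow> sets \<mu> = sets borel \<Longrightarrow>
    \<exists>r>0. r < 1 \<and> ennreal c * sup_green_integral \<nu> \<beta> p \<mu> r \<le> sup_potential_integral k p \<mu> t"
    using sup_green_integral_le[OF nb p] by blast
  obtain r where r: "0 < r" "r < 1"
    and le: "ennreal c * sup_green_integral \<nu> \<beta> p \<mu> r \<le> sup_potential_integral k p \<mu> (min t T)"
    using *[of "min t T" \<mu>] T_pos sets t by auto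
  have "sup_potential_integral k p \<mu> (min t T) \<le> sup_potential_integral k p \<mu> t"
    using p0 by (intro sup_potential_integral_mono) auto
  then have "ennreal c * sup_green_integral \<nu> \<beta> p \<mu> r < \<infinity>" using le t by auto
  then have "sup_green_integral \<nu> \<beta> p \<mu> r < \<infinity>" using c by (auto simp: ennreal_mult_less_top)
  then show "\<mu> \<in> D_class \<nu> \<beta> p"
    using nb r sets by (auto simp: D_class_def sup_green_integral_def)
next
  fix \<mu> :: "'a measure" assume "\<mu> \<in> D_class \<nu> \<beta> p"
  then obtain r where sets: "sets \<mu> = sets borel" and r: "0 < r" "sup_green_integral \<nu> \<beta> p \<mu> r < \<infinity>"
    using nb by (auto simp: D_class_def sup_green_integral_def)
  obtain C r1 where C: "0 < C" "0 < r1" "r1 < 1" and *: "\<And>r (\<mu> :: 'a measure). 0 < r \<Longrightarrow> r \<le> r1 \<Longrightarrow>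
    sets \<mu> = sets borel \<Longrightarrow> sup_green_integral \<nu> \<beta> p \<mu> r < \<infinity> \<Longrightarrow>
    \<exists>K t1. 0 < t1 \<and> 0 \<le> K \<and> (\<forall>t. 0 < t \<longrightarrow> t \<le> t1 \<longrightarrow>
      sup_potential_integral k p \<mu> t \<le> ennreal C * sup_green_integral \<nu> \<beta> p \<mu> r + ennreal (K * t))"
    using sup_potential_integral_le[OF nb p] by blast
  define r' where "r' = min r r1"
  have r': "0 < r'" "r' \<le> r1" using r C by (auto simp: r'_def)
  have "sup_green_integral \<nu> \<beta> p \<mu> r' \<le> sup_green_integral \<nu> \<beta> p \<mu> r"
    unfolding r'_def by (intro sup_green_integral_mono) auto
  then have fin: "sup_green_integral \<nu> \<beta> p \<mu> r' < \<infinity>" using r by auto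
  then obtain K t where K: "0 < t"
    "sup_potential_integral k p \<mu> t \<le> ennreal C * sup_green_integral \<nu> \<beta> p \<mu> r' + ennreal (K * t)"
    using *[OF r' sets] by blast
  have "ennreal C * sup_green_integral \<nu> \<beta> p \<mu> r' + ennreal (K * t) < \<infinity>"
    using fin by (simp add: ennreal_mult_less_top)
  with K(2) have "sup_potential_integral k p \<mu> t < \<infinity>" by (rule order.strict_trans1)
  moreover have "radon_measure \<mu>"
  proof -
    obtain g where g: "\<And>x. emeasure \<mu> (ball x r') \<le> ennreal g * sup_green_integral \<nu> \<beta> p \<mu> r'"
      using ball_le_sup_green_integral[OF sets nb, of r' p] r' C p by auto
    then show ?thesis using fin
      by (intro radon_measureI_uniform_balls[OF sets r'(1) g]) (simp add: ennreal_mult_less_top)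
  qed
  ultimately show "\<mu> \<in> S_D k p"
    using K(1) by (auto simp: S_D_def sup_potential_integral_def)
qed

text \<open>
  The inclusions \<open>S_K \<subseteq> S_D \<subseteq> D_class = K_class \<subseteq> S_K\<close> close a circle. The second uses that the
  potential at a fixed time is bounded below for distances up to 1, the last that near the diagonal it is at most a
  multiple of \<open>t\<^bsup>1-\<nu>/\<beta>\<^esup>\<close>.
\<close>

lemma classes_eq_if_nu_less_beta:
  assumes nb: "\<nu> < \<beta>" and p: "1 \<le> p"
  shows "K_class \<nu> \<beta> p = S_K k p" "D_class \<nu> \<beta> p = S_D k p"
proof -
  have p0: "0 \<le> p" using p by simp
  have KD: "K_class \<nu> \<beta> p = (D_class \<nu> \<beta> p :: 'a measure set)"
    using nb by (auto simp: K_class_def D_class_def)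
  have D_iff: "\<mu> \<in> D_class \<nu> \<beta> p \<longleftrightarrow> sets \<mu> = sets borel \<and> (SUP x. emeasure \<mu> {y. dist x y \<le> 1}) < \<infinity>"
    for \<mu> :: "'a measure" using nb by (simp add: D_class_def)
  have "S_K k p \<subseteq> S_D k p"
  proof
    fix \<mu> :: "'a measure" assume "\<mu> \<in> S_K k p"
    then have rad: "radon_measure \<mu>" and small: "\<forall>e>0. \<exists>t>0. sup_potential_integral k p \<mu> t < ennreal e"
      by (auto simp: S_K_iff[OF p0])
    obtain t where "0 < t" and t: "sup_potential_integral k p \<mu> t < ennreal 1"
      using small[rule_format, of 1] by auto
    moreover have "sup_potential_integral k p \<mu> t < \<top>" using t ennreal_less_top by (rule order.strict_trans)
    ultimately show "\<mu> \<in> S_D k p"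
      using rad by (auto simp: S_D_def sup_potential_integral_def)
  qed
  moreover have "S_D k p \<subseteq> D_class \<nu> \<beta> p"
  proof
    fix \<mu> :: "'a measure" assume "\<mu> \<in> S_D k p"
    then obtain t0 where rad: "radon_measure \<mu>" and t0: "0 < t0" "sup_potential_integral k p \<mu> t0 < \<infinity>"
      by (auto simp: S_D_def sup_potential_integral_def)
    then have sets [measurable_cong]: "sets \<mu> = sets borel" by (simp add: radon_measure_def)
    define t where "t = min t0 T"
    have t: "0 < t" "t \<le> T" using t0 T_pos by (auto simp: t_def)
    define P where "P = \<Phi>1 (1 / (t / 4) powr (1 / \<beta>))"
    define e where "e = 1 - \<nu> / \<beta>"
    have e: "0 < e" using nb beta_pos by (simp add: e_def)
    define c where "c = P * (((t / 2) powr e - (t / 4) powr e) / e)"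
    have "(t / 4) powr e < (t / 2) powr e" using t e by (intro powr_less_mono2) auto
    then have c: "0 < c" using e t by (simp add: c_def P_def Phi1_pos)
    have le: "ennreal c \<le> time_integral k t x y" if "dist x y \<le> 1" for x y
    proof -
      have I: "(\<integral>\<^sup>+s\<in>{t / 4..t / 2}. ennreal (s powr (- \<nu> / \<beta>)) \<partial>lborel)
          = ennreal (((t / 2) powr e - (t / 4) powr e) / e)"
        using nn_integral_powr[of "- \<nu> / \<beta>" "t / 4" "t / 2"] t e nb by (simp add: e_def)
      have "ennreal c = ennreal P * (\<integral>\<^sup>+s\<in>{t / 4..t / 2}. ennreal (s powr (- \<nu> / \<beta>)) \<partial>lborel)"
        unfolding I c_def by (rule ennreal_mult') (simp add: P_def Phi1_pos less_imp_le)
      also have "\<dots> \<le> time_integral k t x y"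
        unfolding P_def using t that by (intro time_integral_ge) auto
      finally show ?thesis .
    qed
    have "ennreal (c powr p) * emeasure \<mu> {y. dist x y \<le> 1} \<le> sup_potential_integral k p \<mu> t0" for x
    proof -
      have "ennreal (c powr p) * emeasure \<mu> {y. dist x y \<le> 1}
          = (\<integral>\<^sup>+y. ennreal (c powr p) * indicator {y. dist x y \<le> 1} y \<partial>\<mu>)"
        by (subst nn_integral_cmult_indicator) auto
      also have "\<dots> \<le> (\<integral>\<^sup>+y. ennpowr (time_integral k t0 x y) p \<partial>\<mu>)"
      proof (rule nn_integral_mono)
        fix y
        have "ennreal (c powr p) \<le> ennpowr (time_integral k t0 x y) p" if "dist x y \<le> 1"
        proof -
          have "ennreal c \<le> time_integral k t0 x y"
            using le[OF that] time_integral_mono[of t t0 k x y] by (auto simp: t_def intro: order.trans)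
          then have "ennpowr (ennreal c) p \<le> ennpowr (time_integral k t0 x y) p"
            using p0 by (rule ennpowr_mono)
          then show ?thesis using c by (simp add: ennpowr_def)
        qed
        then show "ennreal (c powr p) * indicator {y. dist x y \<le> 1} y \<le> ennpowr (time_integral k t0 x y) p"
          by (auto simp: indicator_def)
      qed
      also have "\<dots> \<le> sup_potential_integral k p \<mu> t0"
        unfolding sup_potential_integral_def by (intro SUP_upper) auto
      finally show ?thesis .
    qed
    then have "ennreal (c powr p) * (SUP x. emeasure \<mu> {y. dist x y \<le> 1}) \<le> sup_potential_integral k p \<mu> t0"
      by (subst SUP_mult_left_ennreal) (auto intro!: SUP_least)
    then have "ennreal (c powr p) * (SUP x. emeasure \<mu> {y. dist x y \<le> 1}) < \<infinity>" using t0 by auto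
    then have "(SUP x. emeasure \<mu> {y. dist x y \<le> 1}) < \<infinity>" using c by (auto simp: ennreal_mult_less_top)
    then show "\<mu> \<in> D_class \<nu> \<beta> p" using sets by (simp add: D_iff)
  qed
  moreover have "D_class \<nu> \<beta> p \<subseteq> S_K k p"
  proof
    fix \<mu> :: "'a measure" assume "\<mu> \<in> D_class \<nu> \<beta> p"
    then have sets [measurable_cong]: "sets \<mu> = sets borel" and fin: "(SUP x. emeasure \<mu> {y. dist x y \<le> 1}) < \<infinity>"
      by (auto simp: D_iff)
    obtain r0 where r0: "0 < r0" and far: "\<And>r (\<mu> :: 'a measure) M. 0 < r \<Longrightarrow> r \<le> r0 \<Longrightarrow> sets \<mu> = sets borel \<Longrightarrow>
      (\<And>x. emeasure \<mu> (ball x r) \<le> M) \<Longrightarrow> M < \<infinity> \<Longrightarrow>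
      \<exists>K t1. 0 < t1 \<and> 0 \<le> K \<and> (\<forall>t x. 0 < t \<longrightarrow> t \<le> t1 \<longrightarrow>
        (\<integral>\<^sup>+y\<in>{y. r \<le> dist x y}. ennpowr (majorant t (dist x y)) p \<partial>\<mu>) \<le> ennreal (K * t))"
      using far_part[OF p] by blast
    define r where "r = min r0 1"
    have r: "0 < r" "r \<le> r0" "r \<le> 1" using r0 by (auto simp: r_def)
    define M where "M = enn2real (SUP x. emeasure \<mu> {y. dist x y \<le> 1})"
    have M: "0 \<le> M" "ennreal M = (SUP x. emeasure \<mu> {y. dist x y \<le> 1})" using fin by (auto simp: M_def)
    have ball: "emeasure \<mu> (ball x r) \<le> ennreal M" for x
    proof -
      have "emeasure \<mu> (ball x r) \<le> emeasure \<mu> {y. dist x y \<le> 1}"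
        using r by (intro emeasure_mono) auto
      also have "\<dots> \<le> ennreal M" unfolding M(2) by (intro SUP_upper) auto
      finally show ?thesis .
    qed
    obtain K t1 where K: "0 < t1" "0 \<le> K"
      and far': "\<And>t x. 0 < t \<Longrightarrow> t \<le> t1 \<Longrightarrow>
        (\<integral>\<^sup>+y\<in>{y. r \<le> dist x y}. ennpowr (majorant t (dist x y)) p \<partial>\<mu>) \<le> ennreal (K * t)"
      using far[OF r(1,2) sets ball] by auto
    define e where "e = 1 - \<nu> / \<beta>"
    have e: "0 < e" using nb beta_pos by (simp add: e_def)
    define C where "C = \<Phi>2 0 / e"
    have C: "0 < C" using e by (simp add: C_def Phi2_pos)
    define h where "h t = (C * t powr e) powr p * M + K * t" for t
    have S_le: "sup_potential_integral k p \<mu> t \<le> ennreal (h t)" if t: "0 < t" "t \<le> min t1 T" for t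
      unfolding sup_potential_integral_def
    proof (rule SUP_least)
      fix x :: 'a
      have U: "majorant t (dist x y) \<le> ennreal (C * t powr e)" for y
        using majorant_le_powr[OF nb, of t "dist x y"] t by (simp add: C_def e_def)
      have "(\<integral>\<^sup>+y\<in>{y. dist x y < r}. ennpowr (majorant t (dist x y)) p \<partial>\<mu>)
        \<le> (\<integral>\<^sup>+y. ennreal ((C * t powr e) powr p) * indicator (ball x r) y \<partial>\<mu>)"
      proof (rule nn_integral_mono)
        fix y
        have "ennpowr (majorant t (dist x y)) p \<le> ennreal ((C * t powr e) powr p)"
          using ennpowr_mono[OF U[of y] p0] C by (simp add: ennpowr_def)
        then show "ennpowr (majorant t (dist x y)) p * indicator {y. dist x y < r} y
          \<le> ennreal ((C * t powr e) powr p) * indicator (ball x r) y" by (auto simp: indicator_def)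
      qed
      also have "\<dots> = ennreal ((C * t powr e) powr p) * emeasure \<mu> (ball x r)"
        by (simp add: nn_integral_cmult_indicator sets)
      also have "\<dots> \<le> ennreal ((C * t powr e) powr p) * ennreal M" by (intro mult_left_mono ball) auto
      finally have near: "(\<integral>\<^sup>+y\<in>{y. dist x y < r}. ennpowr (majorant t (dist x y)) p \<partial>\<mu>)
        \<le> ennreal ((C * t powr e) powr p) * ennreal M" .
      have "(\<integral>\<^sup>+y. ennpowr (time_integral k t x y) p \<partial>\<mu>)
          \<le> (\<integral>\<^sup>+y\<in>{y. dist x y < r}. ennpowr (majorant t (dist x y)) p \<partial>\<mu>)
            + (\<integral>\<^sup>+y\<in>{y. r \<le> dist x y}. ennpowr (majorant t (dist x y)) p \<partial>\<mu>)"
        using t p by (intro potential_integral_split sets) auto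
      also have "\<dots> \<le> ennreal ((C * t powr e) powr p) * ennreal M + ennreal (K * t)"
        using t by (intro add_mono near far') auto
      also have "\<dots> = ennreal (h t)"
        using M(1) K t by (simp add: h_def flip: ennreal_mult ennreal_plus)
      finally show "(\<integral>\<^sup>+y. ennpowr (time_integral k t x y) p \<partial>\<mu>) \<le> ennreal (h t)" .
    qed
    have lim: "(h \<longlongrightarrow> (C * 0 powr e) powr p * M + K * 0) (at_right 0)"
      unfolding h_def using e p C
      by (intro tendsto_intros tendsto_powr' tendsto_mult)
        (auto simp: eventually_at_filter intro!: tendsto_eq_intros always_eventually)
    have "\<exists>t>0. sup_potential_integral k p \<mu> t < ennreal \<epsilon>" if \<epsilon>: "0 < \<epsilon>" for \<epsilon>
    proof -
      have "\<forall>\<^sub>F t in at_right 0. h t < \<epsilon>"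
        using order_tendstoD(2)[OF lim, of \<epsilon>] \<epsilon> p by simp
      then obtain b where b: "0 < b" "\<And>t. 0 < t \<Longrightarrow> t < b \<Longrightarrow> h t < \<epsilon>"
        unfolding eventually_at_right_field by auto
      define t where "t = min (b / 2) (min t1 T)"
      have t: "0 < t" "t < b" "t \<le> min t1 T" using b K T_pos by (auto simp: t_def)
      have "ennreal (h t) < ennreal \<epsilon>" using b(2) t \<epsilon> by (intro ennreal_lessI) auto
      then show ?thesis using S_le[of t] t by (intro exI[of _ t]) auto
    qed
    moreover have "radon_measure \<mu>"
      by (rule radon_measureI_uniform_balls[OF sets r(1) ball]) simp
    ultimately show "\<mu> \<in> S_K k p" by (simp add: S_K_iff[OF p0])
  qed
  ultimately show "K_class \<nu> \<beta> p = S_K k p" "D_class \<nu> \<beta> p = S_D k p" using KD by auto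
qed

section \<open>Membership of the reference measure\<close>

lemma emeasure_singleton_eq_0: "emeasure m {x} = 0"
proof -
  obtain C where C: "0 < C" "\<And>a. 0 < a \<Longrightarrow> a \<le> 1 \<Longrightarrow> V a \<le> C * a powr \<nu>"
    using volume_le_powr by blast
  have "((\<lambda>a. ennreal (C * a powr \<nu>)) \<longlongrightarrow> ennreal (C * 0 powr \<nu>)) (at_right 0)"
    using nu_pos by (intro tendsto_ennrealI tendsto_mult tendsto_const tendsto_powr' tendsto_ident_at)
      (auto simp: eventually_at_filter)
  moreover have "\<forall>\<^sub>F a in at_right 0. emeasure m {x} \<le> ennreal (C * a powr \<nu>)"
    unfolding eventually_at_right_field
  proof (intro exI[of _ 1] conjI allI impI)
    fix a :: real assume a: "0 < a" "a < 1"
    have "emeasure m {x} \<le> emeasure m (ball x a)"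
      using a by (intro emeasure_mono) (auto simp: sets_m)
    also have "\<dots> \<le> ennreal (V a)" using a by (intro emeasure_ball_le)
    also have "\<dots> \<le> ennreal (C * a powr \<nu>)" using a C by (intro ennreal_leI) auto
    finally show "emeasure m {x} \<le> ennreal (C * a powr \<nu>)" .
  qed simp
  ultimately have "emeasure m {x} \<le> ennreal (C * 0 powr \<nu>)"
    by (intro tendsto_lowerbound) auto
  then show ?thesis by simp
qed

text \<open>
  This is where the condition on the exponents enters: the singularity of \<open>G\<^sup>p\<close> is weaker than \<open>d\<^bsup>-\<nu>\<^esup>\<close>. For \<open>\<nu> = \<beta>\<close> the logarithm
  is dominated by any negative power, and \<open>\<gamma> = \<nu> / 2\<close> is one admissible choice.
\<close>

lemma (in -) ennpowr_green_le:
  assumes nb: "\<beta> \<le> \<nu>" and nu: "0 < \<nu>" and p: "1 \<le> p" and cond: "0 < \<nu> - p * (\<nu> - \<beta>)"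
  obtains C \<gamma> where "0 < C" "0 \<le> \<gamma>" "\<gamma> < \<nu>"
    "\<And>d. 0 < d \<Longrightarrow> d < 1 \<Longrightarrow> ennpowr (green \<nu> \<beta> d) p \<le> ennreal (C * d powr - \<gamma>)"
proof (cases "\<nu> = \<beta>")
  case True
  define a where "a = \<nu> / (2 * p)"
  have a: "0 < a" "a * p = \<nu> / 2" using nu p by (auto simp: a_def)
  show thesis
  proof (rule that[of "(1 / a) powr p" "\<nu> / 2"])
    fix d :: real assume d: "0 < d" "d < 1"
    have "ln (1 / d) \<le> (1 / d) powr a / a" using d a by (intro ln_powr_bound) auto
    also have "\<dots> = 1 / a * d powr - a" using d by (simp add: powr_divide powr_minus field_simps)
    finally have "ln (1 / d) powr p \<le> (1 / a * d powr - a) powr p"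
      using d p by (intro powr_mono2) auto
    also have "\<dots> = (1 / a) powr p * d powr (- a * p)"
      using a by (simp add: powr_mult powr_powr powr_divide)
    also have "- a * p = - (\<nu> / 2)" using a by simp
    finally show "ennpowr (green \<nu> \<beta> d) p \<le> ennreal ((1 / a) powr p * d powr - (\<nu> / 2))"
      using True d by (simp add: green_def ennpowr_def ennreal_leI)
  qed (use a nu in auto)
next
  case False
  show thesis
  proof (rule that[of 1 "p * (\<nu> - \<beta>)"])
    fix d :: real assume d: "0 < d" "d < 1"
    have "(d powr (\<beta> - \<nu>)) powr p = d powr - (p * (\<nu> - \<beta>))"
      by (simp add: powr_powr algebra_simps)
    then show "ennpowr (green \<nu> \<beta> d) p \<le> ennreal (1 * d powr - (p * (\<nu> - \<beta>)))"
      using False nb d by (simp add: green_def ennpowr_def)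
  qed (use nb p cond in auto)
qed

text \<open>
  The annulus at distance about \<open>b = r / 2\<^sup>j\<close> contributes a multiple of \<open>b\<^bsup>-\<gamma>\<^esup> b\<^sup>\<nu>\<close>, and these bounds form a
  geometric series. The centre of the ball, where the Green function is infinite, is a null set.
\<close>

lemma sup_green_integral_volume_le:
  assumes \<gamma>: "0 \<le> \<gamma>" "\<gamma> < \<nu>" and C: "0 < C"
    and le: "\<And>d. 0 < d \<Longrightarrow> d < 1 \<Longrightarrow> ennpowr (green \<nu> \<beta> d) p \<le> ennreal (C * d powr - \<gamma>)"
  obtains D where "0 < D" "\<And>r. 0 < r \<Longrightarrow> r \<le> 1/2 \<Longrightarrow>
    sup_green_integral \<nu> \<beta> p m r \<le> ennreal (D * r powr (\<nu> - \<gamma>))"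
proof -
  obtain CV where CV: "0 < CV" "\<And>a. 0 < a \<Longrightarrow> a \<le> 1 \<Longrightarrow> V a \<le> CV * a powr \<nu>"
    using volume_le_powr by blast
  define \<delta> where "\<delta> = \<nu> - \<gamma>"
  define q where "q = 2 powr - \<delta>"
  have \<delta>: "0 < \<delta>" using \<gamma> by (simp add: \<delta>_def)
  have q: "0 < q" "q < 1" using \<delta> powr_less_mono[of "-\<delta>" 0 "2::real"] by (auto simp: q_def)
  define D where "D = C * CV * 2 powr \<gamma> * 2 powr \<nu>"
  have D: "0 < D" using C CV by (simp add: D_def)
  have m [measurable_cong]: "sets m = sets borel" by (rule sets_m)
  show thesis
  proof (rule that[of "D / (1 - q)"])
    fix r :: real assume r: "0 < r" "r \<le> 1/2"
    show "sup_green_integral \<nu> \<beta> p m r \<le> ennreal (D / (1 - q) * r powr (\<nu> - \<gamma>))"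
      unfolding sup_green_integral_def
    proof (rule SUP_least)
      fix x :: 'a
      define g where "g j = ennreal (C * (r / 2 ^ Suc j) powr - \<gamma>)" for j :: nat
      define A where "A j = ball x (2 * r / 2 ^ j)" for j :: nat
      have A_sets [measurable]: "A j \<in> sets m" for j by (simp add: A_def sets_m)
      have "{x} \<in> null_sets m" by (intro null_setsI emeasure_singleton_eq_0) (simp add: sets_m)
      then have "AE y in m. y \<notin> {x}" by (rule AE_not_in)
      then have "AE y in m. ennpowr (green \<nu> \<beta> (dist x y)) p * indicator {y. dist x y < r} y
          \<le> (\<Sum>j. g j * indicator (A j) y)"
      proof (rule AE_mp, intro AE_I2 impI)
        fix y assume "y \<notin> {x}"
        then have d0: "0 < dist x y" by auto
        show "ennpowr (green \<nu> \<beta> (dist x y)) p * indicator {y. dist x y < r} y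
          \<le> (\<Sum>j. g j * indicator (A j) y)"
        proof (cases "dist x y < r")
          case True
          then have "1 \<le> r / dist x y" using d0 by simp
          then obtain j where j: "2 ^ j \<le> r / dist x y" "r / dist x y < 2 ^ Suc j"
            using dyadic_index by blast
          have up: "dist x y \<le> r / 2 ^ j" using j(1) d0 by (simp add: field_simps)
          also have "\<dots> < 2 * r / 2 ^ j" using r by (intro divide_strict_right_mono) auto
          finally have y: "y \<in> A j" by (simp add: A_def)
          have "r / 2 ^ Suc j \<le> dist x y" using j(2) d0 by (simp add: field_simps)
          then have "C * dist x y powr - \<gamma> \<le> C * (r / 2 ^ Suc j) powr - \<gamma>"
            using r \<gamma> C by (intro mult_left_mono powr_mono2') auto
          then have "ennpowr (green \<nu> \<beta> (dist x y)) p \<le> g j"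
            using le[of "dist x y"] d0 True r unfolding g_def by (auto intro: order.trans ennreal_leI)
          also have "g j = g j * indicator (A j) y" using y by simp
          also have "\<dots> \<le> (\<Sum>j. g j * indicator (A j) y)"
            using sum_le_suminf[of "\<lambda>j. g j * indicator (A j) y" "{j}"] by (simp del: sum_mult_indicator)
          finally show ?thesis using True by simp
        qed simp
      qed
      then have "green_integral \<nu> \<beta> p m r x \<le> (\<integral>\<^sup>+y. (\<Sum>j. g j * indicator (A j) y) \<partial>m)"
        unfolding green_integral_def by (rule nn_integral_mono_AE)
      also have "\<dots> = (\<Sum>j. g j * emeasure m (A j))"
        by (simp add: nn_integral_suminf nn_integral_cmult_indicator)
      also have "\<dots> \<le> (\<Sum>j. ennreal (D * r powr \<delta> * q ^ j))"
      proof (intro suminf_le allI)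
        fix j :: nat
        define b where "b = r / 2 ^ j"
        have b: "0 < b" using r by (simp add: b_def)
        have "b \<le> r" unfolding b_def using r by (simp add: divide_le_eq)
        then have b1: "2 * b \<le> 1" using r by simp
        have "emeasure m (A j) \<le> ennreal (V (2 * b))"
          unfolding A_def b_def using r emeasure_ball_le[of "2 * r / 2 ^ j" x] by simp
        also have "\<dots> \<le> ennreal (CV * (2 * b) powr \<nu>)" using b b1 by (intro ennreal_leI CV) auto
        finally have "g j * emeasure m (A j)
            \<le> ennreal (C * (b / 2) powr - \<gamma>) * ennreal (CV * (2 * b) powr \<nu>)"
          by (intro mult_mono) (auto simp: g_def b_def mult.commute)
        also have "\<dots> = ennreal (C * (b / 2) powr - \<gamma> * (CV * (2 * b) powr \<nu>))"
          using C by (intro ennreal_mult'[symmetric]) auto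
        also have "C * (b / 2) powr - \<gamma> * (CV * (2 * b) powr \<nu>) = D * b powr \<delta>"
        proof -
          have 1: "(b / 2) powr - \<gamma> = 2 powr \<gamma> * b powr - \<gamma>"
            using b by (simp add: powr_divide powr_minus field_simps)
          have 2: "(2 * b) powr \<nu> = 2 powr \<nu> * b powr \<nu>" using b by (simp add: powr_mult)
          have 3: "b powr \<delta> = b powr - \<gamma> * b powr \<nu>" by (simp add: \<delta>_def flip: powr_add)
          show ?thesis unfolding 1 2 3 by (simp add: D_def)
        qed
        also have "b powr \<delta> = r powr \<delta> * q ^ j"
        proof -
          have "(2 ^ j) powr \<delta> = ((2::real) powr \<delta>) ^ j" by (simp add: powr_powr powr_realpow[symmetric] mult.commute)
          then have "b powr \<delta> = r powr \<delta> / (2 powr \<delta>) ^ j" using r by (simp add: b_def powr_divide)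
          moreover have "q ^ j = 1 / (2 powr \<delta>) ^ j" by (simp add: q_def powr_minus_divide power_one_over)
          ultimately show ?thesis by simp
        qed
        finally show "g j * emeasure m (A j) \<le> ennreal (D * r powr \<delta> * q ^ j)" by (simp add: mult.assoc)
      qed auto
      also have "\<dots> = ennreal (\<Sum>j. D * r powr \<delta> * q ^ j)"
        using D q by (intro suminf_ennreal2 summable_mult summable_geometric) auto
      also have "(\<Sum>j. D * r powr \<delta> * q ^ j) = D / (1 - q) * r powr (\<nu> - \<gamma>)"
        using q by (subst suminf_mult) (auto simp: suminf_geometric \<delta>_def summable_geometric)
      finally show "green_integral \<nu> \<beta> p m r x \<le> ennreal (D / (1 - q) * r powr (\<nu> - \<gamma>))" .
    qed
  qed (use D q in auto)
qed

lemma reference_measure_in_K_class: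
  assumes p: "1 \<le> p" and cond: "0 < \<nu> - p * (\<nu> - \<beta>)"
  shows "m \<in> K_class \<nu> \<beta> p"
proof (cases "\<beta> \<le> \<nu>")
  case True
  obtain C \<gamma> where C: "0 < C" and \<gamma>: "0 \<le> \<gamma>" "\<gamma> < \<nu>"
    and le: "\<And>d. 0 < d \<Longrightarrow> d < 1 \<Longrightarrow> ennpowr (green \<nu> \<beta> d) p \<le> ennreal (C * d powr - \<gamma>)"
    using ennpowr_green_le[OF True nu_pos p cond] by blast
  obtain D where D: "0 < D" "\<And>r. 0 < r \<Longrightarrow> r \<le> 1/2 \<Longrightarrow>
    sup_green_integral \<nu> \<beta> p m r \<le> ennreal (D * r powr (\<nu> - \<gamma>))"
    using sup_green_integral_volume_le[OF \<gamma> C le] by blast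
  have "\<exists>r>0. sup_green_integral \<nu> \<beta> p m r < ennreal e" if e: "0 < e" for e
  proof -
    define r where "r = min (1/2) ((e / (2 * D)) powr (1 / (\<nu> - \<gamma>)))"
    have r: "0 < r" "r \<le> 1/2" using e D by (auto simp: r_def)
    have "r powr (\<nu> - \<gamma>) \<le> ((e / (2 * D)) powr (1 / (\<nu> - \<gamma>))) powr (\<nu> - \<gamma>)"
      using r \<gamma> by (intro powr_mono2) (auto simp: r_def)
    then have "r powr (\<nu> - \<gamma>) \<le> e / (2 * D)" using \<gamma> e D by (simp add: powr_powr)
    then have "D * r powr (\<nu> - \<gamma>) < e" using D e by (simp add: field_simps)
    then have "ennreal (D * r powr (\<nu> - \<gamma>)) < ennreal e" using e by (intro ennreal_lessI)
    then show ?thesis using D(2)[OF r] r by (intro exI[of _ r]) auto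
  qed
  then show ?thesis by (simp add: K_class_iff[OF True] sets_m)
next
  case False
  have "(SUP x. emeasure m {y. dist x y \<le> 1}) \<le> ennreal (V 2)"
  proof (rule SUP_least)
    fix x :: 'a
    have "emeasure m {y. dist x y \<le> 1} \<le> emeasure m (ball x 2)"
      by (intro emeasure_mono) (auto simp: sets_m)
    also have "\<dots> \<le> ennreal (V 2)" by (rule emeasure_ball_le) simp
    finally show "emeasure m {y. dist x y \<le> 1} \<le> ennreal (V 2)" .
  qed
  also have "\<dots> < \<infinity>" by simp
  finally show ?thesis using False by (simp add: K_class_def sets_m)
qed

lemma K_class_subset_D_class: "(K_class \<nu> \<beta> p :: 'a measure set) \<subseteq> D_class \<nu> \<beta> p"
proof (cases "\<beta> \<le> \<nu>")
  case True
  show ?thesis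
  proof
    fix \<mu> :: "'a measure" assume "\<mu> \<in> K_class \<nu> \<beta> p"
    then have sets: "sets \<mu> = sets borel"
      and small: "\<forall>e>0. \<exists>r>0. sup_green_integral \<nu> \<beta> p \<mu> r < ennreal e"
      by (auto simp: K_class_iff[OF True])
    obtain r where r: "0 < r" "sup_green_integral \<nu> \<beta> p \<mu> r < ennreal 1"
      using small[rule_format, of 1] by auto
    have "sup_green_integral \<nu> \<beta> p \<mu> (min r (1/2)) \<le> sup_green_integral \<nu> \<beta> p \<mu> r"
      by (intro sup_green_integral_mono) auto
    also have "\<dots> < \<infinity>" using order.strict_trans[OF r(2) ennreal_less_top] by simp
    finally have "sup_green_integral \<nu> \<beta> p \<mu> (min r (1/2)) < \<infinity>" .
    then show "\<mu> \<in> D_class \<nu> \<beta> p" using True sets r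
      by (auto simp: D_class_def sup_green_integral_def intro!: exI[of _ "min r (1/2)"])
  qed
qed (auto simp: K_class_def D_class_def)

text \<open>
  If \<open>p (\<nu> - \<beta>) \<ge> \<nu>\<close>, then \<open>G\<^sup>p\<close> has integral at least \<open>c a\<^bsup>\<nu> - p(\<nu>-\<beta>)\<^esup> \<ge> c\<close> over \<open>ball x a\<close> for all small \<open>a\<close>. Were
  it integrable near \<open>x\<close>, these integrals would tend to the integral over the null set \<open>{x}\<close>.
\<close>

lemma reference_measure_in_D_class_imp:
  assumes p: "1 \<le> p" and mem: "m \<in> D_class \<nu> \<beta> p"
  shows "0 < \<nu> - p * (\<nu> - \<beta>)"
proof (cases "\<beta> < \<nu>")
  case False
  then have "p * (\<nu> - \<beta>) \<le> 0" using p by (intro mult_nonneg_nonpos) auto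
  then show ?thesis using nu_pos by linarith
next
  case True
  show ?thesis
  proof (rule ccontr)
    assume "\<not> 0 < \<nu> - p * (\<nu> - \<beta>)"
    then have exponent: "\<nu> - p * (\<nu> - \<beta>) \<le> 0" by simp
    obtain r where r: "0 < r" "sup_green_integral \<nu> \<beta> p m r < \<infinity>"
      using mem True by (auto simp: D_class_def sup_green_integral_def)
    obtain c r0 where c: "0 < c" "0 < r0" and
      vol: "\<And>x r. 0 < r \<Longrightarrow> r \<le> r0 \<Longrightarrow> ennreal (c * r powr \<nu>) \<le> emeasure m (ball x r)"
      using volume_lower by blast
    have m [measurable_cong]: "sets m = sets borel" by (rule sets_m)
    define x :: 'a where "x = undefined"
    define f where "f y = ennpowr (green \<nu> \<beta> (dist x y)) p" for y
    have f [measurable]: "f \<in> borel_measurable m" unfolding f_def by measurable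
    define \<rho> where "\<rho> = min r (min r0 1)"
    have \<rho>: "0 < \<rho>" "\<rho> \<le> r" "\<rho> \<le> r0" "\<rho> \<le> 1" using r c by (auto simp: \<rho>_def)
    define A where "A n = ball x (\<rho> / real (Suc n))" for n
    have A_sets: "A n \<in> sets (density m f)" for n by (simp add: A_def sets_m)
    have large: "ennreal c \<le> emeasure (density m f) (A n)" for n
    proof -
      define a where "a = \<rho> / real (Suc n)"
      have a: "0 < a" "a \<le> \<rho>" using \<rho> by (auto simp: a_def divide_le_eq)
      have "ennreal (a powr - (p * (\<nu> - \<beta>))) * emeasure m (ball x a)
          = (\<integral>\<^sup>+y. ennreal (a powr - (p * (\<nu> - \<beta>))) * indicator (ball x a) y \<partial>m)"
        by (simp add: nn_integral_cmult_indicator sets_m)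
      also have "\<dots> \<le> (\<integral>\<^sup>+y. f y * indicator (A n) y \<partial>m)"
      proof (rule nn_integral_mono)
        fix y
        have "ennreal (a powr - (p * (\<nu> - \<beta>))) \<le> f y" if y: "dist x y < a"
        proof (cases "dist x y = 0")
          case False
          have eq: "(dist x y powr (\<beta> - \<nu>)) powr p = dist x y powr - (p * (\<nu> - \<beta>))"
            by (simp add: powr_powr algebra_simps)
          have "a powr - (p * (\<nu> - \<beta>)) \<le> dist x y powr - (p * (\<nu> - \<beta>))"
            using False y p True by (intro powr_mono2') auto
          then show ?thesis using False True eq by (simp add: f_def green_def ennpowr_def ennreal_leI)
        qed (simp add: f_def green_def ennpowr_def)
        then show "ennreal (a powr - (p * (\<nu> - \<beta>))) * indicator (ball x a) y \<le> f y * indicator (A n) y"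
          by (auto simp: indicator_def A_def a_def)
      qed
      also have "\<dots> = emeasure (density m f) (A n)"
        by (subst emeasure_density) (auto simp: A_def sets_m)
      finally have "ennreal (a powr - (p * (\<nu> - \<beta>))) * emeasure m (ball x a) \<le> emeasure (density m f) (A n)" .
      moreover have "ennreal (a powr - (p * (\<nu> - \<beta>))) * ennreal (c * a powr \<nu>)
          \<le> ennreal (a powr - (p * (\<nu> - \<beta>))) * emeasure m (ball x a)"
        using a \<rho> by (intro mult_left_mono vol) auto
      moreover have "ennreal c \<le> ennreal (a powr - (p * (\<nu> - \<beta>))) * ennreal (c * a powr \<nu>)"
      proof -
        have "a powr 0 \<le> a powr (\<nu> - p * (\<nu> - \<beta>))"
          using a \<rho> exponent by (intro powr_mono') auto
        then have "c * 1 \<le> c * a powr (\<nu> - p * (\<nu> - \<beta>))" using a c by (intro mult_left_mono) auto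
        also have "\<dots> = a powr - (p * (\<nu> - \<beta>)) * (c * a powr \<nu>)"
        proof -
          have "a powr (\<nu> - p * (\<nu> - \<beta>)) = a powr - (p * (\<nu> - \<beta>)) * a powr \<nu>"
            unfolding powr_add[symmetric] by simp
          then show ?thesis by simp
        qed
        finally show ?thesis using c by (simp add: ennreal_mult'[symmetric] ennreal_leI)
      qed
      ultimately show ?thesis by (meson order.trans)
    qed
    have "(\<lambda>n. emeasure (density m f) (A n)) \<longlonglongrightarrow> emeasure (density m f) (\<Inter>n. A n)"
    proof (rule Lim_emeasure_decseq)
      show "decseq A" unfolding A_def decseq_def using \<rho>
        by (auto intro!: subset_ball divide_left_mono)
      fix n
      have "emeasure (density m f) (A n) = (\<integral>\<^sup>+y. f y * indicator (A n) y \<partial>m)"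
        by (subst emeasure_density) (auto simp: A_def sets_m)
      also have "\<dots> \<le> green_integral \<nu> \<beta> p m r x"
        unfolding green_integral_def
      proof (rule nn_integral_mono)
        fix y
        have "\<rho> / real (Suc n) \<le> \<rho>" using \<rho>(1) by (simp add: divide_le_eq)
        then have "\<rho> / real (Suc n) \<le> r" using \<rho> by linarith
        then show "f y * indicator (A n) y
            \<le> ennpowr (green \<nu> \<beta> (dist x y)) p * indicator {y. dist x y < r} y"
          by (auto simp: f_def A_def indicator_def)
      qed
      also have "\<dots> \<le> sup_green_integral \<nu> \<beta> p m r"
        unfolding sup_green_integral_def by (intro SUP_upper) auto
      also have "\<dots> < \<infinity>" by (rule r)
      finally show "emeasure (density m f) (A n) \<noteq> \<infinity>" by simp
    qed (use A_sets in auto)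
    moreover have "(\<Inter>n. A n) = {x}"
    proof -
      have "y = x" if y: "\<And>n. dist x y < \<rho> / real (Suc n)" for y
      proof (rule ccontr)
        assume "y \<noteq> x"
        then obtain n where n: "\<rho> / dist x y < real n" using reals_Archimedean2 by blast
        have "\<rho> < real n * dist x y" using n \<open>y \<noteq> x\<close> by (simp add: field_simps)
        also have "\<dots> \<le> real (Suc n) * dist x y" by (intro mult_right_mono) auto
        finally show False using y[of n] by (simp add: field_simps)
      qed
      then show ?thesis using \<rho> by (auto simp: A_def)
    qed
    moreover have "emeasure (density m f) {x} = 0"
    proof -
      have "emeasure (density m f) {x} = (\<integral>\<^sup>+y. f y * indicator {x} y \<partial>m)"
        by (subst emeasure_density) (auto simp: sets_m)
      also have "\<dots> = (\<integral>\<^sup>+y. 0 \<partial>m)"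
        by (intro nn_integral_cong_AE)
          (use emeasure_singleton_eq_0[of x] in \<open>auto intro!: AE_I[of _ _ "{x}"] simp: sets_m indicator_def\<close>)
      finally show ?thesis by simp
    qed
    ultimately have "(\<lambda>n. emeasure (density m f) (A n)) \<longlonglongrightarrow> 0" by simp
    then have "ennreal c \<le> 0" by (rule LIMSEQ_le_const) (use large in auto)
    then show False using c by simp
  qed
qed

theorem Kato_Dynkin_class_equivalence:
  assumes p: "1 \<le> p"
  shows "((m \<in> K_class \<nu> \<beta> p \<and> K_class \<nu> \<beta> p = S_K k p) \<longleftrightarrow>
            (m \<in> D_class \<nu> \<beta> p \<and> D_class \<nu> \<beta> p = S_D k p)) \<and>
         ((m \<in> D_class \<nu> \<beta> p \<and> D_class \<nu> \<beta> p = S_D k p) \<longleftrightarrow>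
            0 < \<nu> - p * (\<nu> - \<beta>))"
proof -
  have "K_class \<nu> \<beta> p = S_K k p" "D_class \<nu> \<beta> p = S_D k p"
    using K_class_eq_S_K_if_beta_le_nu[OF _ p] D_class_eq_S_D_if_beta_le_nu[OF _ p]
      classes_eq_if_nu_less_beta[OF _ p] by (meson not_le)+
  then show ?thesis
    using reference_measure_in_K_class[OF p] reference_measure_in_D_class_imp[OF p] K_class_subset_D_class by blast
qed

end

section \<open>Mass of the kernel and life time\<close>

lemma cemetery_in_sets: "{None} \<in> sets (cemetery_borel :: 'a::topological_space option measure)"
proof -
  have "openin cemetery_topology (Some ` (UNIV :: 'a set))"
    by (auto simp: openin_Alexandroff_compactification)
  then have "Some ` (UNIV :: 'a set) \<in> sets (cemetery_borel :: 'a option measure)"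
    unfolding cemetery_borel_def by (auto simp: sets_measure_of)
  then have "space (cemetery_borel :: 'a option measure) - Some ` UNIV \<in> sets cemetery_borel"
    by (rule sets.compl_sets)
  moreover have "space (cemetery_borel :: 'a option measure) - Some ` UNIV = {None}"
    unfolding cemetery_borel_def by (auto simp: space_measure_of notin_range_Some)
  ultimately show ?thesis by simp
qed

text \<open>
  At a finite time \<open>t\<close> the process sits in the cemetery exactly when its life time is at most \<open>t\<close>, so the mass of
  \<open>k t x\<close> is the probability of having a life time longer than \<open>t\<close>.
\<close>

lemma life_time_condition_imp_kernel_mass:
  assumes hunt: "hunt_process N X P" and kernel: "semigroup_kernel m X P k"
    and life: "life_time_condition X P"
  obtains c t1 where "0 < c" "0 < t1"
    "\<And>x t. 0 < t \<Longrightarrow> t < t1 \<Longrightarrow> ennreal c \<le> (\<integral>\<^sup>+y. ennreal (k t x y) \<partial>m)"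
proof -
  interpret hunt_process N X P by (rule hunt)
  interpret semigroup_kernel m X P k by (rule kernel)
  define s where "s t = (SUP x. measure (P (Some x)) {\<omega> \<in> space (P (Some x)). lifetime X \<omega> \<le> ennreal t})" for t
  obtain l where l: "0 \<le> l" "l < 1" "(s \<longlongrightarrow> l) (at_right 0)"
    using life by (auto simp: life_time_condition_def s_def[abs_def])
  define c where "c = (1 - l) / 2"
  have c: "0 < c" "l < 1 - c" using l by (auto simp: c_def field_simps)
  then obtain t1 where t1: "0 < t1" "\<And>t. 0 < t \<Longrightarrow> t < t1 \<Longrightarrow> s t < 1 - c"
    using order_tendstoD(2)[OF l(3)] unfolding eventually_at_right_field by blast
  show thesis
  proof (rule that[OF c(1) t1(1)])
    fix x t assume t: "0 < t" "t < t1"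
    interpret prob_space "P (Some x)" by (rule prob_P)
    have space: "space (P (Some x)) = space N" using sets_P by (rule sets_eq_imp_space_eq)
    define Z where "Z = {\<omega> \<in> space N. X (ennreal t) \<omega> = None}"
    have Z: "Z \<in> sets (P (Some x))"
    proof -
      have "Z = X (ennreal t) -` {None} \<inter> space N" by (auto simp: Z_def)
      then show ?thesis unfolding sets_P using measurable_sets[OF X_measurable cemetery_in_sets] by simp
    qed
    have "Z = {\<omega> \<in> space (P (Some x)). lifetime X \<omega> \<le> ennreal t}"
      unfolding Z_def space using X_dead by (auto simp: lifetime_def intro!: Inf_lower)
    then have "prob Z \<le> s t"
      unfolding s_def
      by (auto intro!: cSUP_upper bdd_aboveI[of _ 1] prob_space.prob_le_1[OF prob_P])
    then have Z_le: "prob Z < 1 - c" using t1(2)[OF t] by simp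
    have "(\<integral>y. k t x y \<partial>m) = transition X P t (\<lambda>_. 1) x"
      using kernel_transition[OF t(1), of "\<lambda>_. 1" x] by simp
    also have "\<dots> = (\<integral>\<omega>. indicator (space N - Z) \<omega> \<partial>P (Some x))"
      unfolding transition_def
      by (intro Bochner_Integration.integral_cong) (auto simp: space Z_def indicator_def split: option.split)
    also have "\<dots> = prob (space (P (Some x)) - Z)"
      using Z by (simp add: space Int_absorb2)
    also have "\<dots> = 1 - prob Z" using Z by (rule prob_compl)
    finally have int: "c < (\<integral>y. k t x y \<partial>m)" using Z_le by simp
    then have "integrable m (k t x)" using c not_integrable_integral_eq[of m "k t x"] by force
    then have "(\<integral>\<^sup>+y. ennreal (k t x y) \<partial>m) = ennreal (\<integral>y. k t x y \<partial>m)"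
      using kernel_nonneg[OF t(1)] by (intro nn_integral_eq_integral) auto
    then show "ennreal c \<le> (\<integral>\<^sup>+y. ennreal (k t x y) \<partial>m)" using int by (simp add: ennreal_leI)
  qed
qed

section \<open>The equivalence\<close>

theorem corollary3p3:
  fixes m :: "'a::{metric_space, second_countable_topology} measure"
    and Q :: "('a \<Rightarrow> real) \<Rightarrow> ('a \<Rightarrow> real) \<Rightarrow> real"
    and D :: "('a \<Rightarrow> real) set"
    and N :: "'w measure"
    and X :: "ennreal \<Rightarrow> 'w \<Rightarrow> 'a option"
    and P :: "'a option \<Rightarrow> 'w measure"
    and k :: "real \<Rightarrow> 'a \<Rightarrow> 'a \<Rightarrow> real"
    and p \<nu> \<beta> :: real
    and t0 :: ennreal
    and V :: "real \<Rightarrow> real"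
  assumes E_locally_compact: "locally_compact_space (euclidean :: 'a topology)"
    and m_radon: "radon_measure m"
    and m_support: "full_support m"
    and form: "regular_dirichlet_form m Q D"
    and hunt: "hunt_process N X P"
    and associated: "associated_process m Q D X P"
    and kernel: "semigroup_kernel m X P k"
    and p: "1 \<le> p" and \<nu>: "0 < \<nu>" and \<beta>: "0 < \<beta>" and t0: "0 < t0"
    and V_positive: "\<And>r. 0 < r \<Longrightarrow> 0 < V r"
    and V_increasing: "mono_on {0<..} V"
    and life_time: "life_time_condition X P"
    and bishop: "bishop_type m \<nu> V"
    and estimates: "heat_kernel_estimates \<nu> \<beta> t0 V k"
  shows "((m \<in> K_class \<nu> \<beta> p \<and> K_class \<nu> \<beta> p = S_K k p) \<longleftrightarrow>
            (m \<in> D_class \<nu> \<beta> p \<and> D_class \<nu> \<beta> p = S_D k p)) \<and>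
         ((m \<in> D_class \<nu> \<beta> p \<and> D_class \<nu> \<beta> p = S_D k p) \<longleftrightarrow>
            0 < \<nu> - p * (\<nu> - \<beta>))"
proof -
  obtain \<Phi>1 \<Phi>2 :: "real \<Rightarrow> real" where
    \<Phi>1: "\<forall>r\<ge>0. 0 < \<Phi>1 r" "antimono_on {0..} \<Phi>1" and
    \<Phi>2: "\<forall>r\<ge>0. 0 < \<Phi>2 r" "antimono_on {0..} \<Phi>2" and
    moment: "(\<integral>\<^sup>+t\<in>{1..}. ennreal (max (V t) (t powr \<nu>) * \<Phi>2 t / t) \<partial>lborel) < \<infinity>" and
    bounds: "\<forall>x y t. 0 < t \<and> ennreal t < t0 \<longrightarrow>
       1 / t powr (\<nu> / \<beta>) * \<Phi>1 (dist x y / t powr (1 / \<beta>)) \<le> k t x y \<and>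
       k t x y \<le> 1 / t powr (\<nu> / \<beta>) * \<Phi>2 (dist x y / t powr (1 / \<beta>))"
    using estimates unfolding heat_kernel_estimates_def by (elim exE conjE)
  obtain c t1 where c: "0 < c" "0 < t1"
    "\<And>x t. 0 < t \<Longrightarrow> t < t1 \<Longrightarrow> ennreal c \<le> (\<integral>\<^sup>+y. ennreal (k t x y) \<partial>m)"
    using life_time_condition_imp_kernel_mass[OF hunt kernel life_time] by blast
  obtain t2 where t2: "0 < t2" "ennreal t2 \<le> t0"
    using t0 by (cases t0) (auto intro: that[of 1])
  have less_t0: "ennreal t < t0" if "0 < t" "t < min t1 t2" for t
    using that t2 by (intro order.strict_trans2[OF ennreal_lessI t2(2)]) auto
  have eq: "1 / t powr (\<nu> / \<beta>) = t powr (- \<nu> / \<beta>)" for t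
    by (simp add: powr_minus divide_inverse)
  interpret heat_kernel_bounds m k \<nu> \<beta> "min t1 t2" c V \<Phi>1 \<Phi>2
  proof
    show "sets m = sets borel" using m_radon by (simp add: radon_measure_def)
    show "V r \<le> V s" if "0 < r" "r \<le> s" for r s
      using that by (intro monotone_onD[OF V_increasing]) auto
    show "mono_on {0<..} (\<lambda>r. V r / r powr \<nu>) \<or> bounded ((\<lambda>r. V r / r powr \<nu>) ` {0<..})"
      using bishop by (simp add: bishop_type_def)
    show "emeasure m (ball x r) \<le> ennreal (V r)" if "0 < r" for x r
      using bishop that SUP_upper[of x UNIV "\<lambda>x. emeasure m (ball x r)"]
      by (auto simp: bishop_type_def intro: order.trans)
    show "\<Phi>1 s \<le> \<Phi>1 r" if "0 \<le> r" "r \<le> s" for r s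
      using monotone_onD[OF \<Phi>1(2), of r s] that by auto
    show "\<Phi>2 s \<le> \<Phi>2 r" if "0 \<le> r" "r \<le> s" for r s
      using monotone_onD[OF \<Phi>2(2), of r s] that by auto
    show "t powr (- \<nu> / \<beta>) * \<Phi>1 (dist x y / t powr (1 / \<beta>)) \<le> k t x y"
      if "0 < t" "t < min t1 t2" for x y t
      using bounds[rule_format, OF conjI[OF that(1) less_t0[OF that]], of x y] unfolding eq by simp
    show "k t x y \<le> t powr (- \<nu> / \<beta>) * \<Phi>2 (dist x y / t powr (1 / \<beta>))"
      if "0 < t" "t < min t1 t2" for x y t
      using bounds[rule_format, OF conjI[OF that(1) less_t0[OF that]], of x y] unfolding eq by simp
  qed (use \<nu> \<beta> c t2 V_positive \<Phi>1(1) \<Phi>2(1) moment in simp_all)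
  show ?thesis by (rule Kato_Dynkin_class_equivalence[OF p])
qed

end
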